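(* Let $M$ be a Hopf hypersurface of the homogeneous nearly K\"ahler $\mathbf{S}^3\times\mathbf{S}^3$ with three distinct principal curvatures. If $P\{U\}^\perp=\{U\}^\perp$, then, up to isometries of type $\mathcal{F}_{abc}$, $M$ is locally (i.e. an open part of) the image of one of the embeddings $f_r,f_r',f_r'':\mathbf{S}^3\times\mathbf{S}^2\to\mathbf{S}^3\times\mathbf{S}^3$ given by $$f_r(x,y)=(x,\sqrt{1-r^2}+ry),\qquad f_r'=\mathcal{F}_1\circ f_r,\qquad f_r''=\mathcal{F}_2\circ f_r,$$ for some $0<r\le 1$, where $x\in\mathbf{S}^3$ and $y\in\mathbf{S}^2\subset\mathbb{R}^3$.
   Context: Regard $\mathbf{S}^3$ as the unit quaternions and $\mathbf{S}^2$ as the unit imaginary quaternions in $\mathbb{H}$. Write tangent vectors at $(p,q)\in\mathbf{S}^3\times\mathbf{S}^3$ as $Z=(U,V)$. The homogeneous NK structure: $JZ=\tfrac{1}{\sqrt3}(2pq^{-1}V-U,\,-2qp^{-1}U+V)$, $g(Z,Z')=\tfrac43(\langle U,U'\rangle+\langle V,V'\rangle)-\tfrac23(\langle p^{-1}U,q^{-1}V'\rangle+\langle p^{-1}U',q^{-1}V\rangle)$ with $\langle\cdot,\cdot\rangle$ the Euclidean product metric. The almost product structure is $PZ=(pq^{-1}V,\,qp^{-1}U)$. The maps $\mathcal{F}_1(p,q)=(q,p)$, $\mathcal{F}_2(p,q)=(\bar p,q\bar p)$ and $\mathcal{F}_{abc}(p,q)=(ap\bar c,bq\bar c)$ ($a,b,c$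 unit quaternions) are isometries of this NK manifold. For a connected orientable hypersurface $M$ with unit normal $\xi$ and shape operator $A$, the structure vector field is $U=-J\xi$; $M$ is Hopf if the integral curves of $U$ are geodesics (equivalently $AU=\alpha U$ for some function $\alpha$). $\{U\}^\perp$ denotes the distribution on $M$ of tangent vectors orthogonal to $U$ (the holomorphic distribution). "Three distinct principal curvatures" means $A$ has exactly three distinct eigenvalues at each point. *)

theory Defs
  imports "HOL-Analysis.Analysis"
begin

section \<open>Quaternions as pairs of complex numbers: (z,w) stands for z + w j\<close>

type_synonym quat = "complex \<times> complex"

definition qmul :: "quat \<Rightarrow> quat \<Rightarrow> quat" where
  "qmul p q = (fst p * fst q - snd p * cnj (snd q), fst p * snd q + snd p * cnj (fst q))"

definition qconj :: "quat \<Rightarrow> quat" where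
  "qconj p = (cnj (fst p), - snd p)"

definition qinv :: "quat \<Rightarrow> quat" where
  "qinv p = (1 / (norm p)\<^sup>2) *\<^sub>R qconj p"

definition qreal :: "real \<Rightarrow> quat" where
  "qreal s = (complex_of_real s, 0)"

text \<open>Unit quaternions S3, unit imaginary quaternions S2 (a copy of the unit sphere of R3).\<close>

definition S3 :: "quat set" where
  "S3 = {p. norm p = 1}"

definition S2 :: "quat set" where
  "S2 = {y. norm y = 1 \<and> Re (fst y) = 0}"

type_synonym pt = "quat \<times> quat"

section \<open>Nearly Kaehler structure on S3 x S3 (formulas extended to nonzero p, q)\<close>

definition Jnk :: "pt \<Rightarrow> pt \<Rightarrow> pt" where
  "Jnk x Z = (let p = fst x; q = snd x; U = fst Z; V = snd Z in
     (1 / sqrt 3) *\<^sub>R (2 *\<^sub>R qmul (qmul p (qinv q)) V - U,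
                       - 2 *\<^sub>R qmul (qmul q (qinv p)) U + V))"

definition gnk :: "pt \<Rightarrow> pt \<Rightarrow> pt \<Rightarrow> real" where
  "gnk x Z Z' = (let p = fst x; q = snd x; U = fst Z; V = snd Z; U' = fst Z'; V' = snd Z' in
     4/3 * (U \<bullet> U' + V \<bullet> V')
     - 2/3 * (qmul (qinv p) U \<bullet> qmul (qinv q) V' + qmul (qinv p) U' \<bullet> qmul (qinv q) V))"

definition Pnk :: "pt \<Rightarrow> pt \<Rightarrow> pt" where
  "Pnk x Z = (qmul (qmul (fst x) (qinv (snd x))) (snd Z), qmul (qmul (snd x) (qinv (fst x))) (fst Z))"

definition dgnk :: "pt \<Rightarrow> pt \<Rightarrow> pt \<Rightarrow> pt \<Rightarrow> real" where
  "dgnk x W Y Z = deriv (\<lambda>t. gnk (x + t *\<^sub>R W) Y Z) 0"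

definition TS3S3 :: "pt \<Rightarrow> pt set" where
  "TS3S3 x = {Z. fst x \<bullet> fst Z = 0 \<and> snd x \<bullet> snd Z = 0}"

fun ider :: "('a::real_normed_vector \<Rightarrow> 'b::real_normed_vector) \<Rightarrow> 'a list \<Rightarrow> 'a \<Rightarrow> 'b" where
  "ider f [] = f"
| "ider f (v # vs) = (\<lambda>x. frechet_derivative (ider f vs) (at x) v)"

definition smooth_on :: "'a::real_normed_vector set \<Rightarrow> ('a \<Rightarrow> 'b::real_normed_vector) \<Rightarrow> bool" where
  "smooth_on V f \<longleftrightarrow> (\<forall>vs. ider f vs differentiable_on V)"

definition is_chart :: "pt set \<Rightarrow> (real^5 \<Rightarrow> pt) \<Rightarrow> (real^5) set \<Rightarrow> bool" where
  "is_chart M \<phi> V \<longleftrightarrow> open V \<and> smooth_on V \<phi> \<and> inj_on \<phi> V \<and> \<phi> ` V \<subseteq> M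
     \<and> openin (top_of_set M) (\<phi> ` V) \<and> continuous_on (\<phi> ` V) (inv_into V \<phi>)
     \<and> (\<forall>u\<in>V. inj (frechet_derivative \<phi> (at u)))"

definition hypersurface :: "pt set \<Rightarrow> bool" where
  "hypersurface M \<longleftrightarrow> M \<subseteq> S3 \<times> S3 \<and> (\<forall>x\<in>M. \<exists>\<phi> V. is_chart M \<phi> V \<and> x \<in> \<phi> ` V)"

definition smooth_on_mfd :: "pt set \<Rightarrow> (pt \<Rightarrow> pt) \<Rightarrow> bool" where
  "smooth_on_mfd M f \<longleftrightarrow> (\<forall>\<phi> V. is_chart M \<phi> V \<longrightarrow> smooth_on V (f \<circ> \<phi>))"

definition tangent_space :: "pt set \<Rightarrow> pt \<Rightarrow> pt set" where
  "tangent_space M x = {v. \<exists>\<gamma>. (\<forall>t. \<gamma> t \<in> M) \<and> \<gamma> 0 = x \<and> (\<gamma> has_vector_derivative v) (at 0)}"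

definition deriv_along :: "pt set \<Rightarrow> (pt \<Rightarrow> pt) \<Rightarrow> pt \<Rightarrow> pt \<Rightarrow> pt \<Rightarrow> bool" where
  "deriv_along M f x v w \<longleftrightarrow> (\<exists>\<gamma>. (\<forall>t. \<gamma> t \<in> M) \<and> \<gamma> 0 = x \<and> (\<gamma> has_vector_derivative v) (at 0)
      \<and> ((f \<circ> \<gamma>) has_vector_derivative w) (at 0))"

definition unit_normal :: "pt set \<Rightarrow> (pt \<Rightarrow> pt) \<Rightarrow> bool" where
  "unit_normal M \<xi> \<longleftrightarrow> smooth_on_mfd M \<xi> \<and>
     (\<forall>x\<in>M. \<xi> x \<in> TS3S3 x \<and> gnk x (\<xi> x) (\<xi> x) = 1 \<and> (\<forall>v\<in>tangent_space M x. gnk x (\<xi> x) v = 0))"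

text \<open>shape M xi x X Y  means  A X = Y, where A X = - (Levi-Civita derivative of xi along X).
  The Levi-Civita derivative is  D_X xi + Gamma(X, xi)  (ambient Christoffel term of g),
  projected to the tangent space; tested against all tangent vectors Z of M:
  g(Gamma(X,Y),Z) = 1/2 (d_X g(Y,Z) + d_Y g(X,Z) - d_Z g(X,Y)).\<close>
definition shape :: "pt set \<Rightarrow> (pt \<Rightarrow> pt) \<Rightarrow> pt \<Rightarrow> pt \<Rightarrow> pt \<Rightarrow> bool" where
  "shape M \<xi> x X Y \<longleftrightarrow> X \<in> tangent_space M x \<and> Y \<in> tangent_space M x \<and>
     (\<exists>w. deriv_along M \<xi> x X w \<and>
        (\<forall>Z\<in>tangent_space M x. gnk x Y Z =
            - (gnk x w Z + 1/2 * (dgnk x X (\<xi> x) Z + dgnk x (\<xi> x) X Z - dgnk x Z X (\<xi> x)))))"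

definition principal_curvatures :: "pt set \<Rightarrow> (pt \<Rightarrow> pt) \<Rightarrow> pt \<Rightarrow> real set" where
  "principal_curvatures M \<xi> x = {k. \<exists>X. X \<noteq> 0 \<and> shape M \<xi> x X (k *\<^sub>R X)}"

definition structure_vf :: "(pt \<Rightarrow> pt) \<Rightarrow> pt \<Rightarrow> pt" where
  "structure_vf \<xi> x = - Jnk x (\<xi> x)"

definition hopf :: "pt set \<Rightarrow> (pt \<Rightarrow> pt) \<Rightarrow> bool" where
  "hopf M \<xi> \<longleftrightarrow> (\<forall>x\<in>M. \<exists>\<alpha>. shape M \<xi> x (structure_vf \<xi> x) (\<alpha> *\<^sub>R structure_vf \<xi> x))"

definition holo_distr :: "pt set \<Rightarrow> (pt \<Rightarrow> pt) \<Rightarrow> pt \<Rightarrow> pt set" where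
  "holo_distr M \<xi> x = {X \<in> tangent_space M x. gnk x X (structure_vf \<xi> x) = 0}"

definition F1 :: "pt \<Rightarrow> pt" where "F1 x = (snd x, fst x)"
definition F2 :: "pt \<Rightarrow> pt" where "F2 x = (qconj (fst x), qmul (snd x) (qconj (fst x)))"
definition Fabc :: "quat \<Rightarrow> quat \<Rightarrow> quat \<Rightarrow> pt \<Rightarrow> pt" where
  "Fabc a b c x = (qmul (qmul a (fst x)) (qconj c), qmul (qmul b (snd x)) (qconj c))"

definition f_r :: "real \<Rightarrow> quat \<times> quat \<Rightarrow> pt" where
  "f_r r xy = (fst xy, qreal (sqrt (1 - r\<^sup>2)) + r *\<^sub>R snd xy)"

end

theory Submission
  imports Defs
begin

text \<open>
  Write tangent vectors at $(p,q)$ as $(p\alpha, q\beta)$ with $\alpha,\beta$ imaginary, and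
  $\xi = (p m_1, q m_2)$. Invariance of the holomorphic distribution under $P$ forces $m_1$ and
  $m_2$ to be parallel, so the conormal of $M$ is $(a n, b n)$ for a unit imaginary $n$. Symmetry
  of the second fundamental form on vectors with $\alpha,\beta \perp n$ then yields
  $a b (a + b) = 0$. By connectedness one of the three alternatives holds on all of $M$, and they
  say that $q$, $p$ or $q p^{-1}$, respectively, maps $M$ to a surface in $\mathbf{S}^3$ with unit
  normal $N$. An eigenvalue $s$ of the differential of $N$ relative to that of the map contributes
  the two roots of $k^2 + s k = 1/12$ to the principal curvatures, hence at most three of these
  force the surface to be umbilic: $N = \lambda Q + c$ with $\lambda$ and $c$ constant. So the
  surface lies in the hyperplane $\langle Q, c\rangle = -\lambda$, and invariance of domain shows
  that $M$ is open in the resulting model hypersurface.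
\<close>

text \<open>The factors of a b (a + b) name three foliations: a = 0 says that the conormal kills all
  (p c, 0), b = 0 all (0, q c), and a + b = 0 all (p c, q c). These are the tangent directions of
  the fibres of q, p and q p^{-1}, so that map has rank 2 on M and the unit normal of M is the
  fibre-orthogonal lift of the surface normal N. Over a direction with dN = s dQ, the shape operator
  preserves the plane spanned by the fibre-orthogonal lift of the direction and one fibre vector. In
  an orthonormal basis its matrix there has diagonal -s, 0 and off-diagonal entries of absolute
  value 1 / (2 sqrt 3), whence k^2 + s k = 1/12. Two obstacles shape the proof. The vector n is only
  chosen point by point, without smoothness, so whatever gets differentiated has to be written in
  terms of the base point and the normal field. And the metric varies, so symmetry of the second
  fundamental form is derived for the Euclidean conormal, where no Christoffel terms occur.\<close>

section \<open>Second derivatives\<close>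

text \<open>The mean value theorem along \<open>v\<close>, applied to the increment of
  \<open>g\<close> in direction \<open>w\<close>, is followed by a first-order expansion of
  \<open>g' x v\<close> at \<open>u\<close>. The quotient is symmetric in \<open>v\<close> and
  \<open>w\<close>, and this is what makes mixed derivatives commute.\<close>

lemma second_difference_tendsto:
  fixes g :: "'a::real_normed_vector \<Rightarrow> real"
  assumes V: "open V" "u \<in> V"
    and g: "\<And>x. x \<in> V \<Longrightarrow> (g has_derivative g' x) (at x)"
    and L: "((\<lambda>x. g' x v) has_derivative L) (at u)"
  shows "((\<lambda>h. (g (u + h *\<^sub>R v + h *\<^sub>R w) - g (u + h *\<^sub>R v) - g (u + h *\<^sub>R w) + g u) / h\<^sup>2)
           \<longlongrightarrow> L w) (at_right 0)"
proof (rule tendstoI)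
  fix e :: real assume "e > 0"
  define K where "K = norm v + norm w + 1"
  have K: "K \<ge> 1" by (simp add: K_def)
  \<comment> \<open>The errors \<open>E1\<close> and \<open>E2\<close> below are at most
    \<open>e' * (h * K)\<close> each; divided by \<open>h\<close> they add up to at most two thirds
    of \<open>e\<close>.\<close>
  define e' where "e' = e / (3 * K)"
  have e': "e' > 0" using \<open>e > 0\<close> K by (simp add: e'_def)
  interpret L: bounded_linear L using L by (rule has_derivative_bounded_linear)
  obtain d1 where d1: "d1 > 0" "\<And>y. norm (y - u) < d1 \<Longrightarrow> norm (g' y v - g' u v - L (y - u)) \<le> e' * norm (y - u)"
    using L e' unfolding has_derivative_at_alt by blast
  obtain d2 where d2: "d2 > 0" "ball u d2 \<subseteq> V" using V openE by blast
  define d where "d = min d1 d2 / K"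
  have d: "d > 0" using d1 d2 K by (simp add: d_def)
  have main: "dist ((g (u + h *\<^sub>R v + h *\<^sub>R w) - g (u + h *\<^sub>R v) - g (u + h *\<^sub>R w) + g u) / h\<^sup>2) (L w) < e"
    if h: "0 < h" "h < d" for h
  proof -
    have hK: "h * K < min d1 d2" using h K by (simp add: d_def field_simps)
    have small: "norm (s *\<^sub>R v + r *\<^sub>R w) \<le> h * K" if "0 \<le> s" "s \<le> h" "0 \<le> r" "r \<le> h" for s r
    proof -
      have "norm (s *\<^sub>R v + r *\<^sub>R w) \<le> s * norm v + r * norm w"
        using norm_triangle_ineq[of "s *\<^sub>R v" "r *\<^sub>R w"] that by simp
      also have "\<dots> \<le> h * norm v + h * norm w"
        using that by (intro add_mono mult_right_mono) auto
      also have "\<dots> \<le> h * K" using h by (simp add: K_def algebra_simps)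
      finally show ?thesis .
    qed
    have inV: "u + s *\<^sub>R v + r *\<^sub>R w \<in> V" if "0 \<le> s" "s \<le> h" "0 \<le> r" "r \<le> h" for s r
    proof -
      have "norm (s *\<^sub>R v + r *\<^sub>R w) < d2" using small[OF that] hK by linarith
      moreover have "dist u (u + s *\<^sub>R v + r *\<^sub>R w) = norm (s *\<^sub>R v + r *\<^sub>R w)"
        by (metis add.assoc add_diff_cancel_left' dist_norm norm_minus_commute)
      ultimately show ?thesis using d2(2) by auto
    qed
    define F where "F s = g (u + s *\<^sub>R v + h *\<^sub>R w) - g (u + s *\<^sub>R v)" for s
    have der: "(F has_real_derivative (g' (u + s *\<^sub>R v + h *\<^sub>R w) v - g' (u + s *\<^sub>R v) v)) (at s)"
      if "0 \<le> s" "s \<le> h" for s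
    proof -
      have A: "((\<lambda>s. g (u + s *\<^sub>R v + r *\<^sub>R w)) has_real_derivative g' (u + s *\<^sub>R v + r *\<^sub>R w) v) (at s)"
        if r: "0 \<le> r" "r \<le> h" for r
      proof -
        have gd: "(g has_derivative g' (u + s *\<^sub>R v + r *\<^sub>R w)) (at (u + s *\<^sub>R v + r *\<^sub>R w))"
          by (rule g[OF inV[OF \<open>0 \<le> s\<close> \<open>s \<le> h\<close> r]])
        interpret G: bounded_linear "g' (u + s *\<^sub>R v + r *\<^sub>R w)" by (rule has_derivative_bounded_linear[OF gd])
        have "((\<lambda>s. u + s *\<^sub>R v + r *\<^sub>R w) has_derivative (\<lambda>t. t *\<^sub>R v)) (at s)"
          by (auto intro!: derivative_eq_intros)
        from diff_chain_at[OF this gd]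
        show ?thesis
          by (simp add: has_field_derivative_def o_def G.scaleR mult.commute[of _ "g' _ v"])
      qed
      show ?thesis unfolding F_def
        using A[of h] A[of 0] h by (auto intro!: DERIV_diff)
    qed
    obtain s where s: "0 < s" "s < h" "F h - F 0 = (h - 0) * (g' (u + s *\<^sub>R v + h *\<^sub>R w) v - g' (u + s *\<^sub>R v) v)"
      using MVT2[of 0 h F "\<lambda>s. g' (u + s *\<^sub>R v + h *\<^sub>R w) v - g' (u + s *\<^sub>R v) v"] h der by auto
    define E1 where "E1 = g' (u + s *\<^sub>R v + h *\<^sub>R w) v - g' u v - L (s *\<^sub>R v + h *\<^sub>R w)"
    define E2 where "E2 = g' (u + s *\<^sub>R v) v - g' u v - L (s *\<^sub>R v)"
    have "\<bar>E1\<bar> \<le> e' * (h * K)"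
    proof -
      have n: "norm (s *\<^sub>R v + h *\<^sub>R w) \<le> h * K" using s h by (intro small) auto
      have "norm (g' (u + s *\<^sub>R v + h *\<^sub>R w) v - g' u v - L (u + s *\<^sub>R v + h *\<^sub>R w - u)) \<le> e' * norm (u + s *\<^sub>R v + h *\<^sub>R w - u)"
        using n hK by (intro d1(2)) (simp add: add.assoc)
      also have "u + s *\<^sub>R v + h *\<^sub>R w - u = s *\<^sub>R v + h *\<^sub>R w" by simp
      finally show ?thesis using n e' unfolding E1_def by (smt (verit) mult_left_mono real_norm_def)
    qed
    moreover have "\<bar>E2\<bar> \<le> e' * (h * K)"
    proof -
      have n: "norm (s *\<^sub>R v) \<le> h * K" using small[of s 0] s h by auto
      have "norm (g' (u + s *\<^sub>R v) v - g' u v - L (u + s *\<^sub>R v - u)) \<le> e' * norm (u + s *\<^sub>R v - u)"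
        using n hK by (intro d1(2)) simp
      also have "u + s *\<^sub>R v - u = s *\<^sub>R v" by simp
      finally show ?thesis using n e' unfolding E2_def by (smt (verit) mult_left_mono real_norm_def)
    qed
    ultimately have E: "\<bar>E1 - E2\<bar> \<le> 2 * e' * K * h" by (simp add: algebra_simps)
    have "g (u + h *\<^sub>R v + h *\<^sub>R w) - g (u + h *\<^sub>R v) - g (u + h *\<^sub>R w) + g u = F h - F 0"
      by (simp add: F_def)
    also have "\<dots> = h * (h * L w + (E1 - E2))"
      using s(3) by (simp add: E1_def E2_def L.add L.scaleR algebra_simps)
    finally have eq: "g (u + h *\<^sub>R v + h *\<^sub>R w) - g (u + h *\<^sub>R v) - g (u + h *\<^sub>R w) + g u = h * (h * L w + (E1 - E2))" .
    have "(g (u + h *\<^sub>R v + h *\<^sub>R w) - g (u + h *\<^sub>R v) - g (u + h *\<^sub>R w) + g u) / h\<^sup>2 - L w = (E1 - E2) / h"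
      unfolding eq using h by (simp add: field_simps power2_eq_square)
    moreover have "\<bar>(E1 - E2) / h\<bar> \<le> 2 * e' * K" using E h by (simp add: field_simps)
    moreover have "2 * e' * K < e" using \<open>e > 0\<close> K by (simp add: e'_def)
    ultimately show ?thesis by (simp add: dist_real_def)
  qed
  show "\<forall>\<^sub>F h in at_right 0. dist ((g (u + h *\<^sub>R v + h *\<^sub>R w) - g (u + h *\<^sub>R v) - g (u + h *\<^sub>R w) + g u) / h\<^sup>2) (L w) < e"
    unfolding eventually_at_right_field using main d by auto
qed

lemma smooth_on_ider_has_derivative:
  assumes "smooth_on V f" "open V" "u \<in> V"
  shows "(ider f vs has_derivative frechet_derivative (ider f vs) (at u)) (at u)"
  using assms unfolding smooth_on_def
  by (metis at_within_open differentiable_on_def frechet_derivative_works)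

lemma smooth_on_has_derivative:
  assumes "smooth_on V f" "open V" "u \<in> V"
  shows "(f has_derivative frechet_derivative f (at u)) (at u)"
  using smooth_on_ider_has_derivative[OF assms, of "[]"] by simp

text \<open>The head of the list is the outermost derivative. In every coordinate, both sides are
  the limit of the same second difference.\<close>

lemma ider_commute:
  fixes f :: "'a::real_normed_vector \<Rightarrow> 'b::euclidean_space"
  assumes f: "smooth_on V f" and V: "open V" "u \<in> V"
  shows "ider f [w, v] u = ider f [v, w] u"
proof (rule euclidean_eqI)
  fix b :: 'b assume "b \<in> Basis"
  define g where "g x = f x \<bullet> b" for x
  define g' where "g' x v = frechet_derivative f (at x) v \<bullet> b" for x v
  have g: "(g has_derivative g' x) (at x)" if "x \<in> V" for x
    unfolding g_def g'_def using smooth_on_has_derivative[OF f V(1) that]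
    by (rule has_derivative_inner_left)
  have L: "((\<lambda>x. g' x v) has_derivative (\<lambda>w. ider f [w, v] u \<bullet> b)) (at u)" for v
    using has_derivative_inner_left[OF smooth_on_ider_has_derivative[OF f V, of "[v]"], of b]
    by (simp add: g'_def)
  have "ider f [w, v] u \<bullet> b = ider f [v, w] u \<bullet> b"
  proof (rule tendsto_unique)
    show "((\<lambda>h. (g (u + h *\<^sub>R v + h *\<^sub>R w) - g (u + h *\<^sub>R v) - g (u + h *\<^sub>R w) + g u) / h\<^sup>2)
           \<longlongrightarrow> ider f [w, v] u \<bullet> b) (at_right 0)"
      by (rule second_difference_tendsto[OF V g L])
    have "((\<lambda>h. (g (u + h *\<^sub>R w + h *\<^sub>R v) - g (u + h *\<^sub>R w) - g (u + h *\<^sub>R v) + g u) / h\<^sup>2)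
           \<longlongrightarrow> ider f [v, w] u \<bullet> b) (at_right 0)"
      by (rule second_difference_tendsto[OF V g L])
    then show "((\<lambda>h. (g (u + h *\<^sub>R v + h *\<^sub>R w) - g (u + h *\<^sub>R v) - g (u + h *\<^sub>R w) + g u) / h\<^sup>2)
           \<longlongrightarrow> ider f [v, w] u \<bullet> b) (at_right 0)"
      by (rule Lim_transform_eventually) (auto intro!: always_eventually simp: add_ac)
  qed simp
  then show "ider f [w, v] u \<bullet> b = ider f [v, w] u \<bullet> b" .
qed

text \<open>\<open>frechet_derivative\<close> is a choice from the set of derivatives at the point,
  and that set depends only on the values nearby.\<close>

lemma frechet_derivative_cong_open:
  assumes "open V" "u \<in> V" "\<And>x. x \<in> V \<Longrightarrow> f x = g x"
  shows "frechet_derivative f (at u) = frechet_derivative g (at u)"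
proof -
  have "(f has_derivative D) (at u) \<longleftrightarrow> (g has_derivative D) (at u)" for D
    using has_derivative_transform_within_open[OF _ assms(1,2)] assms(3) by metis
  then show ?thesis by (simp add: frechet_derivative_def)
qed

section \<open>Smoothness of linear images and of bilinear products\<close>

lemma smooth_on_bounded_linear:
  assumes T: "bounded_linear T" and V: "open V" and f: "smooth_on V f"
  shows "smooth_on V (\<lambda>x. T (f x))"
proof -
  have eq: "ider (\<lambda>x. T (f x)) vs u = T (ider f vs u)" if "u \<in> V" for vs u
    using that
  proof (induction vs arbitrary: u)
    case (Cons v vs)
    have "frechet_derivative (ider (\<lambda>x. T (f x)) vs) (at u) = frechet_derivative (\<lambda>x. T (ider f vs x)) (at u)"
      using Cons by (intro frechet_derivative_cong_open[OF V]) auto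
    also have "\<dots> = (\<lambda>v. T (frechet_derivative (ider f vs) (at u) v))"
      using bounded_linear.has_derivative[OF T smooth_on_ider_has_derivative[OF f V Cons.prems]]
      by (metis frechet_derivative_at)
    finally show ?case by simp
  qed simp
  show ?thesis
    unfolding smooth_on_def differentiable_on_eq_differentiable_at[OF V]
  proof (intro allI ballI)
    fix vs u assume u: "u \<in> V"
    have "((\<lambda>x. T (ider f vs x)) has_derivative (\<lambda>v. T (frechet_derivative (ider f vs) (at u) v))) (at u)"
      by (rule bounded_linear.has_derivative[OF T smooth_on_ider_has_derivative[OF f V u]])
    then have "(ider (\<lambda>x. T (f x)) vs has_derivative (\<lambda>v. T (frechet_derivative (ider f vs) (at u) v))) (at u)"
      using has_derivative_transform_within_open[OF _ V u] eq by (smt (verit))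
    then show "ider (\<lambda>x. T (f x)) vs differentiable at u" by (rule differentiableI)
  qed
qed

text \<open>By the Leibniz rule every iterated derivative of the product is a finite sum of terms
  \<open>B (ider f as) (ider g bs)\<close>. A list of pairs \<open>(as, bs)\<close> encodes such a
  sum as \<open>S\<close>, and \<open>D_eq\<close> shows that differentiation leads from one list to
  another.\<close>

lemma smooth_on_bilinear:
  assumes B: "bounded_bilinear B" and V: "open V" and f: "smooth_on V f" and g: "smooth_on V g"
  shows "smooth_on V (\<lambda>x. B (f x) (g x))"
proof -
  interpret B: bounded_bilinear B by (rule B)
  define S where "S l x = (\<Sum>(as, bs)\<leftarrow>l. B (ider f as x) (ider g bs x))" for l x
  define D where "D l u v = (\<Sum>(as, bs)\<leftarrow>l. B (ider f as u) (frechet_derivative (ider g bs) (at u) v)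
        + B (frechet_derivative (ider f as) (at u) v) (ider g bs u))" for l u v
  have S: "(S l has_derivative D l u) (at u)" if u: "u \<in> V" for l u
  proof (induction l)
    case Nil
    show ?case by (simp add: S_def[abs_def] D_def[abs_def])
  next
    case (Cons ab l)
    obtain as bs where ab: "ab = (as, bs)" by force
    have "S (ab # l) = (\<lambda>x. B (ider f as x) (ider g bs x) + S l x)"
      "D (ab # l) u = (\<lambda>v. (B (ider f as u) (frechet_derivative (ider g bs) (at u) v)
        + B (frechet_derivative (ider f as) (at u) v) (ider g bs u)) + D l u v)"
      by (simp_all add: S_def D_def ab fun_eq_iff)
    then show ?case
      using has_derivative_add[OF B.FDERIV[OF smooth_on_ider_has_derivative[OF f V u, of as]
        smooth_on_ider_has_derivative[OF g V u, of bs]] Cons] by simp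
  qed
  have D_eq: "D l u v = S (concat (map (\<lambda>(as, bs). [(as, v # bs), (v # as, bs)]) l)) u" for l u v
    by (induction l) (auto simp: D_def S_def algebra_simps)
  have ex: "\<exists>l. \<forall>u\<in>V. ider (\<lambda>x. B (f x) (g x)) vs u = S l u" for vs
  proof (induction vs)
    case Nil
    have "\<forall>u\<in>V. ider (\<lambda>x. B (f x) (g x)) [] u = S [([], [])] u" by (simp add: S_def)
    then show ?case ..
  next
    case (Cons v vs)
    then obtain l where l: "\<forall>u\<in>V. ider (\<lambda>x. B (f x) (g x)) vs u = S l u" by blast
    have "ider (\<lambda>x. B (f x) (g x)) (v # vs) u = S (concat (map (\<lambda>(as, bs). [(as, v # bs), (v # as, bs)]) l)) u"
      if u: "u \<in> V" for u
    proof -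
      have "frechet_derivative (ider (\<lambda>x. B (f x) (g x)) vs) (at u) = frechet_derivative (S l) (at u)"
        using l by (intro frechet_derivative_cong_open[OF V u]) auto
      also have "\<dots> = D l u" using frechet_derivative_at[OF S[OF u, of l]] by simp
      finally show ?thesis by (simp add: D_eq)
    qed
    then show ?case by blast
  qed
  show ?thesis
    unfolding smooth_on_def differentiable_on_eq_differentiable_at[OF V]
  proof (intro allI ballI)
    fix vs u assume u: "u \<in> V"
    obtain l where l: "\<forall>u\<in>V. ider (\<lambda>x. B (f x) (g x)) vs u = S l u" using ex by blast
    have "(ider (\<lambda>x. B (f x) (g x)) vs has_derivative D l u) (at u)"
      by (rule has_derivative_transform_within_open[OF S[OF u, of l] V u]) (simp add: l)
    then show "ider (\<lambda>x. B (f x) (g x)) vs differentiable at u" by (rule differentiableI)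
  qed
qed

section \<open>Quaternions and the nearly Kaehler structure\<close>

abbreviation qone :: quat where "qone \<equiv> (1, 0)"

abbreviation qim :: "quat \<Rightarrow> bool" where "qim a \<equiv> Re (fst a) = 0"

text \<open>After squaring, this is Euler's four-square identity.\<close>

lemma norm_qmul: "norm (qmul p q) = norm p * norm q"
proof -
  have "(norm (qmul p q))\<^sup>2 = (norm p * norm q)\<^sup>2"
    unfolding power_mult_distrib power2_norm_eq_inner
    by (simp add: inner_prod_def inner_complex_def qmul_def) algebra
  then show ?thesis by simp
qed

lemma bounded_bilinear_qmul: "bounded_bilinear qmul"
proof
  show "\<exists>K. \<forall>a b. norm (qmul a b) \<le> norm a * norm b * K"
    by (rule exI[of _ 1]) (simp add: norm_qmul)
qed (auto simp: qmul_def algebra_simps scaleR_conv_of_real)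

interpretation qmul: bounded_bilinear qmul by (rule bounded_bilinear_qmul)

lemma qmul_assoc: "qmul (qmul a b) c = qmul a (qmul b c)"
  by (simp add: qmul_def algebra_simps)

lemma qmul_qone [simp]: "qmul a qone = a" "qmul qone a = a"
  by (simp_all add: qmul_def)

lemma bounded_linear_qconj: "bounded_linear qconj"
proof (rule bounded_linear_intro[of _ 1])
  show "norm (qconj x) \<le> norm x * 1" for x
    by (simp add: qconj_def norm_prod_def)
qed (auto simp: qconj_def algebra_simps)

lemma qconj_add: "qconj (a + b) = qconj a + qconj b"
  and qconj_scaleR: "qconj (r *\<^sub>R a) = r *\<^sub>R qconj a"
  by (simp_all add: qconj_def algebra_simps)

lemma qconj_qmul: "qconj (qmul a b) = qmul (qconj b) (qconj a)"
  by (simp add: qmul_def qconj_def algebra_simps)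

lemma qconj_qconj [simp]: "qconj (qconj a) = a"
  by (simp add: qconj_def)

lemma norm_qconj [simp]: "norm (qconj a) = norm a"
  by (simp add: qconj_def norm_prod_def)

lemma qconj_qone [simp]: "qconj qone = qone"
  by (simp add: qconj_def)

lemma qconj_qim: "qim a \<Longrightarrow> qconj a = - a"
  by (simp add: qconj_def prod_eq_iff complex_eq_iff)

lemma qmul_qconj_self: "qmul (qconj a) a = (norm a)\<^sup>2 *\<^sub>R qone" "qmul a (qconj a) = (norm a)\<^sup>2 *\<^sub>R qone"
  unfolding power2_norm_eq_inner
  by (simp_all add: qmul_def qconj_def prod_eq_iff complex_eq_iff inner_prod_def inner_complex_def)

lemma inner_qmul_swap: "qmul a b \<bullet> c = b \<bullet> qmul (qconj a) c" "qmul a b \<bullet> c = a \<bullet> qmul c (qconj b)"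
  by (simp_all add: qmul_def qconj_def inner_prod_def inner_complex_def algebra_simps)

lemma inner_qone: "a \<bullet> qone = Re (fst a)" "qone \<bullet> a = Re (fst a)"
  by (simp_all add: inner_prod_def inner_complex_def)

lemma S3_qmul_qconj [simp]:
  assumes "p \<in> S3"
  shows "qmul (qconj p) p = qone" "qmul p (qconj p) = qone"
  using assms by (simp_all add: S3_def qmul_qconj_self)

lemma S3_cancel [simp]:
  assumes "p \<in> S3"
  shows "qmul (qconj p) (qmul p a) = a" "qmul p (qmul (qconj p) a) = a"
    "qmul (qmul a p) (qconj p) = a" "qmul (qmul a (qconj p)) p = a"
  using assms by (simp_all add: qmul_assoc) (simp_all flip: qmul_assoc)

lemma S3_inner_qmul [simp]:
  assumes "p \<in> S3"
  shows "qmul p a \<bullet> qmul p b = a \<bullet> b" "qmul a p \<bullet> qmul b p = a \<bullet> b"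
  using assms by (simp_all add: inner_qmul_swap(1)[of p] inner_qmul_swap(2)[of _ p])

lemma S3_inner_self_qmul:
  assumes "p \<in> S3"
  shows "p \<bullet> qmul p a = Re (fst a)"
  using S3_inner_qmul(1)[OF assms, of qone a] by (simp only: qmul_qone inner_qone)

lemma S3_norm: "p \<in> S3 \<Longrightarrow> norm p = 1"
  by (simp add: S3_def)

lemma S3_qconj [simp]: "p \<in> S3 \<Longrightarrow> qconj p \<in> S3"
  by (simp add: S3_def)

lemma S3_qmul: "p \<in> S3 \<Longrightarrow> q \<in> S3 \<Longrightarrow> qmul p q \<in> S3"
  by (simp add: S3_def norm_qmul)

lemma S3_qone [simp]: "qone \<in> S3"
  by (simp add: S3_def norm_prod_def)

lemma S3_qinv: "p \<in> S3 \<Longrightarrow> qinv p = qconj p"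
  by (simp add: qinv_def S3_def)

lemma qmul_eq_0: "qmul a b = 0 \<longleftrightarrow> a = 0 \<or> b = 0"
  by (metis mult_eq_0_iff norm_eq_zero norm_qmul)

lemma qmul_qim_commute:
  assumes "qim a" "qim b"
  shows "qmul b a = - qmul a b - (2 * (a \<bullet> b)) *\<^sub>R qone"
  using assms by (simp add: qmul_def prod_eq_iff complex_eq_iff inner_prod_def inner_complex_def)

lemma qim_qmul:
  assumes "qim a" "qim b" shows "qim (qmul a b) \<longleftrightarrow> a \<bullet> b = 0"
  using assms by (simp add: qmul_def inner_prod_def inner_complex_def) (smt (verit))

text \<open>Left translation identifies each tangent space with the pairs of imaginary quaternions.
  In this frame \<open>gnk\<close>, \<open>Jnk\<close> and \<open>Pnk\<close> have constant
  coefficients, so pointwise questions become linear algebra.\<close>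

abbreviation lift :: "pt \<Rightarrow> quat \<Rightarrow> quat \<Rightarrow> pt" where
  "lift x a b \<equiv> (qmul (fst x) a, qmul (snd x) b)"

lemma TS3S3_lift:
  assumes "x \<in> S3 \<times> S3"
  shows "lift x a b \<in> TS3S3 x \<longleftrightarrow> qim a \<and> qim b"
  using assms by (simp add: TS3S3_def mem_Times_iff S3_inner_self_qmul)

lemma TS3S3_liftE:
  assumes "x \<in> S3 \<times> S3" "Z \<in> TS3S3 x"
  obtains a b where "Z = lift x a b" "qim a" "qim b"
proof -
  have Z: "Z = lift x (qmul (qconj (fst x)) (fst Z)) (qmul (qconj (snd x)) (snd Z))"
    using assms(1) by (simp add: mem_Times_iff)
  show ?thesis using that[OF Z] TS3S3_lift[OF assms(1)] assms(2) Z by metis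
qed

lemma gnk_lift:
  assumes "x \<in> S3 \<times> S3"
  shows "gnk x (lift x a b) (lift x a' b') = 4/3 * (a \<bullet> a' + b \<bullet> b') - 2/3 * (a \<bullet> b' + a' \<bullet> b)"
  using assms by (auto simp: gnk_def Let_def S3_qinv)

lemma Jnk_lift:
  assumes "x \<in> S3 \<times> S3"
  shows "Jnk x (lift x a b) = (1 / sqrt 3) *\<^sub>R lift x (2 *\<^sub>R b - a) (b - 2 *\<^sub>R a)"
  using assms by (auto simp: Jnk_def Let_def S3_qinv qmul_assoc qmul.diff_right qmul.scaleR_right)

lemma Pnk_lift:
  assumes "x \<in> S3 \<times> S3"
  shows "Pnk x (lift x a b) = lift x b a"
  using assms by (auto simp: Pnk_def S3_qinv qmul_assoc)

text \<open>The base point moves on a straight line that leaves the spheres, so the normalising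
  factor in \<open>qinv\<close> enters. It is 1 / (1 + t^2 |w|^2), because p w is orthogonal to p,
  and contributes nothing to first order. What remains is (p + t p w)^{-1} p a = a - t w a + O(t^2)
  in the mixed term of the metric.\<close>

lemma dgnk_lift:
  assumes x: "x \<in> S3 \<times> S3" and w: "qim w1" "qim w2"
  shows "dgnk x (lift x w1 w2) (lift x a b) (lift x a' b') =
    2/3 * (qmul w1 a \<bullet> b' + a \<bullet> qmul w2 b' + qmul w1 a' \<bullet> b + a' \<bullet> qmul w2 b)"
proof -
  obtain p q where pq: "x = (p, q)" "p \<in> S3" "q \<in> S3" using x by force
  have inv: "qmul (qinv (p + t *\<^sub>R qmul p w)) (qmul p a) = (1 / (1 + t\<^sup>2 * (norm w)\<^sup>2)) *\<^sub>R (a - t *\<^sub>R qmul w a)"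
    if p: "p \<in> S3" and w: "qim w" for p w t a
  proof -
    have "p \<bullet> qmul p w = 0"
      using p w by (simp add: S3_inner_self_qmul)
    then have "(norm (p + t *\<^sub>R qmul p w))\<^sup>2 = 1 + t\<^sup>2 * (norm w)\<^sup>2"
      using p S3_norm[OF p] unfolding power2_norm_eq_inner
      by (simp add: inner_add_left inner_add_right inner_commute[of "qmul p w" p] norm_eq_1 power2_eq_square)
    moreover have "qmul (qconj (p + t *\<^sub>R qmul p w)) (qmul p a) = a - t *\<^sub>R qmul w a"
      using p w by (simp add: qconj_add qconj_scaleR qmul.add_left qmul.diff_left qmul.scaleR_left qconj_qmul qmul_assoc
          qconj_qim qmul.minus_left)
    ultimately show ?thesis by (simp add: qinv_def qmul.scaleR_left)
  qed
  define c where "c = 4/3 * (qmul p a \<bullet> qmul p a' + qmul q b \<bullet> qmul q b')"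
  define A where "A = a \<bullet> b' + a' \<bullet> b"
  define B where "B = qmul w1 a \<bullet> b' + a \<bullet> qmul w2 b' + qmul w1 a' \<bullet> b + a' \<bullet> qmul w2 b"
  define C where "C = qmul w1 a \<bullet> qmul w2 b' + qmul w1 a' \<bullet> qmul w2 b"
  define s where "s w t = 1 / (1 + t\<^sup>2 * (norm w)\<^sup>2)" for w :: quat and t
  have "gnk (x + t *\<^sub>R lift x w1 w2) (lift x a b) (lift x a' b') = c - 2/3 * (s w1 t * s w2 t * (A - t * B + t\<^sup>2 * C))" for t
    unfolding gnk_def Let_def pq fst_conv snd_conv fst_add snd_add fst_scaleR snd_scaleR
      inv[OF pq(2) w(1)] inv[OF pq(3) w(2)] inner_scaleR_left inner_scaleR_right c_def s_def[symmetric]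
    by (simp add: A_def B_def C_def inner_diff_left inner_diff_right field_simps power2_eq_square)
  moreover have "((\<lambda>t. c - 2/3 * (s w1 t * s w2 t * (A - t * B + t\<^sup>2 * C))) has_real_derivative 2/3 * B) (at 0)"
    unfolding s_def by (auto intro!: derivative_eq_intros)
  ultimately show ?thesis unfolding dgnk_def B_def by (simp add: DERIV_imp_deriv)
qed

text \<open>The musical isomorphism of $g$, with values in the Euclidean dual of $\mathbb{H}^2$.\<close>
definition nk_flat :: "pt \<Rightarrow> pt \<Rightarrow> pt" where
  "nk_flat x Z = ((4/3) *\<^sub>R fst Z - (2/3) *\<^sub>R qmul (qmul (fst x) (qconj (snd x))) (snd Z),
     (4/3) *\<^sub>R snd Z - (2/3) *\<^sub>R qmul (qmul (snd x) (qconj (fst x))) (fst Z))"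

lemma nk_flat_lift:
  assumes "x \<in> S3 \<times> S3"
  shows "nk_flat x (lift x a b) = lift x ((4/3) *\<^sub>R a - (2/3) *\<^sub>R b) ((4/3) *\<^sub>R b - (2/3) *\<^sub>R a)"
  using assms by (auto simp: nk_flat_def qmul_assoc qmul.diff_right qmul.scaleR_right)

lemma gnk_nk_flat:
  assumes "x \<in> S3 \<times> S3"
  shows "gnk x Z W = nk_flat x Z \<bullet> W"
proof -
  have [simp]: "fst x \<in> S3" "snd x \<in> S3" using assms by auto
  obtain a b where Z: "Z = lift x a b"
    using S3_cancel(2) \<open>fst x \<in> S3\<close> \<open>snd x \<in> S3\<close> by (metis prod.collapse)
  obtain a' b' where W: "W = lift x a' b'"
    using S3_cancel(2) \<open>fst x \<in> S3\<close> \<open>snd x \<in> S3\<close> by (metis prod.collapse)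
  show ?thesis unfolding Z W gnk_lift[OF assms] nk_flat_lift[OF assms]
    by (simp add: inner_prod_def[of "(_::quat, _::quat)"] inner_diff_left inner_commute[of b a'] field_simps)
qed

lemma inner_Pair_left: "(a, b) \<bullet> z = a \<bullet> fst z + b \<bullet> snd z"
  by (simp add: inner_prod_def)

text \<open>In the 8-dimensional ambient space this leaves 5 dimensions: once for the two sphere
  conditions with the conormal, once for the tangent space of a model hypersurface.\<close>

lemma dim_orthogonal_three:
  fixes a b c :: "'a::euclidean_space"
  assumes "a \<bullet> b = 0" "a \<bullet> c = 0" "b \<bullet> c = 0" "a \<noteq> 0" "b \<noteq> 0" "c \<noteq> 0"
  shows "dim {z. a \<bullet> z = 0 \<and> b \<bullet> z = 0 \<and> c \<bullet> z = 0} + 3 = DIM('a)"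
proof -
  have ne: "a \<noteq> b" "a \<noteq> c" "b \<noteq> c" using assms by auto
  have "independent {a, b, c}"
    using assms by (intro pairwise_orthogonal_independent)
      (auto simp: pairwise_def orthogonal_def inner_commute)
  then have "dim (span {a, b, c}) = 3"
    using ne by (simp add: dim_eq_card_independent)
  moreover have "{y \<in> UNIV. \<forall>x\<in>span {a, b, c}. orthogonal x y} = {z. a \<bullet> z = 0 \<and> b \<bullet> z = 0 \<and> c \<bullet> z = 0}"
  proof (intro set_eqI iffI)
    fix z assume "z \<in> {z. a \<bullet> z = 0 \<and> b \<bullet> z = 0 \<and> c \<bullet> z = 0}"
    then have "orthogonal z x" if "x \<in> span {a, b, c}" for x
      using that by (intro orthogonal_to_span[of x "{a, b, c}"]) (auto simp: orthogonal_def inner_commute)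
    then show "z \<in> {y \<in> UNIV. \<forall>x\<in>span {a, b, c}. orthogonal x y}" by (auto simp: orthogonal_commute)
  qed (auto simp: orthogonal_def span_base)
  ultimately show ?thesis
    using dim_subspace_orthogonal_to_vectors[of "span {a, b, c}" "UNIV :: 'a set"]
    by (simp add: subspace_span)
qed

section \<open>Hypersurfaces with a unit normal\<close>

locale normal_hypersurface =
  fixes M :: "pt set" and \<xi> :: "pt \<Rightarrow> pt"
  assumes hypersurface: "hypersurface M" and normal: "unit_normal M \<xi>"
begin

lemma M_S3: "x \<in> M \<Longrightarrow> x \<in> S3 \<times> S3"
  using hypersurface by (auto simp: hypersurface_def)

lemma chartE:
  assumes "x \<in> M"
  obtains \<phi> V u where "is_chart M \<phi> V" "u \<in> V" "x = \<phi> u"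
  using assms hypersurface by (auto simp: hypersurface_def)

lemma chart_open: "is_chart M \<phi> V \<Longrightarrow> open V"
  by (simp add: is_chart_def)

lemma chart_in: "is_chart M \<phi> V \<Longrightarrow> u \<in> V \<Longrightarrow> \<phi> u \<in> M"
  by (auto simp: is_chart_def)

lemma chart_smooth: "is_chart M \<phi> V \<Longrightarrow> smooth_on V \<phi>"
  by (simp add: is_chart_def)

lemma chart_smooth_normal: "is_chart M \<phi> V \<Longrightarrow> smooth_on V (\<lambda>u. \<xi> (\<phi> u))"
  using normal by (auto simp: unit_normal_def smooth_on_mfd_def o_def)

lemma chart_derivative:
  assumes "is_chart M \<phi> V" "u \<in> V"
  shows "(\<phi> has_derivative frechet_derivative \<phi> (at u)) (at u)"
    "((\<lambda>u. \<xi> (\<phi> u)) has_derivative frechet_derivative (\<lambda>u. \<xi> (\<phi> u)) (at u)) (at u)"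
  using assms smooth_on_has_derivative chart_smooth chart_smooth_normal chart_open by blast+

lemma deriv_along_chart:
  assumes chart: "is_chart M \<phi> V" "u \<in> V" and f: "((\<lambda>u. f (\<phi> u)) has_derivative F) (at u)"
  shows "deriv_along M f (\<phi> u) (frechet_derivative \<phi> (at u) v) (F v)"
proof -
  \<comment> \<open>Curves in \<open>tangent_space\<close> and \<open>deriv_along\<close> must stay
    in \<open>M\<close> for all real times, so the chart segment is replaced by a constant outside
    \<open>V\<close>; near time 0 nothing changes.\<close>
  define \<gamma> where "\<gamma> t = (if u + t *\<^sub>R v \<in> V then \<phi> (u + t *\<^sub>R v) else \<phi> u)" for t :: real
  let ?T = "(\<lambda>t::real. u + t *\<^sub>R v) -` V"
  have "open ?T"
    using chart_open[OF chart(1)] by (intro open_vimage) (auto intro!: continuous_intros)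
  have "0 \<in> ?T" using chart by simp
  have line: "((\<lambda>t::real. u + t *\<^sub>R v) has_derivative (\<lambda>t. t *\<^sub>R v)) (at 0)"
    by (auto intro!: derivative_eq_intros)
  have curve: "((\<lambda>t. h (\<gamma> t)) has_vector_derivative H v) (at 0)"
    if h: "((\<lambda>u. h (\<phi> u)) has_derivative H) (at u)" for h :: "pt \<Rightarrow> pt" and H
  proof -
    interpret H: bounded_linear H using h by (rule has_derivative_bounded_linear)
    have "((\<lambda>t. h (\<phi> (u + t *\<^sub>R v))) has_derivative (\<lambda>t. H (t *\<^sub>R v))) (at 0)"
      using diff_chain_at[OF line, of "\<lambda>u. h (\<phi> u)" H] h by (simp add: o_def)
    then have "((\<lambda>t. h (\<gamma> t)) has_derivative (\<lambda>t. H (t *\<^sub>R v))) (at 0)"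
      by (rule has_derivative_transform_within_open[OF _ \<open>open ?T\<close> \<open>0 \<in> ?T\<close>]) (simp add: \<gamma>_def)
    then show ?thesis by (simp add: has_vector_derivative_def H.scaleR)
  qed
  have "\<forall>t. \<gamma> t \<in> M" "\<gamma> 0 = \<phi> u" using chart chart_in by (auto simp: \<gamma>_def)
  then show ?thesis
    unfolding deriv_along_def o_def
    using curve[of "\<lambda>x. x", OF chart_derivative(1)[OF chart]] curve[OF f] by blast
qed

lemma tangent_space_TS3S3:
  assumes "x \<in> M" "Z \<in> tangent_space M x"
  shows "Z \<in> TS3S3 x"
proof -
  obtain \<gamma> where \<gamma>: "\<And>t. \<gamma> t \<in> M" "\<gamma> 0 = x" "(\<gamma> has_vector_derivative Z) (at 0)"
    using assms by (auto simp: tangent_space_def)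
  have *: "h x \<bullet> h Z = 0" if h: "bounded_linear h" "\<And>y. y \<in> M \<Longrightarrow> h y \<in> S3" for h :: "pt \<Rightarrow> quat"
  proof -
    have d: "((\<lambda>t. h (\<gamma> t)) has_derivative (\<lambda>t. t *\<^sub>R h Z)) (at 0)"
      using bounded_linear.has_vector_derivative[OF h(1) \<gamma>(3)] by (simp add: has_vector_derivative_def)
    have "((\<lambda>t. h (\<gamma> t) \<bullet> h (\<gamma> t)) has_derivative (\<lambda>t. h x \<bullet> (t *\<^sub>R h Z) + (t *\<^sub>R h Z) \<bullet> h x)) (at 0)"
      using has_derivative_inner[OF d d] \<gamma>(2) by simp
    moreover have "(\<lambda>t. h (\<gamma> t) \<bullet> h (\<gamma> t)) = (\<lambda>t. 1)"
      using h(2)[OF \<gamma>(1)] by (simp add: S3_def norm_eq_1)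
    ultimately have "(\<lambda>t. h x \<bullet> (t *\<^sub>R h Z) + (t *\<^sub>R h Z) \<bullet> h x) = (\<lambda>t. 0)"
      using has_derivative_const has_derivative_unique by metis
    from fun_cong[OF this, of 1] show ?thesis by (simp add: inner_commute)
  qed
  show ?thesis unfolding TS3S3_def
    using *[OF bounded_linear_fst] *[OF bounded_linear_snd] M_S3 by (auto simp: mem_Times_iff)
qed

text \<open>\<open>tangent_space\<close> is defined by curves and is not a subspace by definition.
  It is squeezed between the image of the injective chart derivative and the common kernel of three
  orthogonal covectors (two sphere normals and the conormal); both are subspaces of dimension
  5.\<close>

lemma chart_tangent_space:
  assumes chart: "is_chart M \<phi> V" "u \<in> V"
  shows "tangent_space M (\<phi> u) = range (frechet_derivative \<phi> (at u))"
    and "tangent_space M (\<phi> u) = {Z \<in> TS3S3 (\<phi> u). gnk (\<phi> u) (\<xi> (\<phi> u)) Z = 0}"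
proof -
  let ?x = "\<phi> u"
  have x: "?x \<in> M" "?x \<in> S3 \<times> S3" using chart_in[OF chart] M_S3 by auto
  let ?R = "{Z \<in> TS3S3 ?x. gnk ?x (\<xi> ?x) Z = 0}"
  let ?D = "frechet_derivative \<phi> (at u)"
  have 1: "range ?D \<subseteq> tangent_space M ?x"
    using deriv_along_chart[OF chart, of "\<lambda>x. x", OF chart_derivative(1)[OF chart]]
    unfolding deriv_along_def tangent_space_def by blast
  have 2: "tangent_space M ?x \<subseteq> ?R"
    using tangent_space_TS3S3[OF x(1)] normal x(1) by (auto simp: unit_normal_def)
  have lin: "linear ?D" using chart_derivative(1)[OF chart] has_derivative_linear by blast
  have inj: "inj ?D" using chart by (auto simp: is_chart_def)
  have dD: "dim (range ?D) = 5" using dim_image_eq[OF lin, of UNIV] inj by simp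
  obtain m1 m2 where \<xi>: "\<xi> ?x = lift ?x m1 m2" "qim m1" "qim m2"
    using TS3S3_liftE[OF x(2)] normal x(1) by (metis unit_normal_def)
  define \<zeta> where "\<zeta> = nk_flat ?x (\<xi> ?x)"
  have \<zeta>: "\<zeta> \<in> TS3S3 ?x" unfolding \<zeta>_def \<xi>(1) nk_flat_lift[OF x(2)] TS3S3_lift[OF x(2)]
    using \<xi> by simp
  have "gnk ?x (\<xi> ?x) (\<xi> ?x) = 1" using normal x(1) by (simp add: unit_normal_def)
  then have \<zeta>0: "\<zeta> \<noteq> 0" by (auto simp: \<zeta>_def gnk_nk_flat[OF x(2)])
  have R: "?R = {z. (fst ?x, 0) \<bullet> z = 0 \<and> (0, snd ?x) \<bullet> z = 0 \<and> \<zeta> \<bullet> z = 0}"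
    by (simp add: TS3S3_def \<zeta>_def gnk_nk_flat[OF x(2)] inner_Pair_left)
  have "fst ?x \<noteq> 0" "snd ?x \<noteq> 0" using x(2) by (auto simp: S3_def)
  then have "(fst ?x, 0::quat) \<noteq> 0" "(0::quat, snd ?x) \<noteq> 0" by (metis fst_conv fst_zero, metis snd_conv snd_zero)
  then have "dim ?R + 3 = DIM(pt)"
    unfolding R using \<zeta> \<zeta>0 by (intro dim_orthogonal_three) (simp_all add: TS3S3_def inner_Pair_left)
  then have "dim ?R = 5" by simp
  moreover have "subspace ?R" unfolding R
    by (auto simp: subspace_def inner_add_right)
  ultimately have "range ?D = ?R"
    using 1 2 dD linear_subspace_image[OF lin subspace_UNIV] by (intro subspace_dim_equal) auto
  then show "tangent_space M ?x = range ?D" "tangent_space M ?x = ?R" using 1 2 by auto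
qed

end

text \<open>Differentiating the orthogonality relation along \<open>w\<close> expresses the left
  side as minus the pairing of \<open>\<zeta> u\<close> with the mixed second derivative of
  \<open>f\<close>, which is symmetric. It serves both for the conormal of \<open>M\<close> and for
  the normal of a surface parametrised with redundant variables.\<close>

lemma conormal_symmetric:
  fixes f \<zeta> :: "'a::real_normed_vector \<Rightarrow> 'b::euclidean_space"
  assumes V: "open V" "u \<in> V" and f: "smooth_on V f" and \<zeta>: "(\<zeta> has_derivative \<zeta>') (at u)"
    and orth: "\<And>x v. x \<in> V \<Longrightarrow> \<zeta> x \<bullet> frechet_derivative f (at x) v = 0"
  shows "\<zeta>' w \<bullet> frechet_derivative f (at u) v = \<zeta>' v \<bullet> frechet_derivative f (at u) w"
proof -
  have *: "\<zeta> u \<bullet> ider f [w, v] u + \<zeta>' w \<bullet> frechet_derivative f (at u) v = 0" for v w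
  proof -
    have "((\<lambda>x. \<zeta> x \<bullet> ider f [v] x) has_derivative
        (\<lambda>w. \<zeta> u \<bullet> ider f [w, v] u + \<zeta>' w \<bullet> ider f [v] u)) (at u)"
      using has_derivative_inner[OF \<zeta> smooth_on_ider_has_derivative[OF f V, of "[v]"]] by simp
    then have "((\<lambda>x. 0) has_derivative (\<lambda>w. \<zeta> u \<bullet> ider f [w, v] u + \<zeta>' w \<bullet> ider f [v] u)) (at u)"
      by (rule has_derivative_transform_within_open[OF _ V]) (simp add: orth)
    then have "(\<lambda>w. \<zeta> u \<bullet> ider f [w, v] u + \<zeta>' w \<bullet> ider f [v] u) = (\<lambda>w. 0)"
      using has_derivative_const has_derivative_unique by blast
    from fun_cong[OF this, of w] show ?thesis by simp
  qed
  show ?thesis using *[of w v] *[of v w] ider_commute[OF f V, of w v] by simp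
qed

section \<open>Frames of imaginary quaternions\<close>

lemma orthogonal_qimE:
  obtains e where "qim e" "norm e = 1" "n \<bullet> e = 0"
proof (cases "snd n = 0")
  case True
  then show ?thesis by (intro that[of "(0, 1)"]) (auto simp: norm_prod_def inner_prod_def)
next
  case False
  \<comment> \<open>Multiplication by i is a quarter turn in the plane of the second coordinate, and
    that plane is purely imaginary.\<close>
  define e :: quat where "e = (0, \<i> * sgn (snd n))"
  have "snd n \<bullet> (\<i> * sgn (snd n)) = 0"
    by (simp add: sgn_div_norm inner_complex_def)
  then have "n \<bullet> e = 0" by (simp add: e_def inner_prod_def)
  moreover have "norm e = 1" using False by (simp add: e_def norm_prod_def norm_mult norm_sgn)
  ultimately show ?thesis by (intro that[of e]) (simp_all add: e_def)
qed

text \<open>The multiplication rules of i, j, k, with \<open>e\<close> of arbitrary length.\<close>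

lemma qframe:
  assumes n: "qim n" "norm n = 1" and e: "qim e" "n \<bullet> e = 0"
  shows "qim (qmul n e)" "norm (qmul n e) = norm e" "n \<bullet> qmul n e = 0" "e \<bullet> qmul n e = 0"
    "qmul e n = - qmul n e" "qmul n (qmul n e) = - e" "qmul (qmul n e) n = e" "qmul n n = - qone"
proof -
  have "qmul n (- n) = qone" using qmul_qconj_self(2)[of n] n qconj_qim[of n] by simp
  then show nn: "qmul n n = - qone" by (metis qmul.minus_right minus_minus)
  show "qim (qmul n e)" using qim_qmul n e by blast
  show "norm (qmul n e) = norm e" by (simp add: norm_qmul n)
  have "n \<in> S3" using n by (simp add: S3_def)
  then show "n \<bullet> qmul n e = 0" using e by (simp add: S3_inner_self_qmul)
  have "e \<bullet> qmul n e = n \<bullet> qmul e (qconj e)" by (metis inner_commute inner_qmul_swap(2))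
  also have "\<dots> = 0" using n by (simp only: qmul_qconj_self inner_scaleR_right inner_qone)
  finally show "e \<bullet> qmul n e = 0" .
  show en: "qmul e n = - qmul n e" using qmul_qim_commute[OF n(1) e(1)] unfolding e(2)
    by (metis mult_zero_right scaleR_zero_left diff_zero)
  show nne: "qmul n (qmul n e) = - e" by (metis nn qmul.minus_left qmul_assoc qmul_qone(2))
  show "qmul (qmul n e) n = e" by (metis nne en qmul.minus_right qmul_assoc minus_minus)
qed

text \<open>Only span(1, n) commutes with n. Pairing \<open>qmul d n\<close> and
  \<open>qmul n d\<close> with n e gives -<d, e> and <d, e>.\<close>

lemma qim_commute_orthogonal:
  assumes n: "qim n" "norm n = 1" and e: "qim e" "n \<bullet> e = 0" and d: "qmul d n = qmul n d"
  shows "d \<bullet> e = 0"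
proof -
  note F = qframe[OF n e]
  have "qmul d n \<bullet> qmul n e = d \<bullet> qmul (qmul n e) (qconj n)" by (rule inner_qmul_swap(2))
  also have "\<dots> = - (d \<bullet> e)" by (simp add: qconj_qim n qmul.minus_right F)
  finally have 1: "qmul d n \<bullet> qmul n e = - (d \<bullet> e)" .
  have "qmul n d \<bullet> qmul n e = d \<bullet> e" using n by (intro S3_inner_qmul) (simp add: S3_def)
  then show ?thesis using 1 d by simp
qed

lemma has_derivative_eq_zero_on:
  assumes "(f has_derivative D) (at u)" "open V" "u \<in> V" "\<And>x. x \<in> V \<Longrightarrow> f x = c"
  shows "D v = 0"
proof -
  have "((\<lambda>x. c) has_derivative D) (at u)"
    by (rule has_derivative_transform_within_open[OF assms(1-3)]) (simp add: assms(4))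
  then show ?thesis using has_derivative_const has_derivative_unique by metis
qed

context normal_hypersurface
begin

lemma tangent_space_eq:
  assumes "x \<in> M"
  shows "tangent_space M x = {Z \<in> TS3S3 x. gnk x (\<xi> x) Z = 0}"
proof -
  obtain \<phi> V u where c: "is_chart M \<phi> V" "u \<in> V" "x = \<phi> u" using chartE[OF assms] by blast
  show ?thesis unfolding c(3) by (rule chart_tangent_space(2)[OF c(1,2)])
qed

lemma normal_unit: "x \<in> M \<Longrightarrow> gnk x (\<xi> x) (\<xi> x) = 1"
  and normal_TS3S3: "x \<in> M \<Longrightarrow> \<xi> x \<in> TS3S3 x"
  using normal unfolding unit_normal_def by blast+

lemma continuous_on_normal: "continuous_on M \<xi>"
  unfolding continuous_on_eq_continuous_within
proof
  fix x assume "x \<in> M"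
  then obtain \<phi> V u where c: "is_chart M \<phi> V" "u \<in> V" "x = \<phi> u" using chartE by blast
  have 1: "continuous_on (\<phi> ` V) (inv_into V \<phi>)" using c by (simp add: is_chart_def)
  have "(\<lambda>u. \<xi> (\<phi> u)) differentiable_on V"
    using chart_smooth_normal[OF c(1)] unfolding smooth_on_def by (metis ider.simps(1))
  then have 2: "continuous_on V (\<lambda>u. \<xi> (\<phi> u))" by (rule differentiable_imp_continuous_on)
  have "inv_into V \<phi> ` \<phi> ` V \<subseteq> V" by (auto intro: inv_into_into)
  then have "continuous_on (\<phi> ` V) ((\<lambda>u. \<xi> (\<phi> u)) \<circ> inv_into V \<phi>)"
    using 1 2 by (meson continuous_on_compose continuous_on_subset)
  moreover have "((\<lambda>u. \<xi> (\<phi> u)) \<circ> inv_into V \<phi>) y = \<xi> y" if "y \<in> \<phi> ` V" for y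
    using that by (simp add: f_inv_into_f)
  ultimately have "continuous_on (\<phi> ` V) \<xi>" by (simp add: continuous_on_eq)
  then have 3: "continuous (at x within \<phi> ` V) \<xi>" using c continuous_on_eq_continuous_within by blast
  obtain T where T: "open T" "\<phi> ` V = M \<inter> T"
    using c(1) unfolding is_chart_def openin_open by blast
  have "at x within \<phi> ` V = at x within M"
    using T c by (intro at_within_nhd[of x T]) auto
  then show "continuous (at x within M) \<xi>" using 3 by simp
qed

end

section \<open>Hypersurfaces with P-invariant holomorphic distribution\<close>

locale P_hypersurface = normal_hypersurface +
  assumes P_invariant: "x \<in> M \<Longrightarrow> Pnk x ` holo_distr M \<xi> x = holo_distr M \<xi> x"
begin

lemma normal_parallel:
  assumes xM: "x \<in> M"
  obtains n s t where "qim n" "norm n = 1" "\<xi> x = lift x (s *\<^sub>R n) (t *\<^sub>R n)"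
    "4 * (s\<^sup>2 + t\<^sup>2 - s * t) = 3"
proof -
  note x = M_S3[OF xM]
  obtain m1 m2 where m: "\<xi> x = lift x m1 m2" "qim m1" "qim m2"
    using TS3S3_liftE[OF x normal_TS3S3[OF xM]] by metis
  define G where "G = (m1 \<bullet> m1) * (m2 \<bullet> m2) - (m1 \<bullet> m2)\<^sup>2"
  \<comment> \<open>Both vectors lie in the span of \<open>m1\<close> and \<open>m2\<close>, with
    products 0 and plus or minus \<open>G\<close> against them. The signs make (\<alpha>, \<beta>)
    orthogonal to the normal and to the structure vector, while the product of the swapped pair with
    (2 m2 - m1, m2 - 2 m1) is 4 \<open>G\<close>.\<close>
  define \<beta> where "\<beta> = (m1 \<bullet> m1) *\<^sub>R m2 - (m1 \<bullet> m2) *\<^sub>R m1"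
  define \<alpha> where "\<alpha> = (m1 \<bullet> m2) *\<^sub>R m2 - (m2 \<bullet> m2) *\<^sub>R m1"
  have dots: "m1 \<bullet> \<beta> = 0" "m2 \<bullet> \<beta> = G" "m1 \<bullet> \<alpha> = - G" "m2 \<bullet> \<alpha> = 0"
    by (simp_all add: \<alpha>_def \<beta>_def G_def inner_diff_right inner_commute[of m2 m1] power2_eq_square)
  have dots': "\<beta> \<bullet> m1 = 0" "\<beta> \<bullet> m2 = G" "\<alpha> \<bullet> m1 = - G" "\<alpha> \<bullet> m2 = 0"
    using dots by (simp_all add: inner_commute)
  have im: "qim \<alpha>" "qim \<beta>" using m by (simp_all add: \<alpha>_def \<beta>_def)
  have U: "gnk x X (structure_vf \<xi> x) = - (1 / sqrt 3) * gnk x X (lift x (2 *\<^sub>R m2 - m1) (m2 - 2 *\<^sub>R m1))" for X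
    unfolding structure_vf_def m(1) Jnk_lift[OF x]
    by (simp add: gnk_nk_flat[OF x] del: scaleR_Pair)
  txt \<open>This test vector lies in the distribution, but its image under $P$ does so only if the
    Gram determinant $G$ vanishes.\<close>
  have "lift x \<alpha> \<beta> \<in> holo_distr M \<xi> x"
    unfolding holo_distr_def tangent_space_eq[OF xM]
    by (simp add: TS3S3_lift[OF x] im U m(1) gnk_lift[OF x] dots dots' inner_diff_right inner_diff_left)
  then have "lift x \<beta> \<alpha> \<in> holo_distr M \<xi> x"
    using P_invariant[OF xM] Pnk_lift[OF x, of \<alpha> \<beta>] by (metis imageI)
  then have "gnk x (lift x \<beta> \<alpha>) (lift x (2 *\<^sub>R m2 - m1) (m2 - 2 *\<^sub>R m1)) = 0"
    using U[of "lift x \<beta> \<alpha>"] by (simp add: holo_distr_def)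
  then have G: "(m1 \<bullet> m1) * (m2 \<bullet> m2) = (m1 \<bullet> m2)\<^sup>2"
    by (simp add: gnk_lift[OF x] dots dots' inner_diff_right inner_diff_left G_def)
  have unit: "4/3 * (m1 \<bullet> m1 + m2 \<bullet> m2) - 4/3 * (m1 \<bullet> m2) = 1"
    using normal_unit[OF xM] by (simp add: m(1) gnk_lift[OF x] inner_commute)
  obtain n s t where n: "qim n" "norm n = 1" "m1 = s *\<^sub>R n" "m2 = t *\<^sub>R n"
  proof (cases "m2 = 0")
    case True
    then have "m1 \<noteq> 0" using unit by auto
    then show ?thesis using True m by (intro that[of "m1 /\<^sub>R norm m1" "norm m1" 0]) auto
  next
    case False
    define n where "n = m2 /\<^sub>R norm m2"
    have n: "norm n = 1" "m2 = norm m2 *\<^sub>R n" using False by (auto simp: n_def)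
    have "norm m2 * norm m2 \<noteq> 0" using False by simp
    have "(m1 \<bullet> m1) * (norm m2 * norm m2) = (m1 \<bullet> n)\<^sup>2 * (norm m2 * norm m2)"
      using G n by (metis inner_scaleR_right mult.commute power2_eq_square power2_norm_eq_inner power_mult_distrib)
    then have "m1 \<bullet> m1 = (m1 \<bullet> n)\<^sup>2" using \<open>norm m2 * norm m2 \<noteq> 0\<close> by simp
    then have "(m1 - (m1 \<bullet> n) *\<^sub>R n) \<bullet> (m1 - (m1 \<bullet> n) *\<^sub>R n) = 0"
      using n(1) by (simp add: inner_diff_left inner_diff_right inner_commute[of n m1] power2_eq_square norm_eq_1)
    then have "m1 = (m1 \<bullet> n) *\<^sub>R n" by simp
    then show ?thesis using n m by (intro that[of n "m1 \<bullet> n" "norm m2"]) (auto simp: n_def)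
  qed
  have "4 * (s\<^sup>2 + t\<^sup>2 - s * t) = 3"
    using unit n by (simp add: norm_eq_1 power2_eq_square field_simps)
  then show ?thesis using that n m(1) by blast
qed

text \<open>Write the conormal as (p k1, q k2), with k1 = a n and k2 = b n at the given point.
  Symmetry of its derivative, tested on e and n e in each factor, and the fact that k1 and k2 stay
  parallel nearby are enough to eliminate all derivatives of k1 and k2.\<close>

lemma conormal_trichotomy:
  assumes xM: "x \<in> M" and n: "qim n" "norm n = 1" and \<xi>: "\<xi> x = lift x (s *\<^sub>R n) (t *\<^sub>R n)"
  shows "2 * s = t \<or> 2 * t = s \<or> s + t = 0"
proof -
  obtain \<phi> V u where c: "is_chart M \<phi> V" "u \<in> V" "x = \<phi> u" using chartE[OF xM] by blast
  note V = chart_open[OF c(1)] c(2)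
  note x = M_S3[OF xM]
  define p q m1 m2 where "p y = fst (\<phi> y)" and "q y = snd (\<phi> y)" 
    and "m1 y = qmul (qconj (fst (\<phi> y))) (fst (\<xi> (\<phi> y)))"
    and "m2 y = qmul (qconj (snd (\<phi> y))) (snd (\<xi> (\<phi> y)))" for y
  define k1 k2 where "k1 y = (4/3) *\<^sub>R m1 y - (2/3) *\<^sub>R m2 y"
    and "k2 y = (4/3) *\<^sub>R m2 y - (2/3) *\<^sub>R m1 y" for y
  have \<phi>S: "\<phi> y \<in> S3 \<times> S3" if "y \<in> V" for y using chart_in[OF c(1) that] M_S3 by blast
  have \<xi>\<phi>: "\<xi> (\<phi> y) = lift (\<phi> y) (m1 y) (m2 y)" if "y \<in> V" for y
    using \<phi>S[OF that] by (simp add: m1_def m2_def mem_Times_iff)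
  have mu: "m1 u = s *\<^sub>R n" "m2 u = t *\<^sub>R n"
    using x \<xi> by (auto simp: m1_def m2_def c(3) mem_Times_iff)
  define a b where "a = 4/3 * s - 2/3 * t" and "b = 4/3 * t - 2/3 * s"
  have ku: "k1 u = a *\<^sub>R n" "k2 u = b *\<^sub>R n" by (simp_all add: k1_def k2_def mu a_def b_def algebra_simps)
  define D where "D = frechet_derivative \<phi> (at u)"
  have D: "(\<phi> has_derivative D) (at u)" unfolding D_def by (rule chart_derivative[OF c(1,2)])
  have "m1 differentiable at u" "m2 differentiable at u"
    unfolding m1_def[abs_def] m2_def[abs_def]
    using differentiableI[OF qmul.FDERIV[OF
        bounded_linear.has_derivative[OF bounded_linear_qconj has_derivative_fst[OF D]]
        has_derivative_fst[OF chart_derivative(2)[OF c(1,2)]]]]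
      differentiableI[OF qmul.FDERIV[OF
        bounded_linear.has_derivative[OF bounded_linear_qconj has_derivative_snd[OF D]]
        has_derivative_snd[OF chart_derivative(2)[OF c(1,2)]]]]
    by blast+
  then have "k1 differentiable at u" "k2 differentiable at u"
    unfolding k1_def[abs_def] k2_def[abs_def] by auto
  then obtain k1' k2' where k': "(k1 has_derivative k1') (at u)" "(k2 has_derivative k2') (at u)"
    by (auto simp: differentiable_def)
  \<comment> \<open>The vector \<open>n'\<close> depends on \<open>y\<close> without any regularity;
    a vanishing commutator expresses parallelism in a form that can be differentiated.\<close>
  have comm: "qmul (k1 y) (k2 y) - qmul (k2 y) (k1 y) = 0" if y: "y \<in> V" for y
  proof -
    obtain n' s' t' where "\<xi> (\<phi> y) = lift (\<phi> y) (s' *\<^sub>R n') (t' *\<^sub>R n')"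
      using normal_parallel chart_in[OF c(1) y] by metis
    then have "m1 y = s' *\<^sub>R n'" "m2 y = t' *\<^sub>R n'"
      using \<phi>S[OF y] by (auto simp: m1_def m2_def mem_Times_iff)
    then have "k1 y = (4/3 * s' - 2/3 * t') *\<^sub>R n'" "k2 y = (4/3 * t' - 2/3 * s') *\<^sub>R n'"
      by (simp_all add: k1_def k2_def algebra_simps)
    then show ?thesis
      by (simp add: qmul.scaleR_left qmul.scaleR_right mult.commute)
  qed
  have "((\<lambda>y. qmul (k1 y) (k2 y) - qmul (k2 y) (k1 y)) has_derivative
      (\<lambda>v. (qmul (k1 u) (k2' v) + qmul (k1' v) (k2 u)) - (qmul (k2 u) (k1' v) + qmul (k2' v) (k1 u)))) (at u)"
    by (intro has_derivative_diff qmul.FDERIV k')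
  \<comment> \<open>So b k1' - a k2' commutes with n and is orthogonal to everything imaginary and
    orthogonal to n: on such vectors b k1' may be traded for a k2'.\<close>
  from has_derivative_eq_zero_on[OF this V comm]
  have "qmul (b *\<^sub>R k1' v - a *\<^sub>R k2' v) n = qmul n (b *\<^sub>R k1' v - a *\<^sub>R k2' v)" for v
    by (simp add: ku qmul.diff_left qmul.diff_right qmul.scaleR_left qmul.scaleR_right algebra_simps)
  note perp = qim_commute_orthogonal[OF n _ _ this]
  define \<zeta>' where "\<zeta>' v = (qmul (fst (D v)) (k1 u), qmul (snd (D v)) (k2 u)) + lift x (k1' v) (k2' v)" for v
  have \<zeta>': "((\<lambda>y. lift (\<phi> y) (k1 y) (k2 y)) has_derivative \<zeta>') (at u)"
  proof -
    have "((\<lambda>y. lift (\<phi> y) (k1 y) (k2 y)) has_derivative (\<lambda>v. (qmul (fst (\<phi> u)) (k1' v) + qmul (fst (D v)) (k1 u),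
       qmul (snd (\<phi> u)) (k2' v) + qmul (snd (D v)) (k2 u)))) (at u)"
      by (intro has_derivative_Pair qmul.FDERIV k' has_derivative_fst has_derivative_snd D)
    then show ?thesis by (simp add: \<zeta>'_def[abs_def] c(3) add.commute)
  qed
  have sym: "\<zeta>' w \<bullet> D v = \<zeta>' v \<bullet> D w" for v w
    unfolding D_def
  proof (rule conormal_symmetric[OF V chart_smooth[OF c(1)] \<zeta>'])
    fix y v assume y: "y \<in> V"
    have "frechet_derivative \<phi> (at y) v \<in> tangent_space M (\<phi> y)"
      using chart_tangent_space(1)[OF c(1) y] by simp
    then have "gnk (\<phi> y) (\<xi> (\<phi> y)) (frechet_derivative \<phi> (at y) v) = 0"
      using chart_tangent_space(2)[OF c(1) y] by simp
    then show "lift (\<phi> y) (k1 y) (k2 y) \<bullet> frechet_derivative \<phi> (at y) v = 0"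
      by (simp add: gnk_nk_flat[OF \<phi>S[OF y]] \<xi>\<phi>[OF y] nk_flat_lift[OF \<phi>S[OF y]] k1_def k2_def)
  qed
  have sym': "(qmul \<alpha> (a *\<^sub>R n) + k1' v) \<bullet> \<alpha>' + (qmul \<beta> (b *\<^sub>R n) + k2' v) \<bullet> \<beta>' =
     (qmul \<alpha>' (a *\<^sub>R n) + k1' w) \<bullet> \<alpha> + (qmul \<beta>' (b *\<^sub>R n) + k2' w) \<bullet> \<beta>"
    if "D v = lift x \<alpha> \<beta>" "D w = lift x \<alpha>' \<beta>'" for v w \<alpha> \<beta> \<alpha>' \<beta>'
  proof -
    have *: "\<zeta>' v = lift x (qmul \<alpha> (a *\<^sub>R n) + k1' v) (qmul \<beta> (b *\<^sub>R n) + k2' v)"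
      if "D v = lift x \<alpha> \<beta>" for v \<alpha> \<beta>
      by (simp add: \<zeta>'_def that ku qmul_assoc qmul.add_right)
    have "fst x \<in> S3" "snd x \<in> S3" using x by auto
    then show ?thesis using sym[of v w] by (simp add: *[OF that(1)] *[OF that(2)] that inner_Pair_left)
  qed
  have ex: "\<exists>v. D v = lift x \<alpha> \<beta>" if "qim \<alpha>" "qim \<beta>" "n \<bullet> \<alpha> = 0" "n \<bullet> \<beta> = 0" for \<alpha> \<beta>
  proof -
    have "lift x \<alpha> \<beta> \<in> tangent_space M x"
      unfolding tangent_space_eq[OF xM] using that
      by (simp add: TS3S3_lift[OF x] \<xi> gnk_lift[OF x] inner_commute[of _ n])
    then show ?thesis using chart_tangent_space(1)[OF c(1,2)] c(3) by (auto simp: D_def)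
  qed
  obtain e where e: "qim e" "norm e = 1" "n \<bullet> e = 0" using orthogonal_qimE by blast
  define f where "f = qmul n e"
  note F = qframe[OF n e(1,3), folded f_def]
  have "norm f = 1" using F(2) e(2) by simp
  then have ee: "e \<bullet> e = 1" "f \<bullet> f = 1" using e(2) by (simp_all add: norm_eq_1)
  obtain v1 v2 v3 v4 where v: "D v1 = lift x e 0" "D v2 = lift x f 0" "D v3 = lift x 0 e" "D v4 = lift x 0 f"
    using ex[of e 0] ex[of f 0] ex[of 0 e] ex[of 0 f] e F by auto
  have 1: "k1' v1 \<bullet> f - k1' v2 \<bullet> e = 2 * a"
    using sym'[OF v(1) v(2)] by (simp add: qmul.scaleR_right F inner_add_left inner_diff_left ee)
  have 2: "k2' v3 \<bullet> f - k2' v4 \<bullet> e = 2 * b"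
    using sym'[OF v(3) v(4)] by (simp add: qmul.scaleR_right F inner_add_left inner_diff_left ee)
  have 3: "k2' v1 \<bullet> f = k1' v4 \<bullet> e" using sym'[OF v(1) v(4)] by (simp add: qmul.zero_left)
  have 4: "k2' v2 \<bullet> e = k1' v3 \<bullet> f" using sym'[OF v(2) v(3)] by (simp add: qmul.zero_left)
  have pe: "b * (k1' v \<bullet> e) = a * (k2' v \<bullet> e)" "b * (k1' v \<bullet> f) = a * (k2' v \<bullet> f)" for v
    using perp[of e v] perp[of f v] e F by (simp_all add: inner_diff_left)
  \<comment> \<open>Trading b k1' for a k2' on \<open>v1\<close>, \<open>v2\<close> and using the
    mixed symmetries \<open>3\<close> and \<open>4\<close> leads to \<open>v4\<close>,
    \<open>v3\<close>. A second trade, after multiplication by b, reaches relation \<open>2\<close>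
    with the opposite sign: 2 a b^2 = - 2 a^2 b.\<close>
  have "2 * a * b = b * (k1' v1 \<bullet> f) - b * (k1' v2 \<bullet> e)"
    using 1 by algebra
  also have "\<dots> = a * (k1' v4 \<bullet> e) - a * (k1' v3 \<bullet> f)"
    by (simp only: pe 3 4)
  finally have "a * b * (a + b) = 0"
    using 2 pe(1)[of v4] pe(2)[of v3] by algebra
  then show ?thesis by (auto simp: a_def b_def)
qed

text \<open>Unit length fixes s and t up to a common sign in each alternative, and the sign is
  absorbed into \<open>n\<close>.\<close>

lemma normal_cases:
  assumes xM: "x \<in> M"
  obtains n where "qim n" "norm n = 1"
    "\<xi> x = lift x ((1/2) *\<^sub>R n) n \<or> \<xi> x = lift x n ((1/2) *\<^sub>R n) \<or> \<xi> x = lift x (- (1/2) *\<^sub>R n) ((1/2) *\<^sub>R n)"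
proof -
  obtain n s t where n: "qim n" "norm n = 1" and \<xi>: "\<xi> x = lift x (s *\<^sub>R n) (t *\<^sub>R n)"
    and st: "4 * (s\<^sup>2 + t\<^sup>2 - s * t) = 3"
    using normal_parallel[OF xM] by blast
  from conormal_trichotomy[OF xM n \<xi>] consider "t = 2 * s" | "s = 2 * t" | "s = - t" by linarith
  then show ?thesis
  proof cases
    case 1
    with st have "t\<^sup>2 = 1" by (simp add: power2_eq_square)
    then have "\<bar>t\<bar> = 1" by (auto simp: power2_eq_1_iff)
    then show ?thesis using that[of "t *\<^sub>R n"] n \<xi> 1 by simp
  next
    case 2
    with st have "s\<^sup>2 = 1" by (simp add: power2_eq_square)
    then have "\<bar>s\<bar> = 1" by (auto simp: power2_eq_1_iff)
    then show ?thesis using that[of "s *\<^sub>R n"] n \<xi> 2 by simp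
  next
    case 3
    with st have "(2 * t)\<^sup>2 = 1" by (simp add: power2_eq_square)
    then have "\<bar>2 * t\<bar> = 1" unfolding power2_eq_1_iff by auto
    then show ?thesis using that[of "(2 * t) *\<^sub>R n"] n \<xi> 3 by simp
  qed
qed

end

section \<open>Umbilicity\<close>

text \<open>The remainder \<open>r\<close> is orthogonal to n, e and f = n e, so it anticommutes
  with all three. Anticommuting with n and with e, it commutes with their product f. Hence f r = 0,
  and r = 0.\<close>

lemma qframe_expand:
  assumes n: "qim n" "norm n = 1" and e: "qim e" "norm e = 1" "n \<bullet> e = 0" and d: "qim d" "n \<bullet> d = 0"
  shows "d = (d \<bullet> e) *\<^sub>R e + (d \<bullet> qmul n e) *\<^sub>R qmul n e"
proof -
  define f where "f = qmul n e"
  note F = qframe[OF n e(1,3), folded f_def]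
  have "norm f = 1" using F(2) e(2) by simp
  then have ff: "e \<bullet> e = 1" "f \<bullet> f = 1" using e(2) by (simp_all add: norm_eq_1)
  define r where "r = d - (d \<bullet> e) *\<^sub>R e - (d \<bullet> f) *\<^sub>R f"
  have r: "qim r" "n \<bullet> r = 0" "e \<bullet> r = 0" "f \<bullet> r = 0"
    using d e F ff by (simp_all add: r_def inner_diff_right inner_commute[of d] inner_commute[of f e])
  have anti: "qmul r c = - qmul c r" if "qim c" "c \<bullet> r = 0" for c
    using qmul_qim_commute[OF that(1) r(1)] that(2) by (metis mult_zero_right scaleR_zero_left diff_zero)
  have "qmul r f = qmul (qmul r n) e" by (simp add: f_def qmul_assoc)
  also have "\<dots> = - qmul n (qmul r e)" by (simp add: anti[OF n(1) r(2)] qmul_assoc qmul.minus_left)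
  also have "\<dots> = qmul f r" by (simp add: anti[OF e(1) r(3)] f_def qmul_assoc qmul.minus_right)
  finally have "qmul f r = - qmul f r" using anti[OF F(1) r(4)] by simp
  then have "qmul f r = 0" by (metis add.right_inverse scaleR_2 scaleR_eq_0_iff zero_neq_numeral)
  then have "r = 0" using ff by (auto simp: qmul_eq_0)
  then show ?thesis by (simp add: r_def f_def algebra_simps)
qed

text \<open>Left multiplication by \<open>qconj Q\<close> carries \<open>Q\<close> to 1 and
  \<open>N\<close> to an imaginary unit n, where the frame e, n e is available.\<close>

lemma orthonormal_complementE:
  assumes "norm Q = 1" "norm N = 1" "Q \<bullet> N = (0::real)"
  obtains E1 E2 :: quat where "norm E1 = 1" "norm E2 = 1" "E1 \<bullet> E2 = 0"
    "Q \<bullet> E1 = 0" "Q \<bullet> E2 = 0" "N \<bullet> E1 = 0" "N \<bullet> E2 = 0"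
    "\<And>d. Q \<bullet> d = 0 \<Longrightarrow> N \<bullet> d = 0 \<Longrightarrow> d = (d \<bullet> E1) *\<^sub>R E1 + (d \<bullet> E2) *\<^sub>R E2"
proof -
  have Q: "Q \<in> S3" using assms by (simp add: S3_def)
  note inner1 = S3_inner_self_qmul[OF Q]
  define n where "n = qmul (qconj Q) N"
  have N: "N = qmul Q n" using Q by (simp add: n_def)
  have n: "qim n" "norm n = 1" using assms(3) inner1[of n] assms by (auto simp: N norm_qmul)
  obtain e where e: "qim e" "norm e = 1" "n \<bullet> e = 0" using orthogonal_qimE by blast
  define f where "f = qmul n e"
  note F = qframe[OF n e(1,3), folded f_def]
  show ?thesis
  proof (rule that[of "qmul Q e" "qmul Q f"])
    fix d assume d: "Q \<bullet> d = 0" "N \<bullet> d = 0"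
    define d' where "d' = qmul (qconj Q) d"
    have d': "d = qmul Q d'" using Q by (simp add: d'_def)
    have "qim d'" "n \<bullet> d' = 0" using d inner1[of d'] Q by (simp_all add: d' N)
    from qframe_expand[OF n e this, folded f_def]
    have "qmul Q d' = qmul Q ((d' \<bullet> e) *\<^sub>R e + (d' \<bullet> f) *\<^sub>R f)" by simp
    moreover have "d \<bullet> qmul Q e = d' \<bullet> e" "d \<bullet> qmul Q f = d' \<bullet> f" using Q by (simp_all add: d')
    ultimately show "d = (d \<bullet> qmul Q e) *\<^sub>R qmul Q e + (d \<bullet> qmul Q f) *\<^sub>R qmul Q f"
      by (simp only: d' qmul.add_right qmul.scaleR_right)
  qed (use Q e F in \<open>simp_all add: norm_qmul S3_norm inner1 N\<close>)
qed

lemma symmetric2_eigen: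
  fixes x y z :: real
  assumes "\<not> (y = 0 \<and> x = z)"
  obtains s1 s2 c1 c2 d1 d2 where "s1 \<noteq> s2" "(c1, c2) \<noteq> (0, 0)" "(d1, d2) \<noteq> (0, 0)"
    "x * c1 + y * c2 = s1 * c1" "y * c1 + z * c2 = s1 * c2"
    "x * d1 + y * d2 = s2 * d1" "y * d1 + z * d2 = s2 * d2"
proof -
  define R where "R = sqrt ((x - z)\<^sup>2 + 4 * y\<^sup>2)"
  have pos: "(x - z)\<^sup>2 + 4 * y\<^sup>2 > 0"
    using assms by (cases "y = 0") (auto intro: add_pos_nonneg add_nonneg_pos)
  have R: "R \<noteq> 0" "R\<^sup>2 = (x - z)\<^sup>2 + 4 * y\<^sup>2" using pos by (simp_all add: R_def)
  \<comment> \<open>The vector (y, s - x) solves the first row identically and the second by the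
    characteristic equation. If it vanishes, the matrix is diagonal with first entry s, and (1, 0)
    serves.\<close>
  have ex: "\<exists>c1 c2. (c1, c2) \<noteq> (0, 0) \<and> x * c1 + y * c2 = s * c1 \<and> y * c1 + z * c2 = s * c2"
    if s: "(s - x) * (s - z) = y\<^sup>2" for s
  proof (cases "(y, s - x) = (0, 0)")
    case True
    then show ?thesis by (intro exI[of _ 1] exI[of _ 0]) auto
  next
    case False
    have "y * y + z * (s - x) = s * (s - x)" using s by (simp add: power2_eq_square algebra_simps)
    then show ?thesis using False
      by (intro exI[of _ y] exI[of _ "s - x"]) (auto simp: algebra_simps)
  qed
  define s1 s2 where "s1 = (x + z + R) / 2" and "s2 = (x + z - R) / 2"
  have "(s1 - x) * (s1 - z) = y\<^sup>2" "(s2 - x) * (s2 - z) = y\<^sup>2" "s1 \<noteq> s2"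
    using R by (simp_all add: s1_def s2_def field_simps power2_eq_square)
  then show ?thesis using ex that by metis
qed

text \<open>Since c > 0, each quadratic has two distinct real roots and no root is 0. A root k
  therefore determines s, so the two pairs of roots are disjoint.\<close>

lemma quadratic_roots_card:
  fixes s1 s2 c :: real
  assumes "s1 \<noteq> s2" "c > 0" and sub: "\<And>s k. s \<in> {s1, s2} \<Longrightarrow> k\<^sup>2 + s * k = c \<Longrightarrow> k \<in> A" and fin: "finite A"
  shows "card A \<ge> 4"
proof -
  define r where "r s = sqrt (s\<^sup>2 + 4 * c)" for s
  have r: "r s > 0" "(r s)\<^sup>2 = s\<^sup>2 + 4 * c" for s
    using assms(2) by (simp_all add: r_def add_nonneg_pos)
  define kp km where "kp s = (- s + r s) / 2" and "km s = (- s - r s) / 2" for s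
  have eq: "(kp s)\<^sup>2 + s * kp s = c" "(km s)\<^sup>2 + s * km s = c" for s
    using r(2)[of s] by (simp_all add: kp_def km_def field_simps power2_eq_square)
  have inj: "s = s'" if "k\<^sup>2 + s * k = c" "k\<^sup>2 + s' * k = c" for s s' k
    using that assms(2) by (metis add_left_cancel mult_right_cancel mult_zero_right add_0 power_zero_numeral less_irrefl)
  have "kp s \<noteq> km s" for s using r(1)[of s] by (simp add: kp_def km_def)
  moreover have "kp s1 \<noteq> kp s2" "kp s1 \<noteq> km s2" "km s1 \<noteq> kp s2" "km s1 \<noteq> km s2"
    using inj[of _ s1 s2] eq assms(1) by metis+
  ultimately have "card {kp s1, km s1, kp s2, km s2} = 4" by simp
  moreover have "{kp s1, km s1, kp s2, km s2} \<subseteq> A" using sub eq by auto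
  ultimately show ?thesis using card_mono[OF fin] by metis
qed

text \<open>$Q$ maps $M$ submersively onto (pieces of) a surface in $\mathbf{S}^3$ with unit normal $N$.
  The assumption \<open>curvature\<close> is the only link to the geometry of $M$ itself.\<close>
locale gauss_hypersurface = normal_hypersurface +
  fixes Q N :: "pt \<Rightarrow> quat"
  assumes smooth_Q: "is_chart M \<phi> V \<Longrightarrow> smooth_on V (\<lambda>u. Q (\<phi> u))"
    and smooth_N: "is_chart M \<phi> V \<Longrightarrow> smooth_on V (\<lambda>u. N (\<phi> u))"
    and unit: "x \<in> M \<Longrightarrow> norm (Q x) = 1" "x \<in> M \<Longrightarrow> norm (N x) = 1" "x \<in> M \<Longrightarrow> Q x \<bullet> N x = 0"
    and N_orth: "is_chart M \<phi> V \<Longrightarrow> u \<in> V \<Longrightarrow> N (\<phi> u) \<bullet> frechet_derivative (\<lambda>u. Q (\<phi> u)) (at u) v = 0"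
    and Q_onto: "is_chart M \<phi> V \<Longrightarrow> u \<in> V \<Longrightarrow> Q (\<phi> u) \<bullet> E = 0 \<Longrightarrow> N (\<phi> u) \<bullet> E = 0 \<Longrightarrow>
        \<exists>v. frechet_derivative (\<lambda>u. Q (\<phi> u)) (at u) v = E"
    and curvature: "is_chart M \<phi> V \<Longrightarrow> u \<in> V \<Longrightarrow> E \<noteq> 0 \<Longrightarrow> Q (\<phi> u) \<bullet> E = 0 \<Longrightarrow> N (\<phi> u) \<bullet> E = 0 \<Longrightarrow>
        (\<And>v. frechet_derivative (\<lambda>u. Q (\<phi> u)) (at u) v = E \<Longrightarrow>
              frechet_derivative (\<lambda>u. N (\<phi> u)) (at u) v = s *\<^sub>R E) \<Longrightarrow>
        k\<^sup>2 + s * k = 1/12 \<Longrightarrow> k \<in> principal_curvatures M \<xi> (\<phi> u)"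
    and card_curvatures: "x \<in> M \<Longrightarrow> card (principal_curvatures M \<xi> x) = 3"
begin

section \<open>The Weingarten map of the image surface\<close>

abbreviation "dQ \<phi> u \<equiv> frechet_derivative (\<lambda>u. Q (\<phi> u)) (at u)"
abbreviation "dN \<phi> u \<equiv> frechet_derivative (\<lambda>u. N (\<phi> u)) (at u)"

context
  fixes \<phi> V assumes chart: "is_chart M \<phi> V"
begin

lemma V_open: "open V"
  using chart by (rule chart_open)

lemma derivQ: "u \<in> V \<Longrightarrow> ((\<lambda>u. Q (\<phi> u)) has_derivative dQ \<phi> u) (at u)"
  and derivN: "u \<in> V \<Longrightarrow> ((\<lambda>u. N (\<phi> u)) has_derivative dN \<phi> u) (at u)"
  using smooth_on_has_derivative smooth_Q[OF chart] smooth_N[OF chart] V_open by blast+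

lemma dQ_orth: assumes "u \<in> V" shows "Q (\<phi> u) \<bullet> dQ \<phi> u v = 0"
proof -
  have "((\<lambda>y. Q (\<phi> y) \<bullet> Q (\<phi> y)) has_derivative (\<lambda>v. Q (\<phi> u) \<bullet> dQ \<phi> u v + dQ \<phi> u v \<bullet> Q (\<phi> u))) (at u)"
    by (rule has_derivative_inner[OF derivQ[OF assms] derivQ[OF assms]])
  from has_derivative_eq_zero_on[OF this V_open assms, of 1]
  show ?thesis using unit(1) chart_in[OF chart] by (simp add: norm_eq_1 inner_commute)
qed

lemma dN_orth:
  assumes "u \<in> V" shows "N (\<phi> u) \<bullet> dN \<phi> u v = 0" "Q (\<phi> u) \<bullet> dN \<phi> u v = 0"
proof -
  have "((\<lambda>y. N (\<phi> y) \<bullet> N (\<phi> y)) has_derivative (\<lambda>v. N (\<phi> u) \<bullet> dN \<phi> u v + dN \<phi> u v \<bullet> N (\<phi> u))) (at u)"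
    by (rule has_derivative_inner[OF derivN[OF assms] derivN[OF assms]])
  from has_derivative_eq_zero_on[OF this V_open assms, of 1]
  show "N (\<phi> u) \<bullet> dN \<phi> u v = 0" using unit(2) chart_in[OF chart] by (simp add: norm_eq_1 inner_commute)
  have "((\<lambda>y. Q (\<phi> y) \<bullet> N (\<phi> y)) has_derivative (\<lambda>v. Q (\<phi> u) \<bullet> dN \<phi> u v + dQ \<phi> u v \<bullet> N (\<phi> u))) (at u)"
    by (rule has_derivative_inner[OF derivQ[OF assms] derivN[OF assms]])
  from has_derivative_eq_zero_on[OF this V_open assms, of 0]
  show "Q (\<phi> u) \<bullet> dN \<phi> u v = 0" using unit(3) chart_in[OF chart] N_orth[OF chart assms]
    by (simp add: inner_commute)
qed

lemma dN_symmetric: assumes "u \<in> V" shows "dN \<phi> u w \<bullet> dQ \<phi> u v = dN \<phi> u v \<bullet> dQ \<phi> u w"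
  by (rule conormal_symmetric[OF V_open assms smooth_Q[OF chart] derivN[OF assms]])
     (rule N_orth[OF chart])

text \<open>\<open>dQ\<close> has a kernel, so the Weingarten map has to be shown well defined. For
  z in that kernel, dN z is tangent to the surface and thus equals dQ y for some y; symmetry gives
  |dN z|^2 = <dN y, dQ z> = 0.\<close>

lemma dN_factor:
  assumes u: "u \<in> V" and "dQ \<phi> u v = dQ \<phi> u w"
  shows "dN \<phi> u v = dN \<phi> u w"
proof -
  have linQ: "linear (dQ \<phi> u)" and linN: "linear (dN \<phi> u)"
    using derivQ[OF u] derivN[OF u] has_derivative_linear by blast+
  define z where "z = v - w"
  have z: "dQ \<phi> u z = 0" using assms by (simp add: z_def linear_diff[OF linQ])
  obtain y where "dQ \<phi> u y = dN \<phi> u z" using Q_onto[OF chart u] dN_orth[OF u] by metis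
  then have "dN \<phi> u z \<bullet> dN \<phi> u z = 0" using dN_symmetric[OF u, of z y] z by simp
  then show ?thesis by (simp add: z_def linear_diff[OF linN])
qed

lemma umbilic: assumes u: "u \<in> V" shows "\<exists>l. \<forall>v. dN \<phi> u v = l *\<^sub>R dQ \<phi> u v"
proof -
  have linQ: "linear (dQ \<phi> u)" and linN: "linear (dN \<phi> u)"
    using derivQ[OF u] derivN[OF u] has_derivative_linear by blast+
  note xM = chart_in[OF chart u]
  obtain E1 E2 where E: "norm E1 = 1" "norm E2 = 1" "E1 \<bullet> E2 = 0"
    "Q (\<phi> u) \<bullet> E1 = 0" "Q (\<phi> u) \<bullet> E2 = 0" "N (\<phi> u) \<bullet> E1 = 0" "N (\<phi> u) \<bullet> E2 = 0"
    and exp: "\<And>d. Q (\<phi> u) \<bullet> d = 0 \<Longrightarrow> N (\<phi> u) \<bullet> d = 0 \<Longrightarrow> d = (d \<bullet> E1) *\<^sub>R E1 + (d \<bullet> E2) *\<^sub>R E2"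
    using orthonormal_complementE[OF unit[OF xM]] by metis
  obtain v1 v2 where v: "dQ \<phi> u v1 = E1" "dQ \<phi> u v2 = E2"
    using Q_onto[OF chart u] E by metis
  define x y z where "x = dN \<phi> u v1 \<bullet> E1" and "y = dN \<phi> u v1 \<bullet> E2" and "z = dN \<phi> u v2 \<bullet> E2"
  have y': "dN \<phi> u v2 \<bullet> E1 = y" using dN_symmetric[OF u, of v1 v2] v by (simp add: y_def)
  have n1: "dN \<phi> u v1 = x *\<^sub>R E1 + y *\<^sub>R E2" unfolding x_def y_def
    by (rule exp[OF dN_orth(2)[OF u] dN_orth(1)[OF u]])
  have n2: "dN \<phi> u v2 = y *\<^sub>R E1 + z *\<^sub>R E2" unfolding y'[symmetric] z_def
    by (rule exp[OF dN_orth(2)[OF u] dN_orth(1)[OF u]])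
  have dN: "dN \<phi> u v = (x * c1 + y * c2) *\<^sub>R E1 + (y * c1 + z * c2) *\<^sub>R E2"
    if "dQ \<phi> u v = c1 *\<^sub>R E1 + c2 *\<^sub>R E2" for v c1 c2
  proof -
    have "dQ \<phi> u v = dQ \<phi> u (c1 *\<^sub>R v1 + c2 *\<^sub>R v2)"
      using that v by (simp add: linear_add[OF linQ] linear_scale[OF linQ])
    from dN_factor[OF u this] show ?thesis
      by (simp add: linear_add[OF linN] linear_scale[OF linN] n1 n2 algebra_simps)
  qed
  show ?thesis
  proof (cases "y = 0 \<and> x = z")
    case True
    have "dN \<phi> u v = x *\<^sub>R dQ \<phi> u v" for v
    proof -
      have "dQ \<phi> u v = (dQ \<phi> u v \<bullet> E1) *\<^sub>R E1 + (dQ \<phi> u v \<bullet> E2) *\<^sub>R E2" (is "_ = ?r")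
        by (rule exp[OF dQ_orth[OF u] N_orth[OF chart u]])
      from dN[OF this] have "dN \<phi> u v = x *\<^sub>R ?r" using True by (simp add: scaleR_add_right)
      then show ?thesis using \<open>dQ \<phi> u v = ?r\<close> by simp
    qed
    then show ?thesis by blast
  next
    case False
    obtain s1 s2 c1 c2 d1 d2 where s: "s1 \<noteq> s2" "(c1, c2) \<noteq> (0, 0)" "(d1, d2) \<noteq> (0, 0)"
      "x * c1 + y * c2 = s1 * c1" "y * c1 + z * c2 = s1 * c2"
      "x * d1 + y * d2 = s2 * d1" "y * d1 + z * d2 = s2 * d2"
      using symmetric2_eigen[OF False] by metis
    have *: "k \<in> principal_curvatures M \<xi> (\<phi> u)"
      if "(a, b) \<noteq> (0, 0)" "x * a + y * b = s * a" "y * a + z * b = s * b" "k\<^sup>2 + s * k = 1/12" for k a b s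
    proof (rule curvature[OF chart u _ _ _ _ that(4)])
      have "(a *\<^sub>R E1 + b *\<^sub>R E2) \<bullet> (a *\<^sub>R E1 + b *\<^sub>R E2) = a * a + b * b"
        using E by (simp add: inner_add_left inner_add_right inner_commute[of E2 E1] norm_eq_1)
      moreover have "a * a + b * b \<noteq> 0" using that(1) by (simp add: sum_squares_eq_zero_iff)
      ultimately show "a *\<^sub>R E1 + b *\<^sub>R E2 \<noteq> 0" by force
      fix v assume "dQ \<phi> u v = a *\<^sub>R E1 + b *\<^sub>R E2"
      from dN[OF this] that show "dN \<phi> u v = s *\<^sub>R (a *\<^sub>R E1 + b *\<^sub>R E2)"
        by (simp add: scaleR_add_right)
    qed (use E in \<open>simp_all add: inner_add_right\<close>)
    have "card (principal_curvatures M \<xi> (\<phi> u)) \<ge> 4"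
    proof (rule quadratic_roots_card[OF s(1)])
      \<comment> \<open>An infinite set would have \<open>card\<close> 0.\<close>
      show "finite (principal_curvatures M \<xi> (\<phi> u))"
        using card_curvatures[OF xM] by (metis card.infinite zero_neq_numeral)
      show "k \<in> principal_curvatures M \<xi> (\<phi> u)" if "s \<in> {s1, s2}" "k\<^sup>2 + s * k = 1/12" for s k
        using that *[OF s(2,4,5)] *[OF s(3,6,7)] by blast
    qed simp
    then show ?thesis using card_curvatures[OF xM] by simp
  qed
qed

text \<open>The Codazzi argument. Differentiating dN = l dQ once more and using the symmetry of
  second derivatives gives l'(w) dQ v = l'(v) dQ w. As the image of dQ is a plane, v can be chosen
  with dQ v nonzero and orthogonal to dQ w.\<close>

lemma umbilic_factor_derivative_zero:
  assumes W: "open W" "W \<subseteq> V" "u \<in> W" and l: "(l has_derivative l') (at u)"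
    and umb: "\<And>y v. y \<in> W \<Longrightarrow> dN \<phi> y v = l y *\<^sub>R dQ \<phi> y v"
  shows "l' w = 0"
proof -
  have u: "u \<in> V" using W by auto
  have d2: "ider (\<lambda>u. N (\<phi> u)) [w, v] u = l u *\<^sub>R ider (\<lambda>u. Q (\<phi> u)) [w, v] u + l' w *\<^sub>R dQ \<phi> u v" for v w
  proof -
    have "((\<lambda>y. l y *\<^sub>R dQ \<phi> y v) has_derivative
        (\<lambda>w. l u *\<^sub>R ider (\<lambda>u. Q (\<phi> u)) [w, v] u + l' w *\<^sub>R dQ \<phi> u v)) (at u)"
      using has_derivative_scaleR[OF l smooth_on_ider_has_derivative[OF smooth_Q[OF chart] V_open u, of "[v]"]] by simp
    then have "((\<lambda>y. dN \<phi> y v) has_derivative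
        (\<lambda>w. l u *\<^sub>R ider (\<lambda>u. Q (\<phi> u)) [w, v] u + l' w *\<^sub>R dQ \<phi> u v)) (at u)"
      by (rule has_derivative_transform_within_open[OF _ W(1,3)]) (simp add: umb)
    from frechet_derivative_at[OF this] show ?thesis by (simp add: fun_eq_iff)
  qed
  have sym: "l' w *\<^sub>R dQ \<phi> u v = l' v *\<^sub>R dQ \<phi> u w" for v w
    using d2[of w v] d2[of v w] ider_commute[OF smooth_Q[OF chart] V_open u, of w v]
      ider_commute[OF smooth_N[OF chart] V_open u, of w v] by simp
  obtain E1 E2 where E: "norm E1 = 1" "norm E2 = 1" "E1 \<bullet> E2 = 0"
    "Q (\<phi> u) \<bullet> E1 = 0" "Q (\<phi> u) \<bullet> E2 = 0" "N (\<phi> u) \<bullet> E1 = 0" "N (\<phi> u) \<bullet> E2 = 0"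
    using orthonormal_complementE[OF unit[OF chart_in[OF chart u]]] by metis
  define d where "d = dQ \<phi> u w"
  have "\<exists>E. E \<noteq> 0 \<and> E \<bullet> d = 0 \<and> Q (\<phi> u) \<bullet> E = 0 \<and> N (\<phi> u) \<bullet> E = 0"
  proof (cases "E1 \<bullet> d = 0")
    case True
    then show ?thesis using E by (intro exI[of _ E1]) auto
  next
    case False
    \<comment> \<open>The vector \<open>d\<close> projected to the plane of \<open>E1\<close> and
      \<open>E2\<close> and turned by a right angle, up to sign.\<close>
    define E3 where "E3 = (E2 \<bullet> d) *\<^sub>R E1 - (E1 \<bullet> d) *\<^sub>R E2"
    have "E3 \<bullet> E2 = - (E1 \<bullet> d)" using E by (simp add: E3_def inner_diff_left norm_eq_1)
    then have "E3 \<noteq> 0" using False by auto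
    moreover have "E3 \<bullet> d = 0" by (simp add: E3_def inner_diff_left)
    ultimately show ?thesis using E by (intro exI[of _ E3]) (auto simp: E3_def inner_diff_right)
  qed
  then obtain E0 where E0: "E0 \<noteq> 0" "E0 \<bullet> d = 0" "Q (\<phi> u) \<bullet> E0 = 0" "N (\<phi> u) \<bullet> E0 = 0" by blast
  then obtain v where "dQ \<phi> u v = E0" using Q_onto[OF chart u] by metis
  then have "l' w * (E0 \<bullet> E0) = 0"
    using sym[of w v] E0(2) by (metis d_def inner_scaleR_right mult_zero_right)
  then show ?thesis using E0(1) by simp
qed

lemma umbilic_local:
  assumes u: "u \<in> V"
  shows "\<exists>l c r. r > 0 \<and> ball u r \<subseteq> V \<and> (\<forall>y\<in>ball u r. N (\<phi> y) = l *\<^sub>R Q (\<phi> y) + c)"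
proof -
  obtain E where E: "norm E = 1" "Q (\<phi> u) \<bullet> E = 0" "N (\<phi> u) \<bullet> E = 0"
    using orthonormal_complementE[OF unit[OF chart_in[OF chart u]]] by metis
  obtain v where v: "dQ \<phi> u v = E" using Q_onto[OF chart u] E by metis
  have diffQ: "(\<lambda>y. dQ \<phi> y v) differentiable at y" and diffN: "(\<lambda>y. dN \<phi> y v) differentiable at y" if "y \<in> V" for y
    using differentiableI[OF smooth_on_ider_has_derivative[OF smooth_Q[OF chart] V_open that, of "[v]"]]
      differentiableI[OF smooth_on_ider_has_derivative[OF smooth_N[OF chart] V_open that, of "[v]"]] by simp_all
  have "continuous_on V (\<lambda>y. dQ \<phi> y v)"
    using diffQ by (meson continuous_at_imp_continuous_on differentiable_imp_continuous_within)
  then have "open (V \<inter> (\<lambda>y. dQ \<phi> y v) -` (- {0}))"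
    using V_open by (intro continuous_open_preimage) auto
  moreover have "u \<in> V \<inter> (\<lambda>y. dQ \<phi> y v) -` (- {0})" using u v E by auto
  ultimately obtain r where r: "r > 0" "ball u r \<subseteq> V \<inter> (\<lambda>y. dQ \<phi> y v) -` (- {0})"
    using openE by blast
  \<comment> \<open>\<open>umbilic\<close> yields the factor only pointwise. As a quotient along one
    fixed chart direction \<open>v\<close> with \<open>dQ\<close> nonzero on \<open>v\<close>, it
    becomes visibly differentiable.\<close>
  define l where "l y = (dN \<phi> y v \<bullet> dQ \<phi> y v) / (dQ \<phi> y v \<bullet> dQ \<phi> y v)" for y
  have umb: "dN \<phi> y w = l y *\<^sub>R dQ \<phi> y w" if y: "y \<in> ball u r" for y w
  proof -
    obtain k where k: "\<And>w. dN \<phi> y w = k *\<^sub>R dQ \<phi> y w" using umbilic y r by blast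
    have "dQ \<phi> y v \<noteq> 0" using y r by auto
    then have "l y = k" by (simp add: l_def k)
    then show ?thesis using k by simp
  qed
  have lconst: "l y = l u" if "y \<in> ball u r" for y
  proof -
    have "\<exists>c. \<forall>y\<in>ball u r. l y = c"
    proof (rule has_derivative_zero_constant)
      fix y assume y: "y \<in> ball u r"
      then have yV: "y \<in> V" and ne: "dQ \<phi> y v \<noteq> 0" using r by auto
      have "l differentiable at y"
        unfolding l_def[abs_def] using ne
        by (intro differentiable_divide differentiable_inner diffQ[OF yV] diffN[OF yV]) auto
      then obtain l' where l': "(l has_derivative l') (at y)" by (auto simp: differentiable_def)
      have "l' = (\<lambda>w. 0)"
        using umbilic_factor_derivative_zero[OF open_ball _ y l' umb] r by fastforce
      then show "(l has_derivative (\<lambda>h. 0)) (at y within ball u r)"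
        using l' has_derivative_at_withinI by blast
    qed simp
    then show ?thesis using that r(1) by (metis centre_in_ball)
  qed
  have "\<exists>c. \<forall>y\<in>ball u r. N (\<phi> y) - l u *\<^sub>R Q (\<phi> y) = c"
  proof (rule has_derivative_zero_constant)
    fix y assume y: "y \<in> ball u r"
    then have yV: "y \<in> V" using r by auto
    have "((\<lambda>y. N (\<phi> y) - l u *\<^sub>R Q (\<phi> y)) has_derivative (\<lambda>w. dN \<phi> y w - l u *\<^sub>R dQ \<phi> y w)) (at y)"
      by (intro has_derivative_diff has_derivative_scaleR_right derivN[OF yV] derivQ[OF yV])
    moreover have "(\<lambda>w. dN \<phi> y w - l u *\<^sub>R dQ \<phi> y w) = (\<lambda>w. 0)"
      using umb[OF y] lconst[OF y] by simp
    ultimately have "((\<lambda>y. N (\<phi> y) - l u *\<^sub>R Q (\<phi> y)) has_derivative (\<lambda>h. 0)) (at y)" by simp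
    then show "((\<lambda>y. N (\<phi> y) - l u *\<^sub>R Q (\<phi> y)) has_derivative (\<lambda>h. 0)) (at y within ball u r)"
      by (rule has_derivative_at_withinI)
  qed simp
  then obtain c where "\<forall>y\<in>ball u r. N (\<phi> y) - l u *\<^sub>R Q (\<phi> y) = c" by blast
  then have "\<forall>y\<in>ball u r. N (\<phi> y) = l u *\<^sub>R Q (\<phi> y) + c" by (simp add: diff_eq_eq add.commute)
  then show ?thesis using r by blast
qed

text \<open>If l and l' differed, Q would be constant on the ball, although its derivative maps onto
  a plane.\<close>

lemma umbilic_unique:
  assumes u: "u \<in> V" "r > 0" "ball u r \<subseteq> V"
    and eq: "\<And>y. y \<in> ball u r \<Longrightarrow> l *\<^sub>R Q (\<phi> y) + c = l' *\<^sub>R Q (\<phi> y) + c'"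
  shows "l = l' \<and> c = c'"
proof -
  have "((\<lambda>y. (l - l') *\<^sub>R Q (\<phi> y)) has_derivative (\<lambda>v. (l - l') *\<^sub>R dQ \<phi> u v)) (at u)"
    by (intro has_derivative_scaleR_right derivQ u)
  moreover have "(l - l') *\<^sub>R Q (\<phi> y) = c' - c" if "y \<in> ball u r" for y
    using eq[OF that] by (simp add: algebra_simps)
  ultimately have z: "(l - l') *\<^sub>R dQ \<phi> u v = 0" for v
    using has_derivative_eq_zero_on[OF _ open_ball, of _ _ u u r "c' - c"] u by fastforce
  obtain E where E: "norm E = 1" "Q (\<phi> u) \<bullet> E = 0" "N (\<phi> u) \<bullet> E = 0"
    using orthonormal_complementE[OF unit[OF chart_in[OF chart u(1)]]] by metis
  obtain v where v: "dQ \<phi> u v = E" using Q_onto[OF chart u(1)] E by metis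
  have "l = l'" using z[of v] v E by auto
  then show ?thesis using eq[of u] u by simp
qed

lemma chart_ball_openin:
  assumes "ball u r \<subseteq> V"
  shows "openin (top_of_set M) (\<phi> ` ball u r)"
proof -
  have c: "openin (top_of_set M) (\<phi> ` V)" "continuous_on (\<phi> ` V) (inv_into V \<phi>)" "inj_on \<phi> V"
    using chart by (auto simp: is_chart_def)
  have "\<phi> ` ball u r = \<phi> ` V \<inter> inv_into V \<phi> -` ball u r"
    using assms c(3) by (auto simp: inv_into_f_f)
  moreover have "openin (top_of_set (\<phi> ` V)) (\<phi> ` V \<inter> inv_into V \<phi> -` ball u r)"
    using c(2) by (simp add: continuous_openin_preimage_gen)
  ultimately show ?thesis using c(1) openin_trans by metis
qed

end

lemma umbilic_nhd:
  assumes "x \<in> M"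
  shows "\<exists>l c T. openin (top_of_set M) T \<and> x \<in> T \<and> (\<forall>y\<in>T. N y = l *\<^sub>R Q y + c)"
proof -
  obtain \<phi> V u where c: "is_chart M \<phi> V" "u \<in> V" "x = \<phi> u" using chartE[OF assms] by blast
  obtain l d r where r: "r > 0" "ball u r \<subseteq> V" "\<forall>y\<in>ball u r. N (\<phi> y) = l *\<^sub>R Q (\<phi> y) + d"
    using umbilic_local[OF c(1,2)] by blast
  show ?thesis
    using chart_ball_openin[OF c(1) r(2)] r c
    by (intro exI[of _ l] exI[of _ d] exI[of _ "\<phi> ` ball u r"]) auto
qed

lemma umbilic_nhd_unique:
  assumes T: "openin (top_of_set M) T" "x \<in> T" and eq: "\<And>y. y \<in> T \<Longrightarrow> l *\<^sub>R Q y + c = l' *\<^sub>R Q y + c'"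
  shows "l = l' \<and> c = c'"
proof -
  have "x \<in> M" using T openin_imp_subset by blast
  then obtain \<phi> V u where ch: "is_chart M \<phi> V" "u \<in> V" "x = \<phi> u" using chartE by blast
  obtain S where S: "open S" "T = M \<inter> S" using T(1) unfolding openin_open by blast
  have "smooth_on V \<phi>" "open V" using ch by (auto simp: is_chart_def)
  then have "continuous_on V \<phi>"
    using chart_derivative(1)[OF ch(1)] by (meson continuous_at_imp_continuous_on has_derivative_continuous)
  then have "open (V \<inter> \<phi> -` S)" using \<open>open V\<close> S(1) by (simp add: continuous_open_preimage)
  moreover have "u \<in> V \<inter> \<phi> -` S" using ch S T by auto
  ultimately obtain r where r: "r > 0" "ball u r \<subseteq> V \<inter> \<phi> -` S" using openE by blast
  have "\<phi> y \<in> T" if "y \<in> ball u r" for y using that r S chart_in[OF ch(1)] by auto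
  then show ?thesis using umbilic_unique[OF ch(1,2) r(1), of l c l' c'] r(2) eq by auto
qed

text \<open>A choice \<open>L\<close> of constants at every point is locally constant, by uniqueness
  on the overlap of two neighbourhoods, and hence constant on the connected set
  \<open>M\<close>.\<close>

lemma umbilic_global:
  assumes "connected M"
  obtains l c where "\<And>x. x \<in> M \<Longrightarrow> N x = l *\<^sub>R Q x + c"
proof -
  obtain L where L: "\<And>x. x \<in> M \<Longrightarrow> \<exists>T. openin (top_of_set M) T \<and> x \<in> T \<and> (\<forall>y\<in>T. N y = fst (L x) *\<^sub>R Q y + snd (L x))"
  proof -
    have "\<forall>x. \<exists>lc. x \<in> M \<longrightarrow> (\<exists>T. openin (top_of_set M) T \<and> x \<in> T \<and> (\<forall>y\<in>T. N y = fst lc *\<^sub>R Q y + snd lc))"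
      using umbilic_nhd by (metis fst_conv snd_conv)
    then show ?thesis using that by metis
  qed
  have loc: "\<forall>\<^sub>F y in at x within M. L x = L y" if x: "x \<in> M" for x
  proof -
    obtain T where T: "openin (top_of_set M) T" "x \<in> T" "\<forall>y\<in>T. N y = fst (L x) *\<^sub>R Q y + snd (L x)"
      using L[OF x] by blast
    have "L x = L y" if y: "y \<in> T" for y
    proof -
      have "y \<in> M" using y T openin_imp_subset by blast
      then obtain T' where T': "openin (top_of_set M) T'" "y \<in> T'" "\<forall>z\<in>T'. N z = fst (L y) *\<^sub>R Q z + snd (L y)"
        using L by blast
      have "fst (L x) = fst (L y) \<and> snd (L x) = snd (L y)"
        using T T' y by (intro umbilic_nhd_unique[of "T \<inter> T'" y]) auto
      then show ?thesis by (simp add: prod_eq_iff)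
    qed
    moreover obtain S where "open S" "T = M \<inter> S" using T(1) unfolding openin_open by blast
    ultimately show ?thesis using T(2) unfolding eventually_at_topological by blast
  qed
  show ?thesis
  proof (cases "M = {}")
    case False
    then obtain x0 where x0: "x0 \<in> M" by blast
    have "L x = L x0" if "x \<in> M" for x
      using connected_local_const[OF assms that x0] loc by blast
    then show ?thesis using that[of "fst (L x0)" "snd (L x0)"] L by metis
  qed (use that in auto)
qed

end

section \<open>Principal curvatures of the three types\<close>

text \<open>For $X = (p a, q b)$, $\xi = (p m_1, q m_2)$ and $D_X\xi = (p w_1, q w_2)$, the equation
  $g(kX, Z) = -g(\nabla_X\xi, Z)$ for $Z = (p c, q d)$ reads
  $\langle c, \Gamma\rangle + \langle d, \Delta\rangle = 0$, where $\Gamma$ is the following vector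
  and $\Delta$ arises from it by exchanging the two factors.\<close>
definition shape_defect :: "real \<Rightarrow> quat \<Rightarrow> quat \<Rightarrow> quat \<Rightarrow> quat \<Rightarrow> quat \<Rightarrow> quat \<Rightarrow> quat" where
  "shape_defect k a b w1 w2 m1 m2 = k *\<^sub>R ((4/3) *\<^sub>R a - (2/3) *\<^sub>R b) + (4/3) *\<^sub>R w1 - (2/3) *\<^sub>R w2
     + (1/3) *\<^sub>R (qmul b m2 + qmul m2 b + qmul m2 a - qmul a m2 + qmul b m1 - qmul m1 b)"

lemma inner_qmul_qim:
  assumes "qim b"
  shows "qmul b d \<bullet> a = - (d \<bullet> qmul b a)" "a \<bullet> qmul b d = - (d \<bullet> qmul b a)"
    "qmul d b \<bullet> a = - (d \<bullet> qmul a b)" "a \<bullet> qmul d b = - (d \<bullet> qmul a b)"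
  using inner_qmul_swap(1)[of b d a] inner_qmul_swap(2)[of d b a] qconj_qim[OF assms]
  by (simp_all add: inner_commute[of a] qmul.minus_left qmul.minus_right)

lemma (in normal_hypersurface) principal_curvatureI:
  assumes chart: "is_chart M \<phi> V" "u \<in> V"
    and X: "frechet_derivative \<phi> (at u) v = lift (\<phi> u) a b" "qim a" "qim b" "a \<noteq> 0 \<or> b \<noteq> 0"
    and W: "frechet_derivative (\<lambda>u. \<xi> (\<phi> u)) (at u) v = lift (\<phi> u) w1 w2"
    and m: "\<xi> (\<phi> u) = lift (\<phi> u) m1 m2"
    and defect: "shape_defect k a b w1 w2 m1 m2 = 0" "shape_defect k b a w2 w1 m2 m1 = 0"
  shows "k \<in> principal_curvatures M \<xi> (\<phi> u)"
proof -
  define x where "x = \<phi> u"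
  have xM: "x \<in> M" using chart_in[OF chart] by (simp add: x_def)
  note x = M_S3[OF xM]
  note m' = m[folded x_def]
  have mi: "qim m1" "qim m2" using normal_TS3S3[OF xM] TS3S3_lift[OF x] by (simp_all add: m')
  let ?X = "lift x a b"
  have lin: "linear (frechet_derivative \<phi> (at u))"
    using chart_derivative(1)[OF chart] has_derivative_linear by blast
  have tX: "?X \<in> tangent_space M x" "k *\<^sub>R ?X \<in> tangent_space M x"
    using chart_tangent_space(1)[OF chart, folded x_def] X(1)[folded x_def] linear_scale[OF lin, of k v]
    by (metis rangeI)+
  have "gnk x (k *\<^sub>R ?X) Z = - (gnk x (lift x w1 w2) Z
      + 1/2 * (dgnk x ?X (\<xi> x) Z + dgnk x (\<xi> x) ?X Z - dgnk x Z ?X (\<xi> x)))"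
    if Z: "Z \<in> tangent_space M x" for Z
  proof -
    obtain c d where cd: "Z = lift x c d" "qim c" "qim d"
      using TS3S3_liftE[OF x tangent_space_TS3S3[OF xM Z]] by metis
    have k: "k *\<^sub>R ?X = lift x (k *\<^sub>R a) (k *\<^sub>R b)" by (simp add: qmul.scaleR_right)
    \<comment> \<open>This sum is the difference of the two sides of the goal: skew-adjointness of
      imaginary multiplication brings every Christoffel term into the form of a product with
      \<open>c\<close> or \<open>d\<close>.\<close>
    have "shape_defect k a b w1 w2 m1 m2 \<bullet> c + shape_defect k b a w2 w1 m2 m1 \<bullet> d = 0"
      by (simp add: defect)
    then show ?thesis
      unfolding k cd(1) m' gnk_lift[OF x] dgnk_lift[OF x X(2,3)] dgnk_lift[OF x mi] dgnk_lift[OF x cd(2,3)]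
        shape_defect_def
      using X(2,3) mi cd(2,3)
      by (simp add: inner_add_left inner_diff_left inner_commute[of c] inner_commute[of d]
          inner_qmul_qim(1)[of a c] inner_qmul_qim(1)[of m1 c] inner_qmul_qim(2)[of b _ d] inner_qmul_qim(2)[of m2 _ d]
          inner_qmul_qim(3)[of a c] inner_qmul_qim(3)[of m1 c] inner_qmul_qim(4)[of m2 _ d] inner_qmul_qim(4)[of b _ d]
          field_simps)
  qed
  moreover have "deriv_along M \<xi> x ?X (lift x w1 w2)"
    using deriv_along_chart[OF chart chart_derivative(2)[OF chart], of v] X(1) W by (simp add: x_def)
  ultimately have "shape M \<xi> x ?X (k *\<^sub>R ?X)" unfolding shape_def using tX by blast
  moreover have "?X \<noteq> 0"
  proof -
    have "fst x \<noteq> 0" "snd x \<noteq> 0" using x by (auto simp: S3_def)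
    then show ?thesis using X(4) by (metis fst_conv fst_zero qmul_eq_0 snd_conv snd_zero)
  qed
  ultimately show ?thesis unfolding principal_curvatures_def x_def by blast
qed

text \<open>Pairing with an arbitrary vector turns a quaternion identity into a scalar one, which
  \<open>algebra\<close> can settle.\<close>

lemma inner_all_zeroD: "(\<And>z. (a::'a::real_inner) \<bullet> z = 0) \<Longrightarrow> a = 0"
  by (metis inner_eq_zero_iff)

text \<open>The fibre directions are (c, 0), and (e/2, e) is the lift of \<open>e\<close> orthogonal
  to them. The eigenvector adds the fibre vector (n e, 0); the fibre part of the eigenvalue equation
  gives its coefficient -1/(4k), and the other part then becomes the quadratic equation for
  \<open>k\<close>. The vector \<open>w1\<close> comes from differentiating p q^{-1} N / 2, the
  first component of the normal, under dN = s q e.\<close>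

lemma shape_defect_product:
  assumes n: "qim n" "norm n = 1" and e: "qim e" "n \<bullet> e = 0" and k: "k\<^sup>2 + s * k = 1/12"
    and a: "a = (1/2) *\<^sub>R e - (1 / (4 * k)) *\<^sub>R qmul n e"
    and w1: "w1 = (1/2) *\<^sub>R (qmul a n - qmul e n + s *\<^sub>R e)"
  shows "shape_defect k a e w1 (s *\<^sub>R e) ((1/2) *\<^sub>R n) n = 0"
    "shape_defect k e a (s *\<^sub>R e) w1 n ((1/2) *\<^sub>R n) = 0"
proof -
  define f where "f = qmul n e"
  note F = qframe[OF n e, folded f_def]
  define c where "c = 1 / (4 * k)"
  \<comment> \<open>Replacing 1/k by the variable \<open>c\<close> makes the goals polynomial; the
    formula for \<open>s\<close> is the quadratic equation divided by \<open>k\<close>.\<close>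
  have "k \<noteq> 0" using k by auto
  then have kc: "4 * k * c = 1" by (simp add: c_def)
  have s: "s = c / 3 - k" using k \<open>k \<noteq> 0\<close> by (simp add: c_def field_simps power2_eq_square)
  have a': "a = (1/2) *\<^sub>R e - c *\<^sub>R f" by (simp add: a c_def f_def)
  have na: "qmul n a = (1/2) *\<^sub>R f + c *\<^sub>R e" "qmul a n = - (1/2) *\<^sub>R f - c *\<^sub>R e"
    by (simp_all add: a' qmul.diff_left qmul.diff_right qmul.scaleR_left qmul.scaleR_right F flip: f_def)
  show "shape_defect k a e w1 (s *\<^sub>R e) ((1/2) *\<^sub>R n) n = 0"
  proof (rule inner_all_zeroD)
    fix z
    show "shape_defect k a e w1 (s *\<^sub>R e) ((1/2) *\<^sub>R n) n \<bullet> z = 0"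
      apply (simp only: shape_defect_def w1 na F f_def[symmetric] qmul.scaleR_left qmul.scaleR_right)
      apply (simp only: a' inner_add_left inner_diff_left inner_minus_left inner_scaleR_left)
      using s kc by algebra
  qed
  show "shape_defect k e a (s *\<^sub>R e) w1 n ((1/2) *\<^sub>R n) = 0"
  proof (rule inner_all_zeroD)
    fix z
    show "shape_defect k e a (s *\<^sub>R e) w1 n ((1/2) *\<^sub>R n) \<bullet> z = 0"
      apply (simp only: shape_defect_def w1 na F f_def[symmetric] qmul.scaleR_left qmul.scaleR_right)
      apply (simp only: a' inner_add_left inner_diff_left inner_minus_left inner_scaleR_left)
      using s kc by algebra
  qed
qed

text \<open>Now the fibre directions are (c, c) and the orthogonal lift of \<open>e\<close> is
  (-e/2, e/2); the eigenvector adds n e / (4k) in both factors. The vector \<open>w2\<close> comes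
  from N p / 2, the second component of the normal, and \<open>w1\<close> from the first component
  being -p q^{-1} times the second.\<close>

lemma shape_defect_diagonal:
  assumes n: "qim n" "norm n = 1" and e: "qim e" "n \<bullet> e = 0" and k: "k\<^sup>2 + s * k = 1/12"
    and a: "a = (1/2) *\<^sub>R ((1 / (2 * k)) *\<^sub>R qmul n e - e)"
    and b: "b = (1/2) *\<^sub>R ((1 / (2 * k)) *\<^sub>R qmul n e + e)"
    and w2: "w2 = (1/2) *\<^sub>R (s *\<^sub>R e + qmul n a)"
    and w1: "w1 = - ((1/2) *\<^sub>R qmul a n - (1/2) *\<^sub>R qmul b n + w2)"
  shows "shape_defect k a b w1 w2 (- (1/2) *\<^sub>R n) ((1/2) *\<^sub>R n) = 0"
    "shape_defect k b a w2 w1 ((1/2) *\<^sub>R n) (- (1/2) *\<^sub>R n) = 0"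
proof -
  define f where "f = qmul n e"
  note F = qframe[OF n e, folded f_def]
  define c where "c = 1 / (2 * k)"
  have "k \<noteq> 0" using k by auto
  then have kc: "2 * k * c = 1" by (simp add: c_def)
  have s: "s = c / 6 - k" using k \<open>k \<noteq> 0\<close> by (simp add: c_def field_simps power2_eq_square)
  have a': "a = (1/2) *\<^sub>R (c *\<^sub>R f - e)" by (simp add: a c_def f_def)
  have b': "b = (1/2) *\<^sub>R (c *\<^sub>R f + e)" by (simp add: b c_def f_def)
  have n': "qmul n a = - (1/2) *\<^sub>R (c *\<^sub>R e + f)" "qmul a n = (1/2) *\<^sub>R (c *\<^sub>R e + f)"
    "qmul n b = - (1/2) *\<^sub>R (c *\<^sub>R e - f)" "qmul b n = (1/2) *\<^sub>R (c *\<^sub>R e - f)"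
    by (simp_all add: a' b' qmul.diff_left qmul.diff_right qmul.add_left qmul.add_right qmul.scaleR_left
        qmul.scaleR_right F algebra_simps flip: f_def)
  show "shape_defect k a b w1 w2 (- (1/2) *\<^sub>R n) ((1/2) *\<^sub>R n) = 0"
  proof (rule inner_all_zeroD)
    fix z
    show "shape_defect k a b w1 w2 (- (1/2) *\<^sub>R n) ((1/2) *\<^sub>R n) \<bullet> z = 0"
      apply (simp only: shape_defect_def w1 w2 n' F f_def[symmetric] qmul.scaleR_left qmul.scaleR_right)
      apply (simp only: a' b' inner_add_left inner_diff_left inner_minus_left inner_scaleR_left)
      using s kc by algebra
  qed
  show "shape_defect k b a w2 w1 ((1/2) *\<^sub>R n) (- (1/2) *\<^sub>R n) = 0"
  proof (rule inner_all_zeroD)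
    fix z
    show "shape_defect k b a w2 w1 ((1/2) *\<^sub>R n) (- (1/2) *\<^sub>R n) \<bullet> z = 0"
      apply (simp only: shape_defect_def w1 w2 n' F f_def[symmetric] qmul.scaleR_left qmul.scaleR_right)
      apply (simp only: a' b' inner_add_left inner_diff_left inner_minus_left inner_scaleR_left)
      using s kc by algebra
  qed
qed

section \<open>The image surfaces of q, p and q p^{-1}\<close>

context normal_hypersurface
begin

lemma chart_tangent_liftE:
  assumes "is_chart M \<phi> V" "u \<in> V" "\<xi> (\<phi> u) = lift (\<phi> u) m1 m2"
  obtains a b where "frechet_derivative \<phi> (at u) v = lift (\<phi> u) a b" "qim a" "qim b"
    "4/3 * (m1 \<bullet> a + m2 \<bullet> b) - 2/3 * (m1 \<bullet> b + a \<bullet> m2) = 0"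
proof -
  note x = M_S3[OF chart_in[OF assms(1,2)]]
  have D: "frechet_derivative \<phi> (at u) v \<in> TS3S3 (\<phi> u)" "gnk (\<phi> u) (\<xi> (\<phi> u)) (frechet_derivative \<phi> (at u) v) = 0"
    using chart_tangent_space[OF assms(1,2)] by auto
  obtain a b where ab: "frechet_derivative \<phi> (at u) v = lift (\<phi> u) a b" "qim a" "qim b"
    using TS3S3_liftE[OF x D(1)] by metis
  then show ?thesis using that[OF ab] D(2) by (simp add: assms(3) gnk_lift[OF x])
qed

lemma chart_tangent_lift_ex:
  assumes "is_chart M \<phi> V" "u \<in> V" "\<xi> (\<phi> u) = lift (\<phi> u) m1 m2" "qim a" "qim b"
    "4/3 * (m1 \<bullet> a + m2 \<bullet> b) - 2/3 * (m1 \<bullet> b + a \<bullet> m2) = 0"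
  shows "\<exists>v. frechet_derivative \<phi> (at u) v = lift (\<phi> u) a b"
proof -
  note x = M_S3[OF chart_in[OF assms(1,2)]]
  have "lift (\<phi> u) a b \<in> tangent_space M (\<phi> u)"
    unfolding chart_tangent_space(2)[OF assms(1,2)]
    using assms by (simp add: TS3S3_lift[OF x] gnk_lift[OF x])
  then show ?thesis using chart_tangent_space(1)[OF assms(1,2)] by (metis imageE)
qed

text \<open>The conormal of this form is (0, n), so tangency of (p a, q b) restricts b alone, to the
  plane orthogonal to n. This makes \<open>snd\<close> a submersion onto a surface with normal q
  n.\<close>

lemma gauss_snd:
  assumes card: "\<And>x. x \<in> M \<Longrightarrow> card (principal_curvatures M \<xi> x) = 3"
    and form: "\<And>x. x \<in> M \<Longrightarrow> \<exists>n. qim n \<and> norm n = 1 \<and> \<xi> x = lift x ((1/2) *\<^sub>R n) n"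
  shows "gauss_hypersurface M \<xi> snd (\<lambda>x. snd (\<xi> x))"
proof unfold_locales
  fix \<phi> V assume c: "is_chart M \<phi> V"
  note V = chart_open[OF c]
  show "smooth_on V (\<lambda>u. snd (\<phi> u))"
    by (rule smooth_on_bounded_linear[OF bounded_linear_snd V chart_smooth[OF c]])
  show "smooth_on V (\<lambda>u. snd (\<xi> (\<phi> u)))"
    by (rule smooth_on_bounded_linear[OF bounded_linear_snd V chart_smooth_normal[OF c]])
  fix u assume u: "u \<in> V"
  let ?x = "\<phi> u"
  have xS: "fst ?x \<in> S3" "snd ?x \<in> S3" using M_S3[OF chart_in[OF c u]] by auto
  obtain n where n: "qim n" "norm n = 1" and \<xi>: "\<xi> ?x = lift ?x ((1/2) *\<^sub>R n) n"
    using form[OF chart_in[OF c u]] by blast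
  note D\<phi> = chart_derivative(1)[OF c u] and D\<xi> = chart_derivative(2)[OF c u]
  have dQ: "frechet_derivative (\<lambda>u. snd (\<phi> u)) (at u) = (\<lambda>v. snd (frechet_derivative \<phi> (at u) v))"
    using frechet_derivative_at[OF has_derivative_snd[OF D\<phi>]] by simp
  have dN: "frechet_derivative (\<lambda>u. snd (\<xi> (\<phi> u))) (at u) = (\<lambda>v. snd (frechet_derivative (\<lambda>u. \<xi> (\<phi> u)) (at u) v))"
    using frechet_derivative_at[OF has_derivative_snd[OF D\<xi>]] by simp
  show "snd (\<xi> ?x) \<bullet> frechet_derivative (\<lambda>u. snd (\<phi> u)) (at u) v = 0" for v
  proof -
    obtain a b where ab: "frechet_derivative \<phi> (at u) v = lift ?x a b" "qim a" "qim b"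
      "4/3 * (((1/2) *\<^sub>R n) \<bullet> a + n \<bullet> b) - 2/3 * (((1/2) *\<^sub>R n) \<bullet> b + a \<bullet> n) = 0"
      using chart_tangent_liftE[OF c u \<xi>, of v] by metis
    then have "n \<bullet> b = 0" by (simp add: inner_commute[of a n] inner_commute[of b n])
    then show ?thesis using xS by (simp add: dQ ab(1) \<xi>)
  qed
  have pre: "\<exists>e. E = qmul (snd ?x) e \<and> qim e \<and> n \<bullet> e = 0"
    if "snd ?x \<bullet> E = 0" "snd (\<xi> ?x) \<bullet> E = 0" for E
  proof -
    define e where "e = qmul (qconj (snd ?x)) E"
    have E: "E = qmul (snd ?x) e" using xS by (simp add: e_def)
    have "qim e" "n \<bullet> e = 0" using that xS by (simp_all add: E \<xi> S3_inner_self_qmul)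
    then show ?thesis using E by blast
  qed
  show "\<exists>v. frechet_derivative (\<lambda>u. snd (\<phi> u)) (at u) v = E"
    if E: "snd ?x \<bullet> E = 0" "snd (\<xi> ?x) \<bullet> E = 0" for E
  proof -
    obtain e where e: "E = qmul (snd ?x) e" "qim e" "n \<bullet> e = 0" using pre[OF E] by blast
    have "\<exists>v. frechet_derivative \<phi> (at u) v = lift ?x 0 e"
      by (rule chart_tangent_lift_ex[OF c u \<xi>]) (use e in \<open>simp_all add: inner_commute[of e n]\<close>)
    then obtain v where "frechet_derivative \<phi> (at u) v = lift ?x 0 e" by blast
    then show ?thesis using e by (intro exI[of _ v]) (simp add: dQ)
  qed
  show "k \<in> principal_curvatures M \<xi> ?x"
    if E0: "E \<noteq> 0" and E: "snd ?x \<bullet> E = 0" "snd (\<xi> ?x) \<bullet> E = 0"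
      and H: "\<And>v. frechet_derivative (\<lambda>u. snd (\<phi> u)) (at u) v = E \<Longrightarrow>
              frechet_derivative (\<lambda>u. snd (\<xi> (\<phi> u))) (at u) v = s *\<^sub>R E"
      and k: "k\<^sup>2 + s * k = 1/12" for E s k
  proof -
    obtain e where e: "E = qmul (snd ?x) e" "qim e" "n \<bullet> e = 0" using pre[OF E] by blast
    have "e \<noteq> 0" using E0 e by (auto simp: qmul.zero_right)
    note F = qframe[OF n e(2,3)]
    define a where "a = (1/2) *\<^sub>R e - (1 / (4 * k)) *\<^sub>R qmul n e"
    define w where "w = (1/2) *\<^sub>R (qmul a n - qmul e n + s *\<^sub>R e)"
    have a: "qim a" "n \<bullet> a = 0" using e F by (simp_all add: a_def inner_diff_right)
    have "\<exists>v. frechet_derivative \<phi> (at u) v = lift ?x a e"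
      by (rule chart_tangent_lift_ex[OF c u \<xi>]) (use a e in \<open>simp_all add: inner_commute[of e n] inner_commute[of a n]\<close>)
    then obtain v where v: "frechet_derivative \<phi> (at u) v = lift ?x a e" by blast
    have N: "snd (frechet_derivative (\<lambda>u. \<xi> (\<phi> u)) (at u) v) = qmul (snd ?x) (s *\<^sub>R e)"
      using H[of v] by (simp add: dQ dN v e qmul.scaleR_right)
    \<comment> \<open>As n need not be smooth, the first component of the normal is recovered from
      the second as p q^{-1} \<open>snd\<close> / 2 before it is differentiated.\<close>
    let ?g = "\<lambda>y. (1/2) *\<^sub>R qmul (fst (\<phi> y)) (qmul (qconj (snd (\<phi> y))) (snd (\<xi> (\<phi> y))))"
    have g: "(?g has_derivative (\<lambda>v. (1/2) *\<^sub>R (qmul (fst ?x)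
          (qmul (qconj (snd ?x)) (snd (frechet_derivative (\<lambda>u. \<xi> (\<phi> u)) (at u) v))
            + qmul (qconj (snd (frechet_derivative \<phi> (at u) v))) (snd (\<xi> ?x)))
          + qmul (fst (frechet_derivative \<phi> (at u) v)) (qmul (qconj (snd ?x)) (snd (\<xi> ?x)))))) (at u)"
      by (intro has_derivative_scaleR_right qmul.FDERIV bounded_linear.has_derivative[OF bounded_linear_qconj]
          has_derivative_fst has_derivative_snd D\<phi> D\<xi>)
    have "?g y = fst (\<xi> (\<phi> y))" if "y \<in> V" for y
    proof -
      have "fst (\<phi> y) \<in> S3" "snd (\<phi> y) \<in> S3" using M_S3[OF chart_in[OF c that]] by auto
      then show ?thesis using form[OF chart_in[OF c that]] by (auto simp: qmul.scaleR_right)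
    qed
    from has_derivative_transform_within_open[OF g V u this]
    have "(\<lambda>v. fst (frechet_derivative (\<lambda>u. \<xi> (\<phi> u)) (at u) v)) = (\<lambda>v. (1/2) *\<^sub>R (qmul (fst ?x)
          (qmul (qconj (snd ?x)) (snd (frechet_derivative (\<lambda>u. \<xi> (\<phi> u)) (at u) v))
            + qmul (qconj (snd (frechet_derivative \<phi> (at u) v))) (snd (\<xi> ?x)))
          + qmul (fst (frechet_derivative \<phi> (at u) v)) (qmul (qconj (snd ?x)) (snd (\<xi> ?x)))))"
      using has_derivative_unique[OF has_derivative_fst[OF D\<xi>]] by blast
    from fun_cong[OF this, of v]
    have "fst (frechet_derivative (\<lambda>u. \<xi> (\<phi> u)) (at u) v) = (1/2) *\<^sub>R (qmul (fst ?x)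
          (s *\<^sub>R e + qmul (qconj e) n) + qmul (qmul (fst ?x) a) n)"
      using xS unfolding N v \<xi> by (simp add: qconj_qmul qmul_assoc)
    also have "\<dots> = qmul (fst ?x) w"
      by (simp add: w_def qconj_qim[OF e(2)] qmul_assoc qmul.add_right qmul.diff_right qmul.scaleR_right
          qmul.minus_left qmul.minus_right algebra_simps)
    finally have W: "frechet_derivative (\<lambda>u. \<xi> (\<phi> u)) (at u) v = lift ?x w (s *\<^sub>R e)"
      using N by (simp add: prod_eq_iff del: Product_Type.prod.inject)
    show ?thesis
      by (rule principal_curvatureI[OF c u v _ _ _ W \<xi>])
        (use a e \<open>e \<noteq> 0\<close> shape_defect_product[OF n e(2,3) k a_def w_def] in auto)
  qed
next
  fix x assume x: "x \<in> M"
  have xS: "fst x \<in> S3" "snd x \<in> S3" using M_S3[OF x] by auto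
  obtain n where n: "qim n" "norm n = 1" and \<xi>: "\<xi> x = lift x ((1/2) *\<^sub>R n) n"
    using form[OF x] by blast
  show "norm (snd x) = 1" "norm (snd (\<xi> x)) = 1" using xS n by (simp_all add: \<xi> norm_qmul S3_norm)
  show "snd x \<bullet> snd (\<xi> x) = 0" using xS n by (simp add: \<xi> S3_inner_self_qmul)
  show "card (principal_curvatures M \<xi> x) = 3" by (rule card[OF x])
qed

text \<open>The case of \<open>gauss_snd\<close> with the two factors exchanged; the two identities
  of \<open>shape_defect_product\<close> trade places.\<close>

lemma gauss_fst:
  assumes card: "\<And>x. x \<in> M \<Longrightarrow> card (principal_curvatures M \<xi> x) = 3"
    and form: "\<And>x. x \<in> M \<Longrightarrow> \<exists>n. qim n \<and> norm n = 1 \<and> \<xi> x = lift x n ((1/2) *\<^sub>R n)"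
  shows "gauss_hypersurface M \<xi> fst (\<lambda>x. fst (\<xi> x))"
proof unfold_locales
  fix \<phi> V assume c: "is_chart M \<phi> V"
  note V = chart_open[OF c]
  show "smooth_on V (\<lambda>u. fst (\<phi> u))"
    by (rule smooth_on_bounded_linear[OF bounded_linear_fst V chart_smooth[OF c]])
  show "smooth_on V (\<lambda>u. fst (\<xi> (\<phi> u)))"
    by (rule smooth_on_bounded_linear[OF bounded_linear_fst V chart_smooth_normal[OF c]])
  fix u assume u: "u \<in> V"
  let ?x = "\<phi> u"
  have xS: "fst ?x \<in> S3" "snd ?x \<in> S3" using M_S3[OF chart_in[OF c u]] by auto
  obtain n where n: "qim n" "norm n = 1" and \<xi>: "\<xi> ?x = lift ?x n ((1/2) *\<^sub>R n)"
    using form[OF chart_in[OF c u]] by blast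
  note D\<phi> = chart_derivative(1)[OF c u] and D\<xi> = chart_derivative(2)[OF c u]
  have dQ: "frechet_derivative (\<lambda>u. fst (\<phi> u)) (at u) = (\<lambda>v. fst (frechet_derivative \<phi> (at u) v))"
    using frechet_derivative_at[OF has_derivative_fst[OF D\<phi>]] by simp
  have dN: "frechet_derivative (\<lambda>u. fst (\<xi> (\<phi> u))) (at u) = (\<lambda>v. fst (frechet_derivative (\<lambda>u. \<xi> (\<phi> u)) (at u) v))"
    using frechet_derivative_at[OF has_derivative_fst[OF D\<xi>]] by simp
  show "fst (\<xi> ?x) \<bullet> frechet_derivative (\<lambda>u. fst (\<phi> u)) (at u) v = 0" for v
  proof -
    obtain a b where ab: "frechet_derivative \<phi> (at u) v = lift ?x b a" "qim a" "qim b"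
      "4/3 * (n \<bullet> b + ((1/2) *\<^sub>R n) \<bullet> a) - 2/3 * (n \<bullet> a + b \<bullet> ((1/2) *\<^sub>R n)) = 0"
      using chart_tangent_liftE[OF c u \<xi>, of v] by metis
    then have "n \<bullet> b = 0" by (simp add: inner_commute[of a n] inner_commute[of b n])
    then show ?thesis using xS by (simp add: dQ ab(1) \<xi>)
  qed
  have pre: "\<exists>e. E = qmul (fst ?x) e \<and> qim e \<and> n \<bullet> e = 0"
    if "fst ?x \<bullet> E = 0" "fst (\<xi> ?x) \<bullet> E = 0" for E
  proof -
    define e where "e = qmul (qconj (fst ?x)) E"
    have E: "E = qmul (fst ?x) e" using xS by (simp add: e_def)
    have "qim e" "n \<bullet> e = 0" using that xS by (simp_all add: E \<xi> S3_inner_self_qmul)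
    then show ?thesis using E by blast
  qed
  show "\<exists>v. frechet_derivative (\<lambda>u. fst (\<phi> u)) (at u) v = E"
    if E: "fst ?x \<bullet> E = 0" "fst (\<xi> ?x) \<bullet> E = 0" for E
  proof -
    obtain e where e: "E = qmul (fst ?x) e" "qim e" "n \<bullet> e = 0" using pre[OF E] by blast
    have "\<exists>v. frechet_derivative \<phi> (at u) v = lift ?x e 0"
      by (rule chart_tangent_lift_ex[OF c u \<xi>]) (use e in \<open>simp_all add: inner_commute[of e n]\<close>)
    then obtain v where "frechet_derivative \<phi> (at u) v = lift ?x e 0" by blast
    then show ?thesis using e by (intro exI[of _ v]) (simp add: dQ)
  qed
  show "k \<in> principal_curvatures M \<xi> ?x"
    if E0: "E \<noteq> 0" and E: "fst ?x \<bullet> E = 0" "fst (\<xi> ?x) \<bullet> E = 0"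
      and H: "\<And>v. frechet_derivative (\<lambda>u. fst (\<phi> u)) (at u) v = E \<Longrightarrow>
              frechet_derivative (\<lambda>u. fst (\<xi> (\<phi> u))) (at u) v = s *\<^sub>R E"
      and k: "k\<^sup>2 + s * k = 1/12" for E s k
  proof -
    obtain e where e: "E = qmul (fst ?x) e" "qim e" "n \<bullet> e = 0" using pre[OF E] by blast
    have "e \<noteq> 0" using E0 e by (auto simp: qmul.zero_right)
    note F = qframe[OF n e(2,3)]
    define a where "a = (1/2) *\<^sub>R e - (1 / (4 * k)) *\<^sub>R qmul n e"
    define w where "w = (1/2) *\<^sub>R (qmul a n - qmul e n + s *\<^sub>R e)"
    have a: "qim a" "n \<bullet> a = 0" using e F by (simp_all add: a_def inner_diff_right)
    have "\<exists>v. frechet_derivative \<phi> (at u) v = lift ?x e a"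
      by (rule chart_tangent_lift_ex[OF c u \<xi>]) (use a e in \<open>simp_all add: inner_commute[of e n] inner_commute[of a n]\<close>)
    then obtain v where v: "frechet_derivative \<phi> (at u) v = lift ?x e a" by blast
    have N: "fst (frechet_derivative (\<lambda>u. \<xi> (\<phi> u)) (at u) v) = qmul (fst ?x) (s *\<^sub>R e)"
      using H[of v] by (simp add: dQ dN v e qmul.scaleR_right)
    let ?g = "\<lambda>y. (1/2) *\<^sub>R qmul (snd (\<phi> y)) (qmul (qconj (fst (\<phi> y))) (fst (\<xi> (\<phi> y))))"
    have g: "(?g has_derivative (\<lambda>v. (1/2) *\<^sub>R (qmul (snd ?x)
          (qmul (qconj (fst ?x)) (fst (frechet_derivative (\<lambda>u. \<xi> (\<phi> u)) (at u) v))
            + qmul (qconj (fst (frechet_derivative \<phi> (at u) v))) (fst (\<xi> ?x)))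
          + qmul (snd (frechet_derivative \<phi> (at u) v)) (qmul (qconj (fst ?x)) (fst (\<xi> ?x)))))) (at u)"
      by (intro has_derivative_scaleR_right qmul.FDERIV bounded_linear.has_derivative[OF bounded_linear_qconj]
          has_derivative_fst has_derivative_snd D\<phi> D\<xi>)
    have "?g y = snd (\<xi> (\<phi> y))" if "y \<in> V" for y
    proof -
      have "fst (\<phi> y) \<in> S3" "snd (\<phi> y) \<in> S3" using M_S3[OF chart_in[OF c that]] by auto
      then show ?thesis using form[OF chart_in[OF c that]] by (auto simp: qmul.scaleR_right)
    qed
    from has_derivative_transform_within_open[OF g V u this]
    have "(\<lambda>v. snd (frechet_derivative (\<lambda>u. \<xi> (\<phi> u)) (at u) v)) = (\<lambda>v. (1/2) *\<^sub>R (qmul (snd ?x)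
          (qmul (qconj (fst ?x)) (fst (frechet_derivative (\<lambda>u. \<xi> (\<phi> u)) (at u) v))
            + qmul (qconj (fst (frechet_derivative \<phi> (at u) v))) (fst (\<xi> ?x)))
          + qmul (snd (frechet_derivative \<phi> (at u) v)) (qmul (qconj (fst ?x)) (fst (\<xi> ?x)))))"
      using has_derivative_unique[OF has_derivative_snd[OF D\<xi>]] by blast
    from fun_cong[OF this, of v]
    have "snd (frechet_derivative (\<lambda>u. \<xi> (\<phi> u)) (at u) v) = (1/2) *\<^sub>R (qmul (snd ?x)
          (s *\<^sub>R e + qmul (qconj e) n) + qmul (qmul (snd ?x) a) n)"
      using xS unfolding N v \<xi> by (simp add: qconj_qmul qmul_assoc)
    also have "\<dots> = qmul (snd ?x) w"
      by (simp add: w_def qconj_qim[OF e(2)] qmul_assoc qmul.add_right qmul.diff_right qmul.scaleR_right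
          qmul.minus_left qmul.minus_right algebra_simps)
    finally have W: "frechet_derivative (\<lambda>u. \<xi> (\<phi> u)) (at u) v = lift ?x (s *\<^sub>R e) w"
      using N by (simp add: prod_eq_iff del: Product_Type.prod.inject)
    show ?thesis
      by (rule principal_curvatureI[OF c u v _ _ _ W \<xi>])
        (use a e \<open>e \<noteq> 0\<close> shape_defect_product[OF n e(2,3) k a_def w_def] in auto)
  qed
next
  fix x assume x: "x \<in> M"
  have xS: "fst x \<in> S3" "snd x \<in> S3" using M_S3[OF x] by auto
  obtain n where n: "qim n" "norm n = 1" and \<xi>: "\<xi> x = lift x n ((1/2) *\<^sub>R n)"
    using form[OF x] by blast
  show "norm (fst x) = 1" "norm (fst (\<xi> x)) = 1" using xS n by (simp_all add: \<xi> norm_qmul S3_norm)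
  show "fst x \<bullet> fst (\<xi> x) = 0" using xS n by (simp add: \<xi> S3_inner_self_qmul)
  show "card (principal_curvatures M \<xi> x) = 3" by (rule card[OF x])
qed

text \<open>The derivative of q p^{-1} on (p a, q b) is q (b - a) p^{-1}, and the conormal is (-n,
  n), so tangency means that b - a is orthogonal to n. The factor 2 makes the surface normal q n
  p^{-1} a unit vector, since the second component of the normal of \<open>M\<close> has length
  1/2.\<close>

lemma gauss_quotient:
  assumes card: "\<And>x. x \<in> M \<Longrightarrow> card (principal_curvatures M \<xi> x) = 3"
    and form: "\<And>x. x \<in> M \<Longrightarrow> \<exists>n. qim n \<and> norm n = 1 \<and> \<xi> x = lift x (- (1/2) *\<^sub>R n) ((1/2) *\<^sub>R n)"
  shows "gauss_hypersurface M \<xi> (\<lambda>x. qmul (snd x) (qconj (fst x))) (\<lambda>x. 2 *\<^sub>R qmul (snd (\<xi> x)) (qconj (fst x)))"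
    (is "gauss_hypersurface M \<xi> ?Q ?N")
proof unfold_locales
  fix \<phi> V assume c: "is_chart M \<phi> V"
  note V = chart_open[OF c]
  have conj_smooth: "smooth_on V (\<lambda>u. qconj (fst (\<phi> u)))"
    by (intro smooth_on_bounded_linear[OF bounded_linear_qconj V] smooth_on_bounded_linear[OF bounded_linear_fst V]
        chart_smooth[OF c])
  show "smooth_on V (\<lambda>u. ?Q (\<phi> u))"
    by (intro smooth_on_bilinear[OF bounded_bilinear_qmul V] conj_smooth
        smooth_on_bounded_linear[OF bounded_linear_snd V chart_smooth[OF c]])
  show "smooth_on V (\<lambda>u. ?N (\<phi> u))"
    by (intro smooth_on_bounded_linear[OF bounded_linear_scaleR_right V] smooth_on_bilinear[OF bounded_bilinear_qmul V]
        conj_smooth smooth_on_bounded_linear[OF bounded_linear_snd V chart_smooth_normal[OF c]])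
  fix u assume u: "u \<in> V"
  let ?x = "\<phi> u"
  have xS: "fst ?x \<in> S3" "snd ?x \<in> S3" using M_S3[OF chart_in[OF c u]] by auto
  obtain n where n: "qim n" "norm n = 1" and \<xi>: "\<xi> ?x = lift ?x (- (1/2) *\<^sub>R n) ((1/2) *\<^sub>R n)"
    using form[OF chart_in[OF c u]] by blast
  have N: "?N ?x = qmul (qmul (snd ?x) n) (qconj (fst ?x))"
    by (simp add: \<xi> qmul.scaleR_left qmul.scaleR_right)
  note D\<phi> = chart_derivative(1)[OF c u] and D\<xi> = chart_derivative(2)[OF c u]
  have "((\<lambda>u. ?Q (\<phi> u)) has_derivative (\<lambda>v. qmul (snd ?x) (qconj (fst (frechet_derivative \<phi> (at u) v)))
      + qmul (snd (frechet_derivative \<phi> (at u) v)) (qconj (fst ?x)))) (at u)"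
    by (intro qmul.FDERIV bounded_linear.has_derivative[OF bounded_linear_qconj]
        has_derivative_fst has_derivative_snd D\<phi>)
  from frechet_derivative_at[OF this, symmetric]
  have dQ: "frechet_derivative (\<lambda>u. ?Q (\<phi> u)) (at u) v = qmul (qmul (snd ?x) (b - a)) (qconj (fst ?x))"
    if "frechet_derivative \<phi> (at u) v = lift ?x a b" "qim a" for v a b
    using that by (simp add: qconj_qmul qconj_qim qmul_assoc qmul.diff_left qmul.diff_right
        qmul.minus_left qmul.minus_right)
  show "?N ?x \<bullet> frechet_derivative (\<lambda>u. ?Q (\<phi> u)) (at u) v = 0" for v
  proof -
    obtain a b where ab: "frechet_derivative \<phi> (at u) v = lift ?x a b" "qim a" "qim b"
      "4/3 * ((- (1/2) *\<^sub>R n) \<bullet> a + ((1/2) *\<^sub>R n) \<bullet> b) - 2/3 * ((- (1/2) *\<^sub>R n) \<bullet> b + a \<bullet> ((1/2) *\<^sub>R n)) = 0"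
      using chart_tangent_liftE[OF c u \<xi>, of v] by metis
    then have "n \<bullet> (b - a) = 0" by (simp add: inner_commute[of a n] inner_diff_right)
    then show ?thesis using xS by (simp add: dQ[OF ab(1,2)] N del: inner_diff_right)
  qed
  have pre: "\<exists>e. E = qmul (qmul (snd ?x) e) (qconj (fst ?x)) \<and> qim e \<and> n \<bullet> e = 0"
    if "?Q ?x \<bullet> E = 0" "?N ?x \<bullet> E = 0" for E
  proof -
    define e where "e = qmul (qconj (snd ?x)) (qmul E (fst ?x))"
    have E: "E = qmul (qmul (snd ?x) e) (qconj (fst ?x))" using xS by (simp add: e_def)
    have "qim e" "n \<bullet> e = 0" using that xS unfolding N E by (simp_all add: S3_inner_self_qmul)
    then show ?thesis using E by blast
  qed
  show "\<exists>v. frechet_derivative (\<lambda>u. ?Q (\<phi> u)) (at u) v = E"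
    if E: "?Q ?x \<bullet> E = 0" "?N ?x \<bullet> E = 0" for E
  proof -
    obtain e where e: "E = qmul (qmul (snd ?x) e) (qconj (fst ?x))" "qim e" "n \<bullet> e = 0" using pre[OF E] by blast
    have "\<exists>v. frechet_derivative \<phi> (at u) v = lift ?x 0 e"
      by (rule chart_tangent_lift_ex[OF c u \<xi>]) (use e in \<open>simp_all add: inner_commute[of e n]\<close>)
    then show ?thesis using dQ[of _ 0 e] e by auto
  qed
  show "k \<in> principal_curvatures M \<xi> ?x"
    if E0: "E \<noteq> 0" and E: "?Q ?x \<bullet> E = 0" "?N ?x \<bullet> E = 0"
      and H: "\<And>v. frechet_derivative (\<lambda>u. ?Q (\<phi> u)) (at u) v = E \<Longrightarrow>
              frechet_derivative (\<lambda>u. ?N (\<phi> u)) (at u) v = s *\<^sub>R E"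
      and k: "k\<^sup>2 + s * k = 1/12" for E s k
  proof -
    obtain e where e: "E = qmul (qmul (snd ?x) e) (qconj (fst ?x))" "qim e" "n \<bullet> e = 0" using pre[OF E] by blast
    have "e \<noteq> 0" using E0 e by (auto simp: qmul.zero_right qmul.zero_left)
    note F = qframe[OF n e(2,3)]
    define a where "a = (1/2) *\<^sub>R ((1 / (2 * k)) *\<^sub>R qmul n e - e)"
    define b where "b = (1/2) *\<^sub>R ((1 / (2 * k)) *\<^sub>R qmul n e + e)"
    define w2 where "w2 = (1/2) *\<^sub>R (s *\<^sub>R e + qmul n a)"
    define w1 where "w1 = - ((1/2) *\<^sub>R qmul a n - (1/2) *\<^sub>R qmul b n + w2)"
    have ab: "qim a" "qim b" "n \<bullet> a = 0" "n \<bullet> b = 0"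
      using e F by (simp_all add: a_def b_def inner_diff_right inner_add_right)
    have ba: "b - a = e" unfolding a_def b_def
      by (simp add: algebra_simps flip: scaleR_2 scaleR_add_left)
    have "\<exists>v. frechet_derivative \<phi> (at u) v = lift ?x a b"
      by (rule chart_tangent_lift_ex[OF c u \<xi>]) (use ab in \<open>simp_all add: inner_commute[of a n]\<close>)
    then obtain v where v: "frechet_derivative \<phi> (at u) v = lift ?x a b" by blast
    let ?D\<xi> = "frechet_derivative (\<lambda>u. \<xi> (\<phi> u)) (at u)"
    have dNv: "frechet_derivative (\<lambda>u. ?N (\<phi> u)) (at u) v = s *\<^sub>R E"
      using H[of v] dQ[OF v ab(1)] by (simp add: ba e)
    have "((\<lambda>u. ?N (\<phi> u)) has_derivative (\<lambda>v. 2 *\<^sub>R (qmul (snd (\<xi> ?x)) (qconj (fst (frechet_derivative \<phi> (at u) v)))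
        + qmul (snd (?D\<xi> v)) (qconj (fst ?x))))) (at u)"
      by (intro has_derivative_scaleR_right qmul.FDERIV bounded_linear.has_derivative[OF bounded_linear_qconj]
          has_derivative_fst has_derivative_snd D\<phi> D\<xi>)
    from fun_cong[OF frechet_derivative_at[OF this], of v]
    have "2 *\<^sub>R (qmul (snd (\<xi> ?x)) (qconj (qmul (fst ?x) a)) + qmul (snd (?D\<xi> v)) (qconj (fst ?x)))
        = s *\<^sub>R E" using dNv v by simp
    then have "qmul (2 *\<^sub>R (qmul (snd (\<xi> ?x)) (qconj (qmul (fst ?x) a)) + qmul (snd (?D\<xi> v)) (qconj (fst ?x)))) (fst ?x)
        = qmul (s *\<^sub>R E) (fst ?x)" by simp
    then have D2: "2 *\<^sub>R snd (?D\<xi> v) = qmul (snd ?x) (s *\<^sub>R e + qmul n a)"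
      using xS by (simp add: e(1) \<xi> qconj_qmul qconj_qim[OF ab(1)] qmul_assoc qmul.add_left qmul.diff_left qmul.add_right qmul.scaleR_left
          qmul.scaleR_right qmul.minus_left qmul.minus_right algebra_simps)
    have "snd (?D\<xi> v) = (1/2) *\<^sub>R (2 *\<^sub>R snd (?D\<xi> v))" by simp
    also have "\<dots> = qmul (snd ?x) w2" unfolding D2 w2_def by (simp add: qmul.scaleR_right)
    finally have W2: "snd (?D\<xi> v) = qmul (snd ?x) w2" .
    let ?g = "\<lambda>y. - qmul (fst (\<phi> y)) (qmul (qconj (snd (\<phi> y))) (snd (\<xi> (\<phi> y))))"
    have g: "(?g has_derivative (\<lambda>v. - (qmul (fst ?x)
          (qmul (qconj (snd ?x)) (snd (?D\<xi> v))
            + qmul (qconj (snd (frechet_derivative \<phi> (at u) v))) (snd (\<xi> ?x)))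
          + qmul (fst (frechet_derivative \<phi> (at u) v)) (qmul (qconj (snd ?x)) (snd (\<xi> ?x)))))) (at u)"
      by (intro has_derivative_minus qmul.FDERIV bounded_linear.has_derivative[OF bounded_linear_qconj]
          has_derivative_fst has_derivative_snd D\<phi> D\<xi>)
    have "?g y = fst (\<xi> (\<phi> y))" if y: "y \<in> V" for y
    proof -
      have "fst (\<phi> y) \<in> S3" "snd (\<phi> y) \<in> S3" using M_S3[OF chart_in[OF c y]] by auto
      moreover obtain n' where "\<xi> (\<phi> y) = lift (\<phi> y) (- (1/2) *\<^sub>R n') ((1/2) *\<^sub>R n')"
        using form[OF chart_in[OF c y]] by blast
      ultimately show ?thesis by (simp only: fst_conv snd_conv S3_cancel qmul.scaleR_right scaleR_minus_left qmul.minus_right)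
    qed
    from has_derivative_transform_within_open[OF g V u this]
    have "(\<lambda>v. fst (?D\<xi> v)) = (\<lambda>v. - (qmul (fst ?x)
          (qmul (qconj (snd ?x)) (snd (?D\<xi> v))
            + qmul (qconj (snd (frechet_derivative \<phi> (at u) v))) (snd (\<xi> ?x)))
          + qmul (fst (frechet_derivative \<phi> (at u) v)) (qmul (qconj (snd ?x)) (snd (\<xi> ?x)))))"
      using has_derivative_unique[OF has_derivative_fst[OF D\<xi>]] by blast
    from fun_cong[OF this, of v]
    have "fst (?D\<xi> v) = - (qmul (fst ?x) (w2 + qmul (qconj b) ((1/2) *\<^sub>R n)) + qmul (qmul (fst ?x) a) ((1/2) *\<^sub>R n))"
      using xS unfolding W2 v \<xi> by (simp add: qconj_qmul qmul_assoc)
    also have "\<dots> = qmul (fst ?x) w1"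
      by (simp add: w1_def qconj_qim[OF ab(2)] qmul_assoc qmul.add_right qmul.diff_right qmul.scaleR_right
          qmul.minus_left qmul.minus_right algebra_simps)
    finally have W: "?D\<xi> v = lift ?x w1 w2"
      using W2 by (simp add: prod_eq_iff del: Product_Type.prod.inject)
    have "a \<noteq> 0 \<or> b \<noteq> 0" using ba \<open>e \<noteq> 0\<close> by auto
    then show ?thesis
      using shape_defect_diagonal[OF n e(2,3) k a_def b_def w2_def w1_def]
      by (intro principal_curvatureI[OF c u v ab(1,2) _ W \<xi>]) auto
  qed
next
  fix x assume x: "x \<in> M"
  have xS: "fst x \<in> S3" "snd x \<in> S3" using M_S3[OF x] by auto
  obtain n where n: "qim n" "norm n = 1" and \<xi>: "\<xi> x = lift x (- (1/2) *\<^sub>R n) ((1/2) *\<^sub>R n)"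
    using form[OF x] by blast
  have N: "?N x = qmul (qmul (snd x) n) (qconj (fst x))"
    by (simp add: \<xi> qmul.scaleR_left qmul.scaleR_right)
  show "norm (?Q x) = 1" using xS by (simp add: norm_qmul S3_norm)
  show "norm (?N x) = 1" unfolding N using xS n by (simp add: norm_qmul S3_norm)
  show "?Q x \<bullet> ?N x = 0" unfolding N using xS n by (simp add: S3_inner_self_qmul)
  show "card (principal_curvatures M \<xi> x) = 3" by (rule card[OF x])
qed

end

lemma (in P_hypersurface) normal_cases_global:
  assumes conn: "connected M"
  shows "(\<forall>x\<in>M. \<exists>n. qim n \<and> norm n = 1 \<and> \<xi> x = lift x ((1/2) *\<^sub>R n) n)
    \<or> (\<forall>x\<in>M. \<exists>n. qim n \<and> norm n = 1 \<and> \<xi> x = lift x n ((1/2) *\<^sub>R n))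
    \<or> (\<forall>x\<in>M. \<exists>n. qim n \<and> norm n = 1 \<and> \<xi> x = lift x (- (1/2) *\<^sub>R n) ((1/2) *\<^sub>R n))"
proof -
  txt \<open>A continuous function that takes three distinct values in the three cases.\<close>
  define \<psi> where "\<psi> x = norm (fst (\<xi> x)) + 3 * norm (snd (\<xi> x))" for x
  have cases: "(\<psi> x = 7/2 \<and> (\<exists>n. qim n \<and> norm n = 1 \<and> \<xi> x = lift x ((1/2) *\<^sub>R n) n))
    \<or> (\<psi> x = 5/2 \<and> (\<exists>n. qim n \<and> norm n = 1 \<and> \<xi> x = lift x n ((1/2) *\<^sub>R n)))
    \<or> (\<psi> x = 2 \<and> (\<exists>n. qim n \<and> norm n = 1 \<and> \<xi> x = lift x (- (1/2) *\<^sub>R n) ((1/2) *\<^sub>R n)))" if x: "x \<in> M" for x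
  proof -
    have xS: "norm (fst x) = 1" "norm (snd x) = 1" using M_S3[OF x] by (auto simp: S3_def)
    obtain n where n: "qim n" "norm n = 1" and
      "\<xi> x = lift x ((1/2) *\<^sub>R n) n \<or> \<xi> x = lift x n ((1/2) *\<^sub>R n) \<or> \<xi> x = lift x (- (1/2) *\<^sub>R n) ((1/2) *\<^sub>R n)"
      using normal_cases[OF x] by metis
    then consider "\<xi> x = lift x ((1/2) *\<^sub>R n) n" | "\<xi> x = lift x n ((1/2) *\<^sub>R n)" | "\<xi> x = lift x (- (1/2) *\<^sub>R n) ((1/2) *\<^sub>R n)"
      by blast
    then show ?thesis
    proof cases
      case 1
      then have "\<psi> x = 7/2" using xS n by (simp add: \<psi>_def norm_qmul)
      then show ?thesis using 1 n by blast
    next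
      case 2
      then have "\<psi> x = 5/2" using xS n by (simp add: \<psi>_def norm_qmul)
      then show ?thesis using 2 n by blast
    next
      case 3
      then have "\<psi> x = 2" unfolding \<psi>_def using xS n by (simp only: 3 fst_conv snd_conv norm_qmul norm_scaleR)
      then show ?thesis using 3 n by blast
    qed
  qed
  have "continuous_on M \<psi>" unfolding \<psi>_def by (intro continuous_intros continuous_on_normal)
  moreover have "\<psi> ` M \<subseteq> {7/2, 5/2, 2}" using cases by blast
  then have "finite (\<psi> ` M)" by (rule finite_subset) simp
  ultimately have "\<psi> constant_on M" using conn continuous_finite_range_constant by blast
  then obtain c where c: "\<forall>x\<in>M. \<psi> x = c" by (auto simp: constant_on_def)
  show ?thesis
  proof (cases "M = {}")
    case False
    then obtain x0 where "x0 \<in> M" by blast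
    then have "c = 7/2 \<or> c = 5/2 \<or> c = 2" using cases[of x0] c by auto
    then show ?thesis
    proof (elim disjE)
      assume "c = 7/2"
      then have "\<psi> x \<noteq> 5/2" "\<psi> x \<noteq> 2" if "x \<in> M" for x using c that by auto
      then show ?thesis using cases by blast
    next
      assume "c = 5/2"
      then have "\<psi> x \<noteq> 7/2" "\<psi> x \<noteq> 2" if "x \<in> M" for x using c that by auto
      then show ?thesis using cases by blast
    next
      assume "c = 2"
      then have "\<psi> x \<noteq> 7/2" "\<psi> x \<noteq> 5/2" if "x \<in> M" for x using c that by auto
      then show ?thesis using cases by blast
    qed
  qed simp
qed

section \<open>The model hypersurfaces\<close>

text \<open>For unit q with real part h = sqrt(1 - r^2), |q - h|^2 = 1 - h^2 = r^2, so y = (q - h) /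
  r lies in \<open>S2\<close>.\<close>

lemma f_r_image:
  assumes r: "0 < r" "r \<le> 1"
  shows "f_r r ` (S3 \<times> S2) = {x. fst x \<in> S3 \<and> snd x \<in> S3 \<and> Re (fst (snd x)) = sqrt (1 - r\<^sup>2)}"
proof -
  define h where "h = sqrt (1 - r\<^sup>2)"
  have h2: "h\<^sup>2 = 1 - r\<^sup>2" using r by (simp add: h_def power_le_one)
  have h: "qreal h = h *\<^sub>R qone" by (simp add: qreal_def scaleR_conv_of_real)
  have unit: "h *\<^sub>R qone + r *\<^sub>R y \<in> S3" if "y \<in> S2" for y
  proof -
    have "(norm (h *\<^sub>R qone + r *\<^sub>R y))\<^sup>2 = h\<^sup>2 * (qone \<bullet> qone) + 2 * h * r * (qone \<bullet> y) + r\<^sup>2 * (y \<bullet> y)"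
      unfolding power2_norm_eq_inner inner_add_left inner_add_right inner_scaleR_left inner_scaleR_right
        inner_commute[of y qone] by (simp add: algebra_simps power2_eq_square)
    also have "\<dots> = 1" unfolding inner_qone using that h2 by (simp add: S2_def norm_eq_1)
    finally show ?thesis using power2_eq_iff_nonneg[of "norm (h *\<^sub>R qone + r *\<^sub>R y)" 1] by (simp add: S3_def)
  qed
  show ?thesis unfolding h_def[symmetric]
  proof (intro set_eqI iffI)
    fix x assume "x \<in> f_r r ` (S3 \<times> S2)"
    then obtain p y where p: "p \<in> S3" "y \<in> S2" "x = (p, h *\<^sub>R qone + r *\<^sub>R y)"
      unfolding f_r_def h_def[symmetric] h by auto
    then show "x \<in> {x. fst x \<in> S3 \<and> snd x \<in> S3 \<and> Re (fst (snd x)) = h}"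
      using unit[OF p(2)] by (auto simp: S2_def)
  next
    fix x assume "x \<in> {x. fst x \<in> S3 \<and> snd x \<in> S3 \<and> Re (fst (snd x)) = h}"
    then have x: "fst x \<in> S3" "snd x \<in> S3" "Re (fst (snd x)) = h" by auto
    define d where "d = snd x - h *\<^sub>R qone"
    define y where "y = (1/r) *\<^sub>R d"
    have "(norm d)\<^sup>2 = snd x \<bullet> snd x - 2 * h * (qone \<bullet> snd x) + h\<^sup>2 * (qone \<bullet> qone)"
      unfolding d_def power2_norm_eq_inner inner_diff_left inner_diff_right inner_scaleR_left inner_scaleR_right
        inner_commute[of "snd x" qone] by (simp add: algebra_simps power2_eq_square)
    also have "\<dots> = r\<^sup>2" unfolding inner_qone using x h2 by (simp add: S3_def norm_eq_1 power2_eq_square)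
    finally have "norm d = r" using r by (simp add: power2_eq_iff_nonneg)
    then have "norm y = 1" using r by (simp add: y_def)
    moreover have "Re (fst y) = 0" by (simp add: y_def d_def x(3))
    ultimately have "y \<in> S2" by (simp add: S2_def)
    moreover have "x = f_r r (fst x, y)"
      unfolding f_r_def h_def[symmetric] h using r by (simp add: y_def d_def prod_eq_iff del: Product_Type.prod.inject)
    ultimately show "x \<in> f_r r ` (S3 \<times> S2)" using x by (metis SigmaI imageI)
  qed
qed

text \<open>On an open hemisphere, the component along the pole is the positive square root left
  over by Pythagoras.\<close>

lemma unit_inner_determined:
  fixes p p' p0 :: "'a::real_inner"
  assumes "norm p = norm p'" "p0 \<bullet> p > 0" "p0 \<bullet> p' > 0" "p - (p0 \<bullet> p) *\<^sub>R p0 = p' - (p0 \<bullet> p') *\<^sub>R p0" "norm p0 = 1"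
  shows "p = p'"
proof -
  have *: "(norm (p - (p0 \<bullet> p) *\<^sub>R p0))\<^sup>2 = (norm p)\<^sup>2 - (p0 \<bullet> p)\<^sup>2" for p
    using assms(5) unfolding power2_norm_eq_inner
    by (simp add: inner_diff_left inner_diff_right inner_commute[of p p0] norm_eq_1 power2_eq_square)
  have "(p0 \<bullet> p)\<^sup>2 = (p0 \<bullet> p')\<^sup>2" using *[of p] *[of p'] assms(1,4) by simp
  then have "p0 \<bullet> p = p0 \<bullet> p'" using assms(2,3) by (simp add: power2_eq_iff_nonneg)
  then show ?thesis using assms(4) by simp
qed

text \<open>Invariance of domain is applied between linear spaces of dimension 5, after flattening
  \<open>K\<close> near each point by projection to its tangent space. The bound on h keeps the
  second factor a genuine 2-sphere, so that the direction \<open>y0\<close> normal to it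
  exists.\<close>

lemma openin_S3_S2:
  fixes g :: "real^5 \<Rightarrow> pt"
  assumes K: "K = {x. fst x \<in> S3 \<and> snd x \<in> S3 \<and> Re (fst (snd x)) = h}" and h: "\<bar>h\<bar> < 1"
    and V: "open V" and g: "continuous_on V g" "inj_on g V" "g ` V \<subseteq> K"
  shows "openin (top_of_set K) (g ` V)"
proof (subst openin_subopen, intro ballI)
  fix x0 assume x0: "x0 \<in> g ` V"
  define p0 where "p0 = fst x0"
  define d where "d = snd x0 - h *\<^sub>R qone"
  have x0K: "norm p0 = 1" "norm (snd x0) = 1" "Re (fst (snd x0)) = h"
    using x0 g(3) by (auto simp: K S3_def p0_def)
  have "d \<noteq> 0"
  proof
    assume "d = 0"
    then have "norm (snd x0) = norm (h *\<^sub>R qone)" by (simp add: d_def del: scaleR_Pair)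
    also have "\<dots> = \<bar>h\<bar> * norm qone" by (rule norm_scaleR)
    finally show False using h x0K S3_norm[OF S3_qone] by simp
  qed
  define y0 where "y0 = (1 / norm d) *\<^sub>R d"
  have y0: "norm y0 = 1" "qim y0" using \<open>d \<noteq> 0\<close> x0K by (simp_all add: y0_def d_def)
  have dd: "snd x0 = h *\<^sub>R qone + norm d *\<^sub>R y0" using \<open>d \<noteq> 0\<close> by (simp add: y0_def d_def del: scaleR_Pair)
  txt \<open>Near \<open>x0\<close>, orthogonal projection to the tangent space \<open>T\<close> of \<open>K\<close> is injective on \<open>K\<close>.\<close>
  define T where "T = {z. (p0, 0) \<bullet> z = 0 \<and> (0, qone) \<bullet> z = 0 \<and> (0::quat, y0) \<bullet> z = 0}"
  have "qone \<bullet> y0 = 0" unfolding inner_qone by (rule y0)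
  have "dim T + 3 = DIM(pt)" unfolding T_def
  proof (rule dim_orthogonal_three)
    show "(p0, 0::quat) \<noteq> 0" using x0K by (metis fst_conv fst_zero norm_zero zero_neq_one)
    show "(0::quat, qone) \<noteq> 0" by (metis snd_conv snd_zero norm_zero zero_neq_one S3_norm S3_qone)
    show "(0::quat, y0) \<noteq> 0" using y0 by (metis snd_conv snd_zero norm_zero zero_neq_one)
  qed (simp_all only: inner_Pair inner_zero_left inner_zero_right \<open>qone \<bullet> y0 = 0\<close> add_0)
  then have dimT: "dim T = 5" by simp
  have subT: "subspace T" unfolding T_def by (auto simp: subspace_def inner_add_right)
  define \<pi> where "\<pi> x = (fst x - (p0 \<bullet> fst x) *\<^sub>R p0, snd x - (qone \<bullet> snd x) *\<^sub>R qone - (y0 \<bullet> snd x) *\<^sub>R y0)" for x :: pt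
  have \<pi>_cont: "continuous_on A \<pi>" for A unfolding \<pi>_def by (intro continuous_intros)
  have \<pi>T: "\<pi> x \<in> T" for x
  proof -
    have "p0 \<bullet> p0 = 1" "qone \<bullet> qone = 1" "y0 \<bullet> y0 = 1" "qone \<bullet> y0 = 0" "y0 \<bullet> qone = 0"
      using x0K y0 by (simp_all add: norm_eq_1 inner_qone)
    then show ?thesis
      unfolding T_def \<pi>_def mem_Collect_eq inner_Pair_left fst_conv snd_conv
        inner_diff_right inner_scaleR_right by simp
  qed
  \<comment> \<open>Both lost components, along \<open>p0\<close> and \<open>y0\<close>, are
    positive here, and a point of \<open>K\<close> can be reconstructed from its projection.\<close>
  define B where "B = {x::pt. p0 \<bullet> fst x > 0 \<and> y0 \<bullet> snd x > 0}"
  have openB: "open B" unfolding B_def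
    by (intro open_Collect_conj open_Collect_less continuous_intros)
  have "y0 \<bullet> snd x0 = norm d" unfolding dd inner_add_right inner_scaleR_right inner_qone using y0 by (simp add: norm_eq_1)
  then have x0B: "x0 \<in> B" using x0K \<open>d \<noteq> 0\<close> by (simp add: B_def p0_def norm_eq_1)
  have inj: "inj_on \<pi> (K \<inter> B)"
  proof (rule inj_onI)
    fix x x' assume x: "x \<in> K \<inter> B" "x' \<in> K \<inter> B" and eq: "\<pi> x = \<pi> x'"
    have n: "norm (fst x) = 1" "norm (snd x) = 1" "norm (fst x') = 1" "norm (snd x') = 1"
      "qone \<bullet> snd x = h" "qone \<bullet> snd x' = h"
      unfolding inner_qone using x by (simp_all add: K S3_def)
    have pos: "p0 \<bullet> fst x > 0" "y0 \<bullet> snd x > 0" "p0 \<bullet> fst x' > 0" "y0 \<bullet> snd x' > 0"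
      using x by (simp_all add: B_def)
    have "fst x = fst x'"
      by (rule unit_inner_determined[of _ _ p0]) (use n pos x0K eq in \<open>simp_all add: \<pi>_def\<close>)
    moreover have "snd x = snd x'"
    proof (rule unit_inner_determined[of _ _ y0])
      show "snd x - (y0 \<bullet> snd x) *\<^sub>R y0 = snd x' - (y0 \<bullet> snd x') *\<^sub>R y0"
        using eq unfolding \<pi>_def prod.inject n(5,6) by (simp add: algebra_simps del: scaleR_Pair)
    qed (use n pos y0 in simp_all)
    ultimately show "x = x'" by (simp add: prod_eq_iff)
  qed
  define V' where "V' = V \<inter> g -` B"
  have "open V'" unfolding V'_def using g(1) V openB by (rule continuous_open_preimage)
  have gV': "g ` V' \<subseteq> K \<inter> B" using g(3) by (auto simp: V'_def)
  have "openin (top_of_set T) ((\<pi> \<circ> g) ` V')"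
  proof (rule invariance_of_domain_subspaces[of UNIV])
    show "continuous_on V' (\<pi> \<circ> g)"
      using g(1) \<pi>_cont by (intro continuous_on_compose) (auto simp: V'_def intro: continuous_on_subset)
    show "inj_on (\<pi> \<circ> g) V'"
      using g(2) inj gV' by (intro comp_inj_on) (auto simp: V'_def intro: inj_on_subset)
    show "(\<pi> \<circ> g) \<in> V' \<rightarrow> T" using \<pi>T by auto
  qed (use \<open>open V'\<close> subT dimT in auto)
  then obtain C where C: "open C" "(\<pi> \<circ> g) ` V' = T \<inter> C" unfolding openin_open by blast
  have "open (B \<inter> \<pi> -` C)" using openB C(1) \<pi>_cont by (intro continuous_open_preimage) auto
  then have "openin (top_of_set K) (K \<inter> (B \<inter> \<pi> -` C))" by auto
  moreover have "x0 \<in> K \<inter> (B \<inter> \<pi> -` C)"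
  proof -
    obtain u where "u \<in> V'" "x0 = g u" using x0 x0B by (auto simp: V'_def)
    then have "\<pi> x0 \<in> (\<pi> \<circ> g) ` V'" by auto
    then show ?thesis using C x0 x0B g(3) by auto
  qed
  moreover have "K \<inter> (B \<inter> \<pi> -` C) \<subseteq> g ` V"
  proof
    fix x assume x: "x \<in> K \<inter> (B \<inter> \<pi> -` C)"
    then have "\<pi> x \<in> (\<pi> \<circ> g) ` V'" using C \<pi>T by auto
    then obtain u where u: "u \<in> V'" "\<pi> x = \<pi> (g u)" by auto
    then have "x = g u" using inj_onD[OF inj u(2)] x gV' by auto
    then show "x \<in> g ` V" using u by (auto simp: V'_def)
  qed
  ultimately show "\<exists>T. openin (top_of_set K) T \<and> x0 \<in> T \<and> T \<subseteq> g ` V" by blast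
qed

section \<open>Open pieces of the models\<close>

lemma Fabc_S3:
  assumes "a \<in> S3" "b \<in> S3" "c \<in> S3" "x \<in> S3 \<times> S3"
  shows "Fabc a b c x \<in> S3 \<times> S3"
  using assms by (auto simp: Fabc_def S3_qmul)

lemma inj_on_Fabc:
  assumes "a \<in> S3" "b \<in> S3" "c \<in> S3"
  shows "inj_on (Fabc a b c) (S3 \<times> S3)"
proof (rule inj_on_inverseI[of _ "Fabc (qconj a) (qconj b) (qconj c)"])
  show "Fabc (qconj a) (qconj b) (qconj c) (Fabc a b c x) = x" for x
    using assms by (simp add: Fabc_def qmul_assoc)
qed

text \<open>\<open>G\<close> stands for the identity, \<open>F1\<close> or \<open>F2\<close>, each
  an involution of \<open>S3 \<times> S3\<close>. Applying it again moves all three models to the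
  single set \<open>K\<close>, where openness is checked; as a homeomorphism it carries openness
  back.\<close>

lemma hypersurface_openin_image:
  assumes M: "hypersurface M" and abc: "a \<in> S3" "b \<in> S3" "c \<in> S3" and r: "0 < r" "r \<le> 1"
    and G: "continuous_on UNIV G" "\<And>x. x \<in> S3 \<times> S3 \<Longrightarrow> G (G x) = x"
    and sub: "\<And>x. x \<in> M \<Longrightarrow> G (Fabc a b c x) \<in> f_r r ` (S3 \<times> S2)"
  shows "Fabc a b c ` M \<subseteq> (G \<circ> f_r r) ` (S3 \<times> S2) \<and>
    openin (top_of_set ((G \<circ> f_r r) ` (S3 \<times> S2))) (Fabc a b c ` M)"
proof -
  define K where "K = f_r r ` (S3 \<times> S2)"
  have K: "K = {x. fst x \<in> S3 \<and> snd x \<in> S3 \<and> Re (fst (snd x)) = sqrt (1 - r\<^sup>2)}"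
    unfolding K_def by (rule f_r_image[OF r])
  have h: "\<bar>sqrt (1 - r\<^sup>2)\<bar> < 1" using r by (simp add: power_le_one)
  have KS: "K \<subseteq> S3 \<times> S3" unfolding K by auto
  have MS: "M \<subseteq> S3 \<times> S3" using M by (simp add: hypersurface_def)
  define \<Theta> where "\<Theta> = G \<circ> Fabc a b c"
  have \<Theta>K: "\<Theta> ` M \<subseteq> K" using sub by (auto simp: \<Theta>_def K_def)
  have F: "Fabc a b c x = G (\<Theta> x)" if "x \<in> M" for x
  proof -
    have "x \<in> S3 \<times> S3" using that MS by blast
    then show ?thesis by (simp only: \<Theta>_def o_apply G(2)[OF Fabc_S3[OF abc]])
  qed
  have "inj_on G (S3 \<times> S3)" using G(2) by (rule inj_on_inverseI)
  moreover have "Fabc a b c ` M \<subseteq> S3 \<times> S3" using Fabc_S3[OF abc] MS by blast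
  ultimately have \<Theta>_inj: "inj_on \<Theta> M"
    unfolding \<Theta>_def using inj_on_subset[OF inj_on_Fabc[OF abc] MS] by (metis comp_inj_on inj_on_subset)
  have "continuous_on UNIV (Fabc a b c)" unfolding Fabc_def
    by (intro continuous_intros bounded_bilinear.continuous_on[OF bounded_bilinear_qmul])
  then have \<Theta>_cont: "continuous_on A \<Theta>" for A
    unfolding \<Theta>_def using G(1) by (meson continuous_on_compose continuous_on_subset subset_UNIV)
  have "openin (top_of_set K) (\<Theta> ` M)"
  proof (subst openin_subopen, intro ballI)
    fix y assume "y \<in> \<Theta> ` M"
    then obtain x where x: "x \<in> M" "y = \<Theta> x" by auto
    obtain \<phi> V where c: "is_chart M \<phi> V" "x \<in> \<phi> ` V" using M x(1) unfolding hypersurface_def by blast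
    then have V: "open V" "inj_on \<phi> V" "\<phi> ` V \<subseteq> M" "smooth_on V \<phi>" unfolding is_chart_def by auto
    have "continuous_on V \<phi>"
      using V(1) smooth_on_has_derivative[OF V(4,1)]
      by (meson continuous_at_imp_continuous_on has_derivative_continuous)
    then have "continuous_on V (\<Theta> \<circ> \<phi>)" using \<Theta>_cont by (rule continuous_on_compose)
    moreover have "inj_on (\<Theta> \<circ> \<phi>) V" using V(2) inj_on_subset[OF \<Theta>_inj V(3)] by (rule comp_inj_on)
    moreover have "(\<Theta> \<circ> \<phi>) ` V \<subseteq> K" using \<Theta>K V(3) unfolding image_comp[symmetric] by blast
    ultimately have "openin (top_of_set K) ((\<Theta> \<circ> \<phi>) ` V)" by (rule openin_S3_S2[OF K h V(1)])
    then show "\<exists>T. openin (top_of_set K) T \<and> y \<in> T \<and> T \<subseteq> \<Theta> ` M"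
      using x c(2) V(3) by (intro exI[of _ "(\<Theta> \<circ> \<phi>) ` V"]) (auto simp: image_comp[symmetric])
  qed
  moreover have "homeomorphism K (G ` K) G G"
  proof -
    have "G (G y) = y" if "y \<in> K" for y using G(2) KS that by blast
    then show ?thesis
      by (intro homeomorphismI continuous_on_subset[OF G(1)]) (simp_all add: image_subset_iff, metis imageE)
  qed
  ultimately have "openin (top_of_set (G ` K)) (G ` \<Theta> ` M)"
    by (rule homeomorphism_imp_open_map[rotated])
  moreover have "G ` \<Theta> ` M = Fabc a b c ` M" using F by (auto simp: image_image)
  moreover have "G ` K = (G \<circ> f_r r) ` (S3 \<times> S2)" by (simp add: K_def image_comp)
  ultimately show ?thesis by (metis openin_imp_subset)
qed

text \<open>From c = N - l Q come <Q, c> = -l and |c|^2 = 1 + l^2. Hence Q lies in a sphere of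
  radius r = 1/|c| about a multiple of c, and left multiplication by \<open>qconj e\<close> turns
  that axis to 1.\<close>

lemma (in gauss_hypersurface) slice:
  assumes "connected M" "M \<noteq> {}"
  obtains e r where "e \<in> S3" "0 < r" "r \<le> 1" "\<And>x. x \<in> M \<Longrightarrow> Re (fst (qmul (qconj e) (Q x))) = sqrt (1 - r\<^sup>2)"
proof -
  obtain l c where lc: "\<And>x. x \<in> M \<Longrightarrow> N x = l *\<^sub>R Q x + c" using umbilic_global[OF assms(1)] by blast
  have Qc: "Q x \<bullet> c = - l" "c \<bullet> c = 1 + l\<^sup>2" if x: "x \<in> M" for x
  proof -
    have QQ: "Q x \<bullet> Q x = 1" "N x \<bullet> N x = 1" using unit[OF x] by (simp_all add: norm_eq_1)
    have c: "c = N x - l *\<^sub>R Q x" using lc[OF x] by simp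
    show "Q x \<bullet> c = - l" "c \<bullet> c = 1 + l\<^sup>2" unfolding c using QQ unit(3)[OF x]
      by (simp_all add: inner_diff_left inner_diff_right inner_commute[of "N x" "Q x"] power2_eq_square)
  qed
  have cc: "c \<bullet> c = 1 + l\<^sup>2" using Qc assms(2) by blast
  \<comment> \<open>The sign makes the height of the slice |l| / |c|, matching the nonnegative root
    in \<open>f_r\<close>.\<close>
  define \<sigma> :: real where "\<sigma> = (if l \<le> 0 then 1 else - 1)"
  define e where "e = (\<sigma> / norm c) *\<^sub>R c"
  define r where "r = 1 / norm c"
  have nc2: "(norm c)\<^sup>2 = 1 + l\<^sup>2" using cc by (simp add: power2_norm_eq_inner)
  then have nc: "norm c \<ge> 1" by (metis le_add_same_cancel1 norm_ge_zero one_power2 power2_le_imp_le zero_le_power2)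
  have "e \<in> S3" using nc by (auto simp: S3_def e_def \<sigma>_def)
  moreover have "0 < r" "r \<le> 1" using nc by (auto simp: r_def divide_simps)
  moreover have "Re (fst (qmul (qconj e) (Q x))) = sqrt (1 - r\<^sup>2)" if x: "x \<in> M" for x
  proof -
    have "1 - r\<^sup>2 = (\<bar>l\<bar> / norm c)\<^sup>2"
      using add_pos_nonneg[of 1 "l\<^sup>2"] by (simp add: r_def power_divide nc2 field_simps)
    then have "sqrt (1 - r\<^sup>2) = \<bar>l\<bar> / norm c" using nc by simp
    moreover have "Re (fst (qmul (qconj e) (Q x))) = e \<bullet> Q x"
      unfolding inner_qone(2)[symmetric] inner_commute[of qone] inner_qmul_swap(1) by (simp add: inner_commute)
    moreover have "e \<bullet> Q x = \<sigma> * (- l) / norm c" using Qc(1)[OF x] by (simp add: e_def inner_commute[of c])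
    ultimately show ?thesis by (simp add: \<sigma>_def)
  qed
  ultimately show ?thesis using that by blast
qed

theorem theorem1p2:
  fixes M :: "pt set" and \<xi> :: "pt \<Rightarrow> pt"
  assumes "hypersurface M" and "connected M"
    and "unit_normal M \<xi>"
    and "hopf M \<xi>"
    and "\<forall>x\<in>M. card (principal_curvatures M \<xi> x) = 3"
    and "\<forall>x\<in>M. Pnk x ` holo_distr M \<xi> x = holo_distr M \<xi> x"
  shows "\<exists>a b c r f. a \<in> S3 \<and> b \<in> S3 \<and> c \<in> S3 \<and> 0 < r \<and> r \<le> 1 \<and>
           f \<in> {f_r r, F1 \<circ> f_r r, F2 \<circ> f_r r} \<and>
           Fabc a b c ` M \<subseteq> f ` (S3 \<times> S2) \<and>
           openin (top_of_set (f ` (S3 \<times> S2))) (Fabc a b c ` M)"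
proof (cases "M = {}")
  case True
  then show ?thesis
    by (intro exI[of _ qone] exI[of _ 1] exI[of _ "f_r 1"]) simp
next
  case False
  interpret P_hypersurface M \<xi>
    using assms by unfold_locales auto
  have card: "card (principal_curvatures M \<xi> x) = 3" if "x \<in> M" for x using assms(5) that by blast
  have MS: "fst x \<in> S3" "snd x \<in> S3" if "x \<in> M" for x using M_S3[OF that] by auto
  consider
      "\<forall>x\<in>M. \<exists>n. qim n \<and> norm n = 1 \<and> \<xi> x = lift x ((1/2) *\<^sub>R n) n"
    | "\<forall>x\<in>M. \<exists>n. qim n \<and> norm n = 1 \<and> \<xi> x = lift x n ((1/2) *\<^sub>R n)"
    | "\<forall>x\<in>M. \<exists>n. qim n \<and> norm n = 1 \<and> \<xi> x = lift x (- (1/2) *\<^sub>R n) ((1/2) *\<^sub>R n)"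
    using normal_cases_global[OF assms(2)] by blast
  then show ?thesis
  proof cases
    case 1
    interpret g: gauss_hypersurface M \<xi> snd "\<lambda>x. snd (\<xi> x)"
      by (rule gauss_snd) (use card 1 in blast)+
    obtain e r where e: "e \<in> S3" "0 < r" "r \<le> 1"
      "\<And>x. x \<in> M \<Longrightarrow> Re (fst (qmul (qconj e) (snd x))) = sqrt (1 - r\<^sup>2)"
      using g.slice[OF assms(2) False] by blast
    \<comment> \<open>The rotation taking \<open>e\<close> to 1 acts on q from the left, so it is
      the parameter \<open>b\<close> of an isometry \<open>Fabc\<close>; the involution is the
      identity.\<close>
    have "Fabc qone (qconj e) qone ` M \<subseteq> ((\<lambda>x. x) \<circ> f_r r) ` (S3 \<times> S2) \<and>
      openin (top_of_set (((\<lambda>x. x) \<circ> f_r r) ` (S3 \<times> S2))) (Fabc qone (qconj e) qone ` M)"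
      using e MS by (intro hypersurface_openin_image[OF assms(1)])
        (simp_all add: f_r_image Fabc_def S3_qmul)
    then show ?thesis using e
      by (intro exI[of _ qone] exI[of _ "qconj e"] exI[of _ r] exI[of _ "f_r r"]) (simp add: o_def)
  next
    case 2
    interpret g: gauss_hypersurface M \<xi> fst "\<lambda>x. fst (\<xi> x)"
      by (rule gauss_fst) (use card 2 in blast)+
    obtain e r where e: "e \<in> S3" "0 < r" "r \<le> 1"
      "\<And>x. x \<in> M \<Longrightarrow> Re (fst (qmul (qconj e) (fst x))) = sqrt (1 - r\<^sup>2)"
      using g.slice[OF assms(2) False] by blast
    \<comment> \<open>The slice now restricts p, so the rotation sits in the first parameter and
      \<open>F1\<close> moves the condition to the second factor.\<close>
    have "continuous_on UNIV F1" unfolding F1_def by (intro continuous_intros)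
    then have "Fabc (qconj e) qone qone ` M \<subseteq> (F1 \<circ> f_r r) ` (S3 \<times> S2) \<and>
      openin (top_of_set ((F1 \<circ> f_r r) ` (S3 \<times> S2))) (Fabc (qconj e) qone qone ` M)"
      using e MS by (intro hypersurface_openin_image[OF assms(1)])
        (auto simp add: f_r_image Fabc_def S3_qmul F1_def)
    then show ?thesis using e
      by (intro exI[of _ qone] exI[of _ "qconj e"] exI[of _ r] exI[of _ "F1 \<circ> f_r r"]) simp
  next
    case 3
    interpret g: gauss_hypersurface M \<xi> "\<lambda>x. qmul (snd x) (qconj (fst x))" "\<lambda>x. 2 *\<^sub>R qmul (snd (\<xi> x)) (qconj (fst x))"
      by (rule gauss_quotient) (use card 3 in blast)+
    obtain e r where e: "e \<in> S3" "0 < r" "r \<le> 1"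
      "\<And>x. x \<in> M \<Longrightarrow> Re (fst (qmul (qconj e) (qmul (snd x) (qconj (fst x))))) = sqrt (1 - r\<^sup>2)"
      using g.slice[OF assms(2) False] by blast
    \<comment> \<open>\<open>F2\<close> places q p^{-1} in the second factor, and left
      multiplication of q passes through it unchanged.\<close>
    have "continuous_on UNIV F2" unfolding F2_def
      by (intro continuous_intros bounded_bilinear.continuous_on[OF bounded_bilinear_qmul]
        bounded_linear.continuous_on[OF bounded_linear_qconj])
    then have "Fabc qone (qconj e) qone ` M \<subseteq> (F2 \<circ> f_r r) ` (S3 \<times> S2) \<and>
      openin (top_of_set ((F2 \<circ> f_r r) ` (S3 \<times> S2))) (Fabc qone (qconj e) qone ` M)"
      using e MS by (intro hypersurface_openin_image[OF assms(1)])
        (auto simp add: f_r_image Fabc_def S3_qmul F2_def qmul_assoc)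
    then show ?thesis using e
      by (intro exI[of _ qone] exI[of _ "qconj e"] exI[of _ r] exI[of _ "F2 \<circ> f_r r"]) simp
  qed
qed

end
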